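(* Let $(\mathcal{M},\mathcal{F})$ be a complex foliation, let $f$ be a smooth function on $\mathcal{M}$, and let $\mathcal{U}=\{U,V\}$ be an open cover of $\mathcal{M}$. Then, for every $p$, there is a long exact sequence $$\cdots\rightarrow H^{p,q-1}_f(\mathcal{F}|_{U\cap V})\rightarrow H^{p,q}_f(\mathcal{F})\stackrel{A}{\rightarrow}H^{p,q}_f(\mathcal{F}|_U)\oplus H^{p,q}_f(\mathcal{F}|_V)\stackrel{B}{\rightarrow}H^{p,q}_f(\mathcal{F}|_{U\cap V})\rightarrow\cdots,$$ where $A([\varphi])=([\varphi|_U],[\varphi|_V])$ for $[\varphi]\in H^{p,q}_f(\mathcal{F})$, and $B([\sigma_U],[\tau_V])=[\sigma_U|_{U\cap V}-\tau_V|_{U\cap V}]$ for $([\sigma_U],[\tau_V])\in H^{p,q}_f(\mathcal{F}|_U)\oplus H^{p,q}_f(\mathcal{F}|_V)$.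
   Context: Complex foliation: $\mathcal{M}$ is a smooth manifold of dimension $2m+n$ with a foliation $\mathcal{F}$ of codimension $n$, defined by an open cover $\{U_i\}_{i\in I}$ of $\mathcal{M}$ and diffeomorphisms $\phi_i:\Omega_i\times\mathcal{O}_i\to U_i$ ($\Omega_i$ an open polydisc in $\mathbb{C}^m$, $\mathcal{O}_i$ an open ball in $\mathbb{R}^n$) such that, whenever $U_i\cap U_j\neq\emptyset$, the coordinate change $\phi_j^{-1}\circ\phi_i$ has the form $(z',x')=(\phi_{ij}^1(z,x),\phi_{ij}^2(x))$ with $\phi_{ij}^1(z,x)$ holomorphic in $z$ for fixed $x$. The leaves, locally given by $x=$ const, are complex manifolds of dimension $m$. The coordinates $(z,x)=(z^1,\ldots,z^m,x^1,\ldots,x^n)$ on $U_i$ given by $\phi_i^{-1}:U_i\to\Omega_i\times\mathcal{O}_i$ are called adapted. Foliated forms: $\Omega^{p,q}(\mathcal{F})$ is the space of foliated (leafwise) differential forms of type $(p,q)$, written in adapted coordinates as $\varphi=\sum\varphi_{A_p\overline{B}_q}(z,x)\,dz^{A_p}\wedge d\overline{z}^{B_q}$ with smooth complex-valued coefficients, where $dz^a,d\overline{z}^a$ are regarded as forms along the leaves (sections of the exterior algebra of the dual of $T\mathcal{F}\otimes\mathbb{C}$). It is $0$ unless $0\le p,q\le m$. The operator $\overline{\partial}_{\mathcal{F}}:\Omega^{p,q}(\mathcal{F})\to\Omega^{p,q+1}(\mathcal{F})$ is $\overline{\partial}_{\mathcal{F}}\varphi=\sum_{a=1}^m\sum\frac{\partial\varphi_{A_p\overline{B}_q}}{\partial\overline{z}^a}\,d\overline{z}^a\wedge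 dz^{A_p}\wedge d\overline{z}^{B_q}$. Smooth functions on $\mathcal{M}$ may be taken complex-valued. For a smooth function $f$ on $\mathcal{M}$, define $\overline{\partial}_{\mathcal{F},f}:\Omega^{p,q}(\mathcal{F})\to\Omega^{p,q+1}(\mathcal{F})$ by $\overline{\partial}_{\mathcal{F},f}\varphi=f\,\overline{\partial}_{\mathcal{F}}\varphi-(p+q)\,\overline{\partial}_{\mathcal{F}}f\wedge\varphi$. It satisfies $\overline{\partial}_{\mathcal{F},f}^2=0$. For fixed $p$, $H^{p,q}_f(\mathcal{F})$ denotes the degree-$q$ cohomology of the complex $0\to\Omega^{p,0}(\mathcal{F})\to\Omega^{p,1}(\mathcal{F})\to\cdots\to\Omega^{p,m}(\mathcal{F})\to0$ with differential $\overline{\partial}_{\mathcal{F},f}$. For an open subset $W\subset\mathcal{M}$, $\mathcal{F}|_W$ is the complex foliation induced on $W$, and $H^{p,q}_f(\mathcal{F}|_W)$ is the degree-$q$ cohomology of the complex $0\to\Omega^{p,0}(\mathcal{F}|_W)\to\Omega^{p,1}(\mathcal{F}|_W)\to\cdots\to\Omega^{p,m}(\mathcal{F}|_W)\to0$ of foliated forms on $(W,\mathcal{F}|_W)$, with differential $\overline{\partial}_{\mathcal{F}|_W,f|_W}$ defined by the restricted function $f|_W$. *)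

theory Defs
  imports "HOL-Analysis.Analysis" "HOL-Algebra.Coset"
begin

section \<open>Smooth functions on open subsets of \<open>\<complex>\<^sup>m \<times> \<real>\<^sup>n\<close>\<close>

text \<open>
  The dimensions \<open>m\<close>, \<open>n\<close> are natural numbers (zero allowed).  As for \<^const>\<open>Euclidean_space\<close>,
  vectors are sequences that vanish beyond the dimension: \<open>\<complex>\<^sup>m \<times> \<real>\<^sup>n\<close> is the set of all pairs
  \<open>(z, t)\<close> with \<open>z a = 0\<close> for \<open>a \<ge> m\<close> and \<open>t b = 0\<close> for \<open>b \<ge> n\<close>.  On this set the product topology
  of the function types is the Euclidean topology.  Indices start at 0.
\<close>

type_synonym model = "(nat \<Rightarrow> complex) \<times> (nat \<Rightarrow> real)"

definition model_space :: "nat \<Rightarrow> nat \<Rightarrow> model set" where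
  "model_space m n = {z. \<forall>a\<ge>m. z a = 0} \<times> {t. \<forall>b\<ge>n. t b = 0}"

datatype coord = ReZ nat | ImZ nat | RealX nat

definition coords :: "nat \<Rightarrow> nat \<Rightarrow> coord set" where
  "coords m n = ReZ ` {..<m} \<union> ImZ ` {..<m} \<union> RealX ` {..<n}"

fun shift :: "coord \<Rightarrow> real \<Rightarrow> model \<Rightarrow> model" where
  "shift (ReZ a) s (z, t) = (z(a := z a + of_real s), t)"
| "shift (ImZ a) s (z, t) = (z(a := z a + \<i> * of_real s), t)"
| "shift (RealX b) s (z, t) = (z, t(b := t b + s))"

definition pderiv_at :: "coord \<Rightarrow> (model \<Rightarrow> complex) \<Rightarrow> model \<Rightarrow> complex" where
  "pderiv_at k g y = vector_derivative (\<lambda>s. g (shift k s y)) (at 0)"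

text \<open>
  \<open>C_k m n r S g\<close>: all partial derivatives of \<open>g\<close> of order at most \<open>r\<close> exist and are continuous
  on \<open>S\<close>, a (relatively) open subset of \<^term>\<open>model_space m n\<close>.
\<close>

primrec C_k :: "nat \<Rightarrow> nat \<Rightarrow> nat \<Rightarrow> model set \<Rightarrow> (model \<Rightarrow> complex) \<Rightarrow> bool" where
  "C_k m n 0 S g \<longleftrightarrow> continuous_on S g"
| "C_k m n (Suc r) S g \<longleftrightarrow> continuous_on S g \<and>
     (\<forall>k\<in>coords m n. (\<forall>y\<in>S. (\<lambda>s. g (shift k s y)) differentiable (at 0)) \<and>
                     C_k m n r S (pderiv_at k g))"

definition smooth_on :: "nat \<Rightarrow> nat \<Rightarrow> model set \<Rightarrow> (model \<Rightarrow> complex) \<Rightarrow> bool" where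
  "smooth_on m n S g \<longleftrightarrow> (\<forall>r. C_k m n r S g)"

definition d_dz :: "nat \<Rightarrow> (model \<Rightarrow> complex) \<Rightarrow> model \<Rightarrow> complex" where
  "d_dz a g y = (pderiv_at (ReZ a) g y - \<i> * pderiv_at (ImZ a) g y) / 2"

definition d_dzbar :: "nat \<Rightarrow> (model \<Rightarrow> complex) \<Rightarrow> model \<Rightarrow> complex" where
  "d_dzbar a g y = (pderiv_at (ReZ a) g y + \<i> * pderiv_at (ImZ a) g y) / 2"


section \<open>Complex foliations\<close>

definition polydisc :: "nat \<Rightarrow> (nat \<Rightarrow> complex) set \<Rightarrow> bool" where
  "polydisc m \<Omega> \<longleftrightarrow> (\<exists>c r. (\<forall>a<m. r a > 0) \<and>
     \<Omega> = {z. (\<forall>a\<ge>m. z a = 0) \<and> (\<forall>a<m. cmod (z a - c a) < r a)})"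

definition open_ball :: "nat \<Rightarrow> (nat \<Rightarrow> real) set \<Rightarrow> bool" where
  "open_ball n O' \<longleftrightarrow> (\<exists>c r. r > 0 \<and>
     O' = {t. (\<forall>b\<ge>n. t b = 0) \<and> sqrt (\<Sum>b<n. (t b - c b)\<^sup>2) < r})"

definition disc_ball :: "nat \<Rightarrow> nat \<Rightarrow> model set \<Rightarrow> bool" where
  "disc_ball m n D \<longleftrightarrow> (\<exists>\<Omega> O'. polydisc m \<Omega> \<and> open_ball n O' \<and> D = \<Omega> \<times> O')"

text \<open>
  A chart is a pair of its domain \<open>\<Omega> \<times> O\<close> and the parametrization \<open>\<phi>\<close>, which goes from the
  domain to the manifold and is only meaningful on the domain.
\<close>

type_synonym 'a chart = "model set \<times> (model \<Rightarrow> 'a)"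

definition chart_image :: "'a chart \<Rightarrow> 'a set" where
  "chart_image c = snd c ` fst c"

definition adapted :: "'a chart \<Rightarrow> 'a \<Rightarrow> model" where
  "adapted c = inv_into (fst c) (snd c)"

text \<open>
  The domain \<open>\<phi>\<^sub>i\<inverse> (U\<^sub>i \<inter> U\<^sub>j)\<close> of the coordinate change \<open>\<phi>\<^sub>j\<inverse> \<circ> \<phi>\<^sub>i\<close>.
\<close>

definition overlap :: "'a chart \<Rightarrow> 'a chart \<Rightarrow> model set" where
  "overlap c c' = {y \<in> fst c. snd c y \<in> chart_image c'}"

definition transition :: "'a chart \<Rightarrow> 'a chart \<Rightarrow> model \<Rightarrow> model" where
  "transition c c' = adapted c' \<circ> snd c"

record 'a foliated =
  cdim :: nat
  codim :: nat
  mtop :: "'a topology"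
  charts :: "'a chart set"

text \<open>
  The smooth structure of the manifold is the one generated by the charts, i.e. the only one for
  which all parametrizations are diffeomorphisms onto their (open) images; this is why the
  coordinate changes are required to be smooth.  Since a coordinate change is in particular
  continuous, holomorphy in \<open>z\<close> is holomorphy in each single \<open>z\<^sup>b\<close>.
\<close>

definition complex_foliation :: "'a foliated \<Rightarrow> bool" where
  "complex_foliation F \<longleftrightarrow>
     (let m = cdim F; n = codim F; X = mtop F in
       Hausdorff_space X \<and> second_countable X \<and>
       (\<forall>c\<in>charts F. disc_ball m n (fst c) \<and> openin X (chart_image c) \<and>
          homeomorphic_map (top_of_set (fst c)) (subtopology X (chart_image c)) (snd c)) \<and>
       (\<Union>c\<in>charts F. chart_image c) = topspace X \<and>
       (\<forall>c\<in>charts F. \<forall>c'\<in>charts F.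
          (\<forall>a<m. smooth_on m n (overlap c c') (\<lambda>y. fst (transition c c' y) a)) \<and>
          (\<forall>b<n. smooth_on m n (overlap c c') (\<lambda>y. of_real (snd (transition c c' y) b))) \<and>
          (\<forall>a<m. \<forall>b<m. \<forall>z t. (\<lambda>w. fst (transition c c' (z(b := w), t)) a)
             holomorphic_on {w. (z(b := w), t) \<in> overlap c c'}) \<and>
          (\<exists>h. \<forall>y\<in>overlap c c'. snd (transition c c' y) = h (snd y))))"

text \<open>
  The foliation induced on an open set \<open>W\<close>: as domains must again be products of a polydisc and
  a ball, the adapted charts are all restrictions of adapted charts to such products that are
  mapped into \<open>W\<close>.
\<close>

definition restrict_foliation :: "'a foliated \<Rightarrow> 'a set \<Rightarrow> 'a foliated" where
  "restrict_foliation F W = F\<lparr>mtop := subtopology (mtop F) W,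
     charts := {(D, \<phi>). \<exists>E. (E, \<phi>) \<in> charts F \<and> D \<subseteq> E \<and>
                  disc_ball (cdim F) (codim F) D \<and> \<phi> ` D \<subseteq> W}\<rparr>"

definition smooth_function :: "'a foliated \<Rightarrow> ('a \<Rightarrow> complex) \<Rightarrow> bool" where
  "smooth_function F f \<longleftrightarrow>
     (\<forall>c\<in>charts F. smooth_on (cdim F) (codim F) (fst c) (f \<circ> snd c))"

definition smooth_near :: "'a foliated \<Rightarrow> 'a \<Rightarrow> ('a \<Rightarrow> complex) \<Rightarrow> bool" where
  "smooth_near F x f \<longleftrightarrow> (\<exists>N. openin (mtop F) N \<and> x \<in> N \<and>
     (\<forall>c\<in>charts F. smooth_on (cdim F) (codim F) {y \<in> fst c. snd c y \<in> N} (f \<circ> snd c)))"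


section \<open>Leafwise tangent vectors\<close>

text \<open>
  Complexified tangent vectors are derivations of (germs of) smooth complex functions; as total
  functions they are set to 0 on functions that are not smooth near the base point.  The vectors
  \<open>\<partial>/\<partial>z\<^sup>a\<close>, \<open>\<partial>/\<partial>zbar\<^sup>a\<close> of the adapted charts span the complexified tangent space of the leaf.
\<close>

type_synonym 'a tvec = "('a \<Rightarrow> complex) \<Rightarrow> complex"

definition vec_dz :: "'a foliated \<Rightarrow> 'a chart \<Rightarrow> nat \<Rightarrow> model \<Rightarrow> 'a tvec" where
  "vec_dz F c a y f = (if smooth_near F (snd c y) f then d_dz a (f \<circ> snd c) y else 0)"

definition vec_dzbar :: "'a foliated \<Rightarrow> 'a chart \<Rightarrow> nat \<Rightarrow> model \<Rightarrow> 'a tvec" where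
  "vec_dzbar F c a y f = (if smooth_near F (snd c y) f then d_dzbar a (f \<circ> snd c) y else 0)"

definition leaf_tangent :: "'a foliated \<Rightarrow> 'a \<Rightarrow> 'a tvec set" where
  "leaf_tangent F x =
     {X. \<exists>c\<in>charts F. \<exists>y\<in>fst c. snd c y = x \<and>
        (\<exists>v w. X = (\<lambda>f. \<Sum>a<cdim F. v a * vec_dz F c a y f + w a * vec_dzbar F c a y f))}"


section \<open>Foliated forms\<close>

text \<open>
  A form assigns to a point \<open>x\<close> an alternating form on \<^term>\<open>leaf_tangent F x\<close>, whose arguments
  are given as a list.  To make forms extensional, they vanish outside the manifold, on lists of
  the wrong length, and on lists with entries that are not in \<^term>\<open>leaf_tangent F x\<close>.

  The exterior product uses the determinant convention, i.e.\ \<open>(\<alpha>\<^sub>1 \<and> \<dots> \<and> \<alpha>\<^sub>k)(X\<^sub>1, \<dots>, X\<^sub>k)\<close> is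
  the determinant of the \<open>\<alpha>\<^sub>i(X\<^sub>j)\<close>; only products with a 1-form on the left are needed, and
  \<open>wedge1\<close> is Laplace expansion along the first row.
\<close>

type_synonym 'a cform = "'a \<Rightarrow> 'a tvec list \<Rightarrow> complex"

definition wedge1 :: "('v \<Rightarrow> complex) \<Rightarrow> ('v list \<Rightarrow> complex) \<Rightarrow> 'v list \<Rightarrow> complex" where
  "wedge1 \<alpha> \<omega> Xs =
     (\<Sum>i<length Xs. (-1) ^ i * \<alpha> (Xs ! i) * \<omega> (take i Xs @ drop (Suc i) Xs))"

definition wedge_list :: "('v \<Rightarrow> complex) list \<Rightarrow> 'v list \<Rightarrow> complex" where
  "wedge_list \<alpha>s = foldr wedge1 \<alpha>s (\<lambda>Xs. if Xs = [] then 1 else 0)"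

text \<open>
  The covectors \<open>dz\<^sup>a\<close> and \<open>dzbar\<^sup>a\<close>: the differential of a function \<open>u\<close> maps \<open>X\<close> to \<open>X u\<close>.
\<close>

definition cov_dz :: "'a chart \<Rightarrow> nat \<Rightarrow> 'a tvec \<Rightarrow> complex" where
  "cov_dz c a X = X (\<lambda>x. fst (adapted c x) a)"

definition cov_dzbar :: "'a chart \<Rightarrow> nat \<Rightarrow> 'a tvec \<Rightarrow> complex" where
  "cov_dzbar c a X = X (\<lambda>x. cnj (fst (adapted c x) a))"

text \<open>
  Multi-indices are the subsets of \<open>{0, \<dots>, m-1}\<close>, listed in increasing order.
\<close>

definition mindex :: "'a foliated \<Rightarrow> nat \<Rightarrow> nat set set" where
  "mindex F p = {A. A \<subseteq> {..<cdim F} \<and> card A = p}"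

definition dzA_dzbarB :: "'a chart \<Rightarrow> nat set \<Rightarrow> nat set \<Rightarrow> 'a tvec list \<Rightarrow> complex" where
  "dzA_dzbarB c A B =
     wedge_list (map (cov_dz c) (sorted_list_of_set A) @ map (cov_dzbar c) (sorted_list_of_set B))"

text \<open>
  The coefficient \<open>\<phi>\<^sub>A\<^sub>B\<close> in the coordinates of \<open>c\<close>, i.e. the value of the form on the dual frame.
\<close>

definition coefficient ::
    "'a foliated \<Rightarrow> 'a chart \<Rightarrow> 'a cform \<Rightarrow> nat set \<Rightarrow> nat set \<Rightarrow> model \<Rightarrow> complex" where
  "coefficient F c \<phi> A B y =
     \<phi> (snd c y) (map (\<lambda>a. vec_dz F c a y) (sorted_list_of_set A) @
                  map (\<lambda>b. vec_dzbar F c b y) (sorted_list_of_set B))"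

definition foliated_forms :: "'a foliated \<Rightarrow> nat \<Rightarrow> nat \<Rightarrow> 'a cform set" where
  "foliated_forms F p q =
     {\<phi>. (\<forall>x Xs. \<not> (x \<in> topspace (mtop F) \<and> set Xs \<subseteq> leaf_tangent F x) \<longrightarrow> \<phi> x Xs = 0) \<and>
         (\<forall>c\<in>charts F.
            (\<forall>A\<in>mindex F p. \<forall>B\<in>mindex F q.
               smooth_on (cdim F) (codim F) (fst c) (coefficient F c \<phi> A B)) \<and>
            (\<forall>y\<in>fst c. \<forall>Xs. set Xs \<subseteq> leaf_tangent F (snd c y) \<longrightarrow>
               \<phi> (snd c y) Xs =
                 (\<Sum>A\<in>mindex F p. \<Sum>B\<in>mindex F q. coefficient F c \<phi> A B y * dzA_dzbarB c A B Xs)))}"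

text \<open>
  The coordinate formula for \<open>\<partial>bar\<^sub>F\<close> is evaluated in an arbitrary adapted chart around the point;
  the result does not depend on the chart.
\<close>

definition dbar_in_chart ::
    "'a foliated \<Rightarrow> nat \<Rightarrow> nat \<Rightarrow> 'a chart \<Rightarrow> 'a cform \<Rightarrow> 'a cform" where
  "dbar_in_chart F p q c \<phi> x =
     (\<lambda>Xs. \<Sum>a<cdim F. \<Sum>A\<in>mindex F p. \<Sum>B\<in>mindex F q.
        d_dzbar a (coefficient F c \<phi> A B) (adapted c x) *
          wedge1 (cov_dzbar c a) (dzA_dzbarB c A B) Xs)"

definition dbar :: "'a foliated \<Rightarrow> nat \<Rightarrow> nat \<Rightarrow> 'a cform \<Rightarrow> 'a cform" where
  "dbar F p q \<phi> x Xs =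
     (if x \<in> topspace (mtop F) \<and> set Xs \<subseteq> leaf_tangent F x
      then dbar_in_chart F p q (SOME c. c \<in> charts F \<and> x \<in> chart_image c) \<phi> x Xs else 0)"

definition function_form :: "'a foliated \<Rightarrow> ('a \<Rightarrow> complex) \<Rightarrow> 'a cform" where
  "function_form F f x Xs = (if x \<in> topspace (mtop F) \<and> Xs = [] then f x else 0)"

definition dbar_f ::
    "'a foliated \<Rightarrow> ('a \<Rightarrow> complex) \<Rightarrow> nat \<Rightarrow> nat \<Rightarrow> 'a cform \<Rightarrow> 'a cform" where
  "dbar_f F f p q \<phi> x Xs =
     f x * dbar F p q \<phi> x Xs -
     of_nat (p + q) * wedge1 (\<lambda>X. dbar F 0 0 (function_form F f) x [X]) (\<phi> x) Xs"

definition restrict_form :: "'a set \<Rightarrow> 'a cform \<Rightarrow> 'a cform" where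
  "restrict_form W \<phi> x Xs = (if x \<in> W then \<phi> x Xs else 0)"

definition add_form :: "'a cform \<Rightarrow> 'a cform \<Rightarrow> 'a cform" where
  "add_form \<phi> \<psi> x Xs = \<phi> x Xs + \<psi> x Xs"

definition diff_form :: "'a cform \<Rightarrow> 'a cform \<Rightarrow> 'a cform" where
  "diff_form \<phi> \<psi> x Xs = \<phi> x Xs - \<psi> x Xs"

definition scale_form :: "complex \<Rightarrow> 'a cform \<Rightarrow> 'a cform" where
  "scale_form k \<phi> x Xs = k * \<phi> x Xs"

definition zero_form :: "'a cform" where
  "zero_form x Xs = 0"


section \<open>Cohomology\<close>

definition cocycles :: "'a foliated \<Rightarrow> ('a \<Rightarrow> complex) \<Rightarrow> nat \<Rightarrow> nat \<Rightarrow> 'a cform set" where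
  "cocycles F f p q = {\<phi> \<in> foliated_forms F p q. dbar_f F f p q \<phi> = zero_form}"

fun coboundaries :: "'a foliated \<Rightarrow> ('a \<Rightarrow> complex) \<Rightarrow> nat \<Rightarrow> nat \<Rightarrow> 'a cform set" where
  "coboundaries F f p 0 = {zero_form}"
| "coboundaries F f p (Suc q) = dbar_f F f p q ` foliated_forms F p q"

definition cocycle_group ::
    "'a foliated \<Rightarrow> ('a \<Rightarrow> complex) \<Rightarrow> nat \<Rightarrow> nat \<Rightarrow> 'a cform monoid" where
  "cocycle_group F f p q = \<lparr>carrier = cocycles F f p q, mult = add_form, one = zero_form\<rparr>"

definition cohomology ::
    "'a foliated \<Rightarrow> ('a \<Rightarrow> complex) \<Rightarrow> nat \<Rightarrow> nat \<Rightarrow> 'a cform set monoid" where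
  "cohomology F f p q = cocycle_group F f p q Mod coboundaries F f p q"

definition coh_class ::
    "'a foliated \<Rightarrow> ('a \<Rightarrow> complex) \<Rightarrow> nat \<Rightarrow> nat \<Rightarrow> 'a cform \<Rightarrow> 'a cform set" where
  "coh_class F f p q \<phi> = coboundaries F f p q #>\<^bsub>cocycle_group F f p q\<^esub> \<phi>"

end

theory Submission
  imports Defs "HOL-Library.Function_Algebras"
begin

text \<open>
  Restriction gives a sequence of complexes
  \<open>0 \<rightarrow> \<Omega>(F) \<rightarrow> \<Omega>(F|U) \<oplus> \<Omega>(F|V) \<rightarrow> \<Omega>(F|U \<inter> V) \<rightarrow> 0\<close>, and the theorem is its long exact cohomology sequence.
  Exactness on the right comes from a smooth function \<open>\<mu>\<close> that vanishes near \<open>U - V\<close> and equals 1 near \<open>V - U\<close>: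
  a form \<open>\<sigma>\<close> on \<open>U \<inter> V\<close> is the difference of \<open>\<mu>\<sigma>\<close> and \<open>(\<mu> - 1)\<sigma>\<close>, extended by zero to \<open>U\<close> and \<open>V\<close>.
  That the operators form complexes and commute with restriction is checked in the frame of a chart, where
  \<open>\<partial>bar\<close> is the antisymmetrized derivative of the component functions. It does not depend on the chart, since it is a
  derivation annihilating \<open>dz\<^sup>a\<close> and \<open>dzbar\<^sup>a\<close> of every adapted chart, and it squares to zero because partial derivatives commute.
\<close>

section \<open>The Mayer-Vietoris sequence of cochain complexes\<close>

text \<open>The obstacle is that a restricted foliation has other charts than \<open>F\<close>,
  hence formally other tangent spaces, other forms, and a \<open>dbar\<close> evaluated in other
  chosen charts. All four complexes are therefore described through the charts of \<open>F\<close>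
  alone: \<open>Frm W\<close> for the forms over an open set \<open>W\<close>, and
  \<open>is_d W\<close> for an operator whose expression in every chart is \<open>twisted_d\<close>.
  Both descriptions are local, so that restriction, gluing and extension by zero take place inside
  one type of total functions. Tangent vectors are derivations at a point and cannot be held fixed
  while the point moves; \<open>pull\<close> replaces them by component lists in the frame of a
  chart. On such lists the exterior derivative and the product with a 1-form are both signed sums
  over the removed entry (\<open>alt_sum\<close>), which make sense for arbitrary functionals on
  lists. The weight \<open>p + q\<close> of the operator matters for its square, where the growth by
  one per degree makes the mixed terms cancel.\<close>

locale cochain_complex =
  fixes C :: "nat \<Rightarrow> 'b::ab_group_add set" and d :: "nat \<Rightarrow> 'b \<Rightarrow> 'b"
  assumes zero_in: "0 \<in> C q"
    and add_in: "x \<in> C q \<Longrightarrow> y \<in> C q \<Longrightarrow> x + y \<in> C q"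
    and uminus_in: "x \<in> C q \<Longrightarrow> - x \<in> C q"
    and d_in: "x \<in> C q \<Longrightarrow> d q x \<in> C (Suc q)"
    and d_add: "x \<in> C q \<Longrightarrow> y \<in> C q \<Longrightarrow> d q (x + y) = d q x + d q y"
    and d_d: "x \<in> C q \<Longrightarrow> d (Suc q) (d q x) = 0"
begin

definition Z :: "nat \<Rightarrow> 'b set" where "Z q = {x \<in> C q. d q x = 0}"

definition B :: "nat \<Rightarrow> 'b set" where "B q = (case q of 0 \<Rightarrow> {0} | Suc r \<Rightarrow> d r ` C r)"

definition G :: "nat \<Rightarrow> 'b monoid" where "G q = \<lparr>carrier = Z q, mult = (+), one = 0\<rparr>"

definition H :: "nat \<Rightarrow> 'b set monoid" where "H q = G q Mod B q"

definition cls :: "nat \<Rightarrow> 'b \<Rightarrow> 'b set" where "cls q x = B q #>\<^bsub>G q\<^esub> x"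

lemma diff_in: "x \<in> C q \<Longrightarrow> y \<in> C q \<Longrightarrow> x - y \<in> C q"
  using add_in[OF _ uminus_in, of x q y] by simp

lemma d_0: "d q 0 = 0"
  using d_add[OF zero_in zero_in, of q] by simp

lemma d_uminus: "x \<in> C q \<Longrightarrow> d q (- x) = - d q x"
  using d_add[OF _ uminus_in, of x q x] d_0[of q] by (simp add: eq_neg_iff_add_eq_0 add.commute)

lemma d_diff: "x \<in> C q \<Longrightarrow> y \<in> C q \<Longrightarrow> d q (x - y) = d q x - d q y"
  using d_add[OF _ uminus_in, of x q y] d_uminus[of y q] by simp

lemma Z_closed: "0 \<in> Z q" "x \<in> Z q \<Longrightarrow> y \<in> Z q \<Longrightarrow> x + y \<in> Z q" "x \<in> Z q \<Longrightarrow> - x \<in> Z q"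
  "x \<in> Z q \<Longrightarrow> y \<in> Z q \<Longrightarrow> x - y \<in> Z q"
  by (auto simp: Z_def zero_in d_0 add_in d_add uminus_in d_uminus diff_in d_diff)

lemma d_in_B: "x \<in> C q \<Longrightarrow> d q x \<in> B (Suc q)"
  by (simp add: B_def)

lemma B_closed: "0 \<in> B q" "x \<in> B q \<Longrightarrow> y \<in> B q \<Longrightarrow> x + y \<in> B q" "x \<in> B q \<Longrightarrow> - x \<in> B q"
proof -
  show "0 \<in> B q" using imageI[OF zero_in, of "d (q - 1)" "q - 1"] by (cases q) (simp_all add: B_def d_0)
  show "x \<in> B q \<Longrightarrow> y \<in> B q \<Longrightarrow> x + y \<in> B q"
    by (cases q) (auto simp: B_def d_add[symmetric] intro!: imageI add_in)
  show "x \<in> B q \<Longrightarrow> - x \<in> B q"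
    by (cases q) (auto simp: B_def d_uminus[symmetric] intro!: imageI uminus_in)
qed

lemma B_Z: "B q \<subseteq> Z q"
  by (cases q) (auto simp: B_def Z_def zero_in d_0 d_in d_d)

lemma comm_group_G: "comm_group (G q)"
proof (rule comm_groupI)
  fix x assume "x \<in> carrier (G q)"
  then show "\<exists>y\<in>carrier (G q). y \<otimes>\<^bsub>G q\<^esub> x = \<one>\<^bsub>G q\<^esub>"
    using Z_closed(3) by (intro bexI[of _ "- x"]) (simp_all add: G_def)
qed (simp_all add: G_def Z_closed add.assoc add.commute)

lemma inv_G: "x \<in> Z q \<Longrightarrow> inv\<^bsub>G q\<^esub> x = - x"
  by (rule group.inv_equality[OF comm_group.axioms(2)[OF comm_group_G]]) (simp_all add: G_def Z_closed(3))

lemma subgroup_B: "subgroup (B q) (G q)"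
proof (rule group.subgroupI[OF comm_group.axioms(2)[OF comm_group_G]])
  show "B q \<noteq> {}" using B_closed(1) by blast
  show "inv\<^bsub>G q\<^esub> x \<in> B q" if "x \<in> B q" for x using inv_G[OF subsetD[OF B_Z that]] B_closed(3)[OF that] by simp
qed (use B_Z B_closed(2) in \<open>auto simp: G_def\<close>)

lemma normal_B: "B q \<lhd> G q"
  by (rule comm_group.subgroup_imp_normal[OF comm_group_G subgroup_B])

lemma comm_group_H: "comm_group (H q)"
  unfolding H_def by (rule comm_group.abelian_FactGroup[OF comm_group_G subgroup_B])

lemma group_H: "group (H q)"
  by (rule comm_group.axioms(2)[OF comm_group_H])

lemma carrier_H: "carrier (H q) = cls q ` Z q"
  by (simp add: H_def carrier_FactGroup cls_def[abs_def] G_def)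

lemma cls_in: "x \<in> Z q \<Longrightarrow> cls q x \<in> carrier (H q)"
  by (simp add: carrier_H)

lemma cls_add: "x \<in> Z q \<Longrightarrow> y \<in> Z q \<Longrightarrow> cls q x \<otimes>\<^bsub>H q\<^esub> cls q y = cls q (x + y)"
  using normal.rcos_sum[OF normal_B, of x q y] by (simp add: H_def cls_def G_def)

lemma cls_eq_set: "cls q x = (\<lambda>b. b + x) ` B q"
  by (auto simp: cls_def r_coset_def G_def)

lemma cls_eq_iff: "cls q x = cls q y \<longleftrightarrow> x - y \<in> B q"
proof
  assume "cls q x = cls q y"
  moreover have "x \<in> cls q x" unfolding cls_eq_set using B_closed(1)[of q] by force
  ultimately obtain b where "b \<in> B q" "x = b + y" unfolding cls_eq_set by blast
  then show "x - y \<in> B q" by simp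
next
  have sub: "cls q x \<subseteq> cls q y" if "x - y \<in> B q" for x y
  proof
    fix z assume "z \<in> cls q x"
    then obtain b where b: "b \<in> B q" "z = b + x" unfolding cls_eq_set by blast
    then have "b + (x - y) \<in> B q" "z = (b + (x - y)) + y" using that B_closed(2) by simp_all
    then show "z \<in> cls q y" unfolding cls_eq_set by blast
  qed
  assume h: "x - y \<in> B q"
  then have "y - x \<in> B q" using B_closed(3)[OF h] by simp
  then show "cls q x = cls q y" using sub h by blast
qed

lemma one_H: "\<one>\<^bsub>H q\<^esub> = cls q 0"
  by (simp add: H_def cls_eq_set)

lemma cls_eq_one_iff: "cls q x = \<one>\<^bsub>H q\<^esub> \<longleftrightarrow> x \<in> B q"
  by (simp add: one_H cls_eq_iff)

text \<open>All maps of the sequence descend to cohomology through this form of the universal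
  property of the quotient. Additivity is asked for only in \<open>K\<close>, so \<open>g\<close>
  may come from choices that are additive up to coboundaries, as happens for the connecting
  map.\<close>

lemma lift:
  assumes K: "group K" and g: "\<And>x. x \<in> Z q \<Longrightarrow> g x \<in> carrier K"
    and add: "\<And>x y. x \<in> Z q \<Longrightarrow> y \<in> Z q \<Longrightarrow> g (x + y) = g x \<otimes>\<^bsub>K\<^esub> g y"
    and B: "\<And>x. x \<in> B q \<Longrightarrow> g x = \<one>\<^bsub>K\<^esub>"
  shows "\<exists>h. group_hom (H q) K h \<and> (\<forall>x\<in>Z q. h (cls q x) = g x)"
proof -
  have hom: "g \<in> hom (G q) K" by (rule homI) (simp_all add: G_def g add)
  have eq: "g x = g y" if x: "x \<in> carrier (G q)" and y: "y \<in> carrier (G q)" and e: "B q #>\<^bsub>G q\<^esub> x = B q #>\<^bsub>G q\<^esub> y" for x y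
  proof -
    have xy: "x \<in> Z q" "y \<in> Z q" using x y by (simp_all add: G_def)
    have b: "x - y \<in> B q" using e cls_eq_iff by (simp add: cls_def)
    have "g x = g ((x - y) + y)" by simp
    also have "\<dots> = g (x - y) \<otimes>\<^bsub>K\<^esub> g y" by (rule add[OF Z_closed(4)[OF xy] xy(2)])
    also have "\<dots> = g y" using B[OF b] g[OF xy(2)] group.is_monoid[OF K] by (simp add: monoid.l_one)
    finally show ?thesis .
  qed
  obtain h where h: "h \<in> hom (G q Mod B q) K" "\<And>x. x \<in> carrier (G q) \<Longrightarrow> h (B q #>\<^bsub>G q\<^esub> x) = g x"
    using FactGroup_universal[OF hom normal_B eq] by blast
  have "group_hom (H q) K h" using h(1) group_H K by (simp add: group_hom_def group_hom_axioms_def H_def)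
  moreover have "\<forall>x\<in>Z q. h (cls q x) = g x" using h(2) by (simp add: cls_def G_def)
  ultimately show ?thesis by blast
qed

end

text \<open>The short exact sequence stated on elements: \<open>r_inj\<close> is exactness on the
  left, \<open>s_r\<close> and \<open>glue\<close> in the middle, \<open>split\<close> on the right.
  One map \<open>s\<close> serves both open sets, since restriction of a form to the intersection is
  the same operation in both cases. The scaling \<open>sc\<close> is carried along to make the
  connecting map complex linear.\<close>

locale mayer_vietoris =
  M: cochain_complex CM dM + U: cochain_complex CU dU + V: cochain_complex CV dV + I: cochain_complex CI dI
  for CM CU CV CI :: "nat \<Rightarrow> 'b::ab_group_add set" and dM dU dV dI +
  fixes rU rV s :: "'b \<Rightarrow> 'b" and sc :: "'k \<Rightarrow> 'b \<Rightarrow> 'b"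
  assumes r_in: "x \<in> CM q \<Longrightarrow> rU x \<in> CU q" "x \<in> CM q \<Longrightarrow> rV x \<in> CV q"
    and s_in: "x \<in> CU q \<Longrightarrow> s x \<in> CI q" "x \<in> CV q \<Longrightarrow> s x \<in> CI q"
    and r_add: "rU (x + y) = rU x + rU y" "rV (x + y) = rV x + rV y" and s_add: "s (x + y) = s x + s y"
    and r_d: "x \<in> CM q \<Longrightarrow> rU (dM q x) = dU q (rU x)" "x \<in> CM q \<Longrightarrow> rV (dM q x) = dV q (rV x)"
    and s_d: "x \<in> CU q \<Longrightarrow> s (dU q x) = dI q (s x)" "x \<in> CV q \<Longrightarrow> s (dV q x) = dI q (s x)"
    and s_r: "x \<in> CM q \<Longrightarrow> s (rU x) = s (rV x)"
    and r_inj: "x \<in> CM q \<Longrightarrow> rU x = 0 \<Longrightarrow> rV x = 0 \<Longrightarrow> x = 0"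
    and glue: "a \<in> CU q \<Longrightarrow> b \<in> CV q \<Longrightarrow> s a = s b \<Longrightarrow> \<exists>x\<in>CM q. rU x = a \<and> rV x = b"
    and split: "c \<in> CI q \<Longrightarrow> \<exists>a\<in>CU q. \<exists>b\<in>CV q. c = s a - s b"
    and sc_in: "x \<in> CM q \<Longrightarrow> sc k x \<in> CM q" "x \<in> CU q \<Longrightarrow> sc k x \<in> CU q" "x \<in> CV q \<Longrightarrow> sc k x \<in> CV q"
      "x \<in> CI q \<Longrightarrow> sc k x \<in> CI q"
    and sc_add: "sc k (x + y) = sc k x + sc k y"
    and sc_d: "x \<in> CM q \<Longrightarrow> dM q (sc k x) = sc k (dM q x)" "x \<in> CU q \<Longrightarrow> dU q (sc k x) = sc k (dU q x)"
      "x \<in> CV q \<Longrightarrow> dV q (sc k x) = sc k (dV q x)" "x \<in> CI q \<Longrightarrow> dI q (sc k x) = sc k (dI q x)"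
    and sc_r: "rU (sc k x) = sc k (rU x)" "rV (sc k x) = sc k (rV x)" "s (sc k x) = sc k (s x)"
begin

lemma additive_diff:
  fixes f :: "'b \<Rightarrow> 'b"
  assumes add: "\<And>x y. f (x + y) = f x + f y"
  shows "f 0 = 0" "f (- x) = - f x" "f (x - y) = f x - f y"
proof -
  show 0: "f 0 = 0" using add[of 0 0] by simp
  have 1: "f (- x) = - f x" for x using add[of "- x" x] 0 by (simp add: eq_neg_iff_add_eq_0)
  show "f (- x) = - f x" by (rule 1)
  show "f (x - y) = f x - f y" using add[of x "- y"] 1[of y] by simp
qed

lemmas rU_diff = additive_diff[of rU, OF r_add(1)]
lemmas rV_diff = additive_diff[of rV, OF r_add(2)]
lemmas s_diff = additive_diff[of s, OF s_add]
lemmas sc_diff = additive_diff[of "sc k" for k, OF sc_add]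

lemma r_Z: "x \<in> M.Z q \<Longrightarrow> rU x \<in> U.Z q" "x \<in> M.Z q \<Longrightarrow> rV x \<in> V.Z q"
  using r_in[of x q] r_d[of x q] by (simp_all add: M.Z_def U.Z_def V.Z_def rU_diff(1) rV_diff(1))

lemma s_Z: "x \<in> U.Z q \<Longrightarrow> s x \<in> I.Z q" "x \<in> V.Z q \<Longrightarrow> s x \<in> I.Z q"
  using s_in[of x q] s_d[of x q] by (simp_all add: I.Z_def U.Z_def V.Z_def s_diff(1))

lemma r_B:
  assumes "x \<in> M.B q"
  shows "rU x \<in> U.B q" "rV x \<in> V.B q"
proof -
  have "rU x \<in> U.B q \<and> rV x \<in> V.B q"
  proof (cases q)
    case 0
    then show ?thesis using assms by (simp add: M.B_def U.B_def V.B_def rU_diff(1) rV_diff(1))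
  next
    case (Suc r)
    then obtain y where y: "y \<in> CM r" "x = dM r y" using assms by (auto simp: M.B_def)
    show ?thesis unfolding Suc y(2) r_d(1)[OF y(1)] r_d(2)[OF y(1)]
      by (rule conjI[OF U.d_in_B[OF r_in(1)[OF y(1)]] V.d_in_B[OF r_in(2)[OF y(1)]]])
  qed
  then show "rU x \<in> U.B q" "rV x \<in> V.B q" by simp_all
qed

lemma s_B: "x \<in> U.B q \<Longrightarrow> s x \<in> I.B q" "x \<in> V.B q \<Longrightarrow> s x \<in> I.B q"
proof -
  show "s x \<in> I.B q" if "x \<in> U.B q"
    using that by (cases q) (auto simp: I.B_def U.B_def s_diff(1) s_d(1) intro: s_in)
  show "s x \<in> I.B q" if "x \<in> V.B q"
    using that by (cases q) (auto simp: I.B_def V.B_def s_diff(1) s_d(2) intro: s_in)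
qed

text \<open>Split a primitive of \<open>c\<close> and differentiate the two pieces; in degree 0 the
  only coboundary is 0.\<close>

lemma B_split:
  assumes "c \<in> I.B q"
  shows "\<exists>a\<in>U.B q. \<exists>b\<in>V.B q. c = s a - s b"
proof (cases q)
  case 0
  then show ?thesis using assms by (simp add: I.B_def U.B_def V.B_def s_diff(1))
next
  case (Suc r)
  then obtain e where e: "e \<in> CI r" "c = dI r e" using assms by (auto simp: I.B_def)
  obtain a b where ab: "a \<in> CU r" "b \<in> CV r" "e = s a - s b" using split[OF e(1)] by blast
  have "c = s (dU r a) - s (dV r b)"
    unfolding s_d(1)[OF ab(1)] s_d(2)[OF ab(2)] e(2) ab(3) by (rule I.d_diff[OF s_in(1)[OF ab(1)] s_in(2)[OF ab(2)]])
  then show ?thesis using U.d_in_B[OF ab(1)] V.d_in_B[OF ab(2)] Suc by blast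
qed

text \<open>The zigzag of the snake lemma, kept as a relation because the splitting
  \<open>a\<close>, \<open>b\<close> of \<open>c\<close> is not unique; only the class of
  \<open>w\<close> is.\<close>

definition conn :: "nat \<Rightarrow> 'b \<Rightarrow> 'b \<Rightarrow> bool" where
  "conn q c w \<longleftrightarrow> (\<exists>a\<in>CU q. \<exists>b\<in>CV q. c = s a - s b \<and> w \<in> CM (Suc q) \<and> rU w = dU q a \<and> rV w = dV q b)"

lemma connI: "a \<in> CU q \<Longrightarrow> b \<in> CV q \<Longrightarrow> c = s a - s b \<Longrightarrow> w \<in> CM (Suc q) \<Longrightarrow> rU w = dU q a \<Longrightarrow> rV w = dV q b \<Longrightarrow> conn q c w"
  unfolding conn_def by blast

lemma conn_total:
  assumes "c \<in> I.Z q"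
  shows "\<exists>w. conn q c w"
proof -
  have c: "c \<in> CI q" "dI q c = 0" using assms by (simp_all add: I.Z_def)
  obtain a b where ab: "a \<in> CU q" "b \<in> CV q" "c = s a - s b" using split[OF c(1)] by blast
  have "dI q c = dI q (s a) - dI q (s b)" unfolding ab(3) by (rule I.d_diff[OF s_in(1)[OF ab(1)] s_in(2)[OF ab(2)]])
  \<comment> \<open>Closedness of \<open>c\<close> is exactly what lets the two derivatives be
    glued.\<close>
  then have "s (dU q a) = s (dV q b)" using c(2) s_d(1)[OF ab(1)] s_d(2)[OF ab(2)] by simp
  from glue[OF U.d_in[OF ab(1)] V.d_in[OF ab(2)] this]
  obtain w where "w \<in> CM (Suc q)" "rU w = dU q a" "rV w = dV q b" by blast
  then show ?thesis using connI[OF ab] by blast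
qed

lemma conn_Z:
  assumes "conn q c w"
  shows "w \<in> M.Z (Suc q)"
proof -
  obtain a b where ab: "a \<in> CU q" "b \<in> CV q" "w \<in> CM (Suc q)" "rU w = dU q a" "rV w = dV q b"
    using assms unfolding conn_def by blast
  have "dM (Suc q) w = 0"
    by (rule r_inj[OF M.d_in[OF ab(3)]])
       (simp_all add: r_d[OF ab(3)] ab(4,5) U.d_d[OF ab(1)] V.d_d[OF ab(2)])
  then show ?thesis using ab(3) by (simp add: M.Z_def)
qed

lemma conn_add:
  assumes "conn q c w" "conn q c' w'"
  shows "conn q (c + c') (w + w')"
proof -
  obtain a b where ab: "a \<in> CU q" "b \<in> CV q" "c = s a - s b" "w \<in> CM (Suc q)" "rU w = dU q a" "rV w = dV q b"
    using assms(1) unfolding conn_def by blast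
  obtain a' b' where ab': "a' \<in> CU q" "b' \<in> CV q" "c' = s a' - s b'" "w' \<in> CM (Suc q)" "rU w' = dU q a'" "rV w' = dV q b'"
    using assms(2) unfolding conn_def by blast
  show ?thesis
    by (rule connI[OF U.add_in[OF ab(1) ab'(1)] V.add_in[OF ab(2) ab'(2)] _ M.add_in[OF ab(4) ab'(4)]])
       (simp_all add: ab ab' s_add r_add U.d_add V.d_add)
qed

lemma conn_scale:
  assumes "conn q c w"
  shows "conn q (sc k c) (sc k w)"
proof -
  obtain a b where ab: "a \<in> CU q" "b \<in> CV q" "c = s a - s b" "w \<in> CM (Suc q)" "rU w = dU q a" "rV w = dV q b"
    using assms unfolding conn_def by blast
  show ?thesis
    by (rule connI[OF sc_in(2)[OF ab(1)] sc_in(3)[OF ab(2)] _ sc_in(1)[OF ab(4)]])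
       (simp_all add: ab(3,5,6) sc_diff(3) sc_r sc_d(2)[OF ab(1)] sc_d(3)[OF ab(2)])
qed

text \<open>If \<open>c\<close> also splits into coboundaries \<open>a0\<close>, \<open>b0\<close>,
  then \<open>a - a0\<close> and \<open>b - b0\<close> agree on the intersection, and they still
  have the derivatives of \<open>a\<close> and \<open>b\<close>, because \<open>a0\<close> and
  \<open>b0\<close> are closed. They glue to a primitive of \<open>w\<close>.\<close>

lemma conn_B:
  assumes c: "c \<in> I.B q" and w: "conn q c w"
  shows "w \<in> M.B (Suc q)"
proof -
  obtain a b where ab: "a \<in> CU q" "b \<in> CV q" "c = s a - s b" "w \<in> CM (Suc q)" "rU w = dU q a" "rV w = dV q b"
    using w unfolding conn_def by blast
  obtain a0 b0 where ab0: "a0 \<in> U.B q" "b0 \<in> V.B q" "c = s a0 - s b0" using B_split[OF c] by blast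
  have z: "a0 \<in> CU q" "dU q a0 = 0" "b0 \<in> CV q" "dV q b0 = 0"
    using ab0 U.B_Z V.B_Z by (auto simp: U.Z_def V.Z_def)
  have "s (a - a0) = s (b - b0)" using ab(3) ab0(3) by (simp add: s_diff(3) algebra_simps)
  from glue[OF U.diff_in[OF ab(1) z(1)] V.diff_in[OF ab(2) z(3)] this]
  obtain x where x: "x \<in> CM q" "rU x = a - a0" "rV x = b - b0" by blast
  have "w - dM q x = 0"
    by (rule r_inj[OF M.diff_in[OF ab(4) M.d_in[OF x(1)]]])
       (simp_all add: rU_diff(3) rV_diff(3) r_d[OF x(1)] x ab U.d_diff[OF ab(1) z(1)] V.d_diff[OF ab(2) z(3)] z)
  then show ?thesis using M.d_in_B[OF x(1)] by simp
qed

text \<open>By additivity the difference is connected to 0, and \<open>conn_B\<close> applies to the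
  coboundary 0.\<close>

lemma conn_unique:
  assumes "conn q c w" "conn q c w'"
  shows "w - w' \<in> M.B (Suc q)"
proof -
  obtain a b where ab: "a \<in> CU q" "b \<in> CV q" "c = s a - s b" "w' \<in> CM (Suc q)" "rU w' = dU q a" "rV w' = dV q b"
    using assms(2) unfolding conn_def by blast
  have "conn q (- c) (- w')"
    by (rule connI[OF U.uminus_in[OF ab(1)] V.uminus_in[OF ab(2)] _ M.uminus_in[OF ab(4)]])
       (simp_all add: ab s_diff rU_diff rV_diff U.d_uminus V.d_uminus)
  from conn_add[OF assms(1) this] have "conn q 0 (w - w')" by simp
  then show ?thesis by (rule conn_B[OF I.B_closed(1)])
qed

text \<open>The connecting map comes from an arbitrary choice of connected forms, which
  \<open>conn_unique\<close> makes additive on classes. Its compatibility with \<open>sc\<close> is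
  a separate clause because group homomorphisms are only additive; for \<open>A\<close> and
  \<open>B\<close> it can be read off from their values on classes.\<close>

lemma exact_sequence:
  "\<exists>A B \<delta>.
    (\<forall>q. group_hom (M.H q) (U.H q \<times>\<times> V.H q) (A q) \<and>
         group_hom (U.H q \<times>\<times> V.H q) (I.H q) (B q) \<and>
         group_hom (I.H q) (M.H (Suc q)) (\<delta> q)) \<and>
    (\<forall>q. \<forall>x\<in>M.Z q. A q (M.cls q x) = (U.cls q (rU x), V.cls q (rV x))) \<and>
    (\<forall>q. \<forall>a\<in>U.Z q. \<forall>b\<in>V.Z q. B q (U.cls q a, V.cls q b) = I.cls q (s a - s b)) \<and>
    (\<forall>q k. \<forall>c\<in>I.Z q. \<forall>w\<in>M.Z (Suc q). \<delta> q (I.cls q c) = M.cls (Suc q) w \<longrightarrow>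
       \<delta> q (I.cls q (sc k c)) = M.cls (Suc q) (sc k w)) \<and>
    kernel (M.H 0) (U.H 0 \<times>\<times> V.H 0) (A 0) = {\<one>\<^bsub>M.H 0\<^esub>} \<and>
    (\<forall>q. A q ` carrier (M.H q) = kernel (U.H q \<times>\<times> V.H q) (I.H q) (B q) \<and>
         B q ` carrier (U.H q \<times>\<times> V.H q) = kernel (I.H q) (M.H (Suc q)) (\<delta> q) \<and>
         \<delta> q ` carrier (I.H q) = kernel (M.H (Suc q)) (U.H (Suc q) \<times>\<times> V.H (Suc q)) (A (Suc q)))"
proof -
  have gUV: "group (U.H q \<times>\<times> V.H q)" for q by (rule DirProd_group[OF U.group_H V.group_H])
  have "\<exists>h. group_hom (M.H q) (U.H q \<times>\<times> V.H q) h \<and> (\<forall>x\<in>M.Z q. h (M.cls q x) = (U.cls q (rU x), V.cls q (rV x)))" for q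
    by (rule M.lift[OF gUV])
       (simp_all add: r_Z U.cls_in V.cls_in r_add U.cls_add V.cls_add r_B U.cls_eq_one_iff V.cls_eq_one_iff)
  then obtain A where A: "\<And>q. group_hom (M.H q) (U.H q \<times>\<times> V.H q) (A q)"
    "\<And>q x. x \<in> M.Z q \<Longrightarrow> A q (M.cls q x) = (U.cls q (rU x), V.cls q (rV x))" by metis
  have "\<exists>h. group_hom (U.H q) (I.H q) h \<and> (\<forall>x\<in>U.Z q. h (U.cls q x) = I.cls q (s x))" for q
    by (rule U.lift[OF I.group_H]) (simp_all add: s_Z I.cls_in s_add I.cls_add s_B I.cls_eq_one_iff)
  then obtain B1 where B1: "\<And>q x. x \<in> U.Z q \<Longrightarrow> B1 q (U.cls q x) = I.cls q (s x)" by metis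
  have "\<exists>h. group_hom (V.H q) (I.H q) h \<and> (\<forall>x\<in>V.Z q. h (V.cls q x) = I.cls q (- s x))" for q
    by (rule V.lift[OF I.group_H])
       (simp_all add: s_Z I.Z_closed I.cls_in s_add I.cls_add s_B I.B_closed(3) I.cls_eq_one_iff add.commute)
  then obtain B2 where B2: "\<And>q x. x \<in> V.Z q \<Longrightarrow> B2 q (V.cls q x) = I.cls q (- s x)" by metis
  \<comment> \<open>\<open>lift\<close> handles one quotient at a time, so \<open>B\<close> is
    assembled from its two components, the minus sign being part of \<open>B2\<close>.\<close>
  define B where "B = (\<lambda>q (S, T). B1 q S \<otimes>\<^bsub>I.H q\<^esub> B2 q T)"
  have Bcls: "B q (U.cls q a, V.cls q b) = I.cls q (s a - s b)" if "a \<in> U.Z q" "b \<in> V.Z q" for q a b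
    using that by (simp add: B_def B1 B2 I.cls_add s_Z I.Z_closed)
  have cUV: "\<exists>a\<in>U.Z q. \<exists>b\<in>V.Z q. S = (U.cls q a, V.cls q b)" if "S \<in> carrier (U.H q \<times>\<times> V.H q)" for S q
    using that by (auto simp: U.carrier_H V.carrier_H)
  have Bhom: "group_hom (U.H q \<times>\<times> V.H q) (I.H q) (B q)" for q
  proof -
    have "B q \<in> hom (U.H q \<times>\<times> V.H q) (I.H q)"
    proof (rule homI)
      fix S T assume S: "S \<in> carrier (U.H q \<times>\<times> V.H q)" and T: "T \<in> carrier (U.H q \<times>\<times> V.H q)"
      obtain a b where ab: "a \<in> U.Z q" "b \<in> V.Z q" "S = (U.cls q a, V.cls q b)" using cUV[OF S] by blast
      obtain a' b' where ab': "a' \<in> U.Z q" "b' \<in> V.Z q" "T = (U.cls q a', V.cls q b')" using cUV[OF T] by blast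
      show "B q S \<in> carrier (I.H q)" unfolding ab(3) Bcls[OF ab(1,2)]
        by (rule I.cls_in[OF I.Z_closed(4)[OF s_Z(1)[OF ab(1)] s_Z(2)[OF ab(2)]]])
      have "S \<otimes>\<^bsub>U.H q \<times>\<times> V.H q\<^esub> T = (U.cls q (a + a'), V.cls q (b + b'))"
        by (simp add: ab ab' U.cls_add V.cls_add)
      then have "B q (S \<otimes>\<^bsub>U.H q \<times>\<times> V.H q\<^esub> T) = I.cls q (s (a + a') - s (b + b'))"
        using Bcls[OF U.Z_closed(2)[OF ab(1) ab'(1)] V.Z_closed(2)[OF ab(2) ab'(2)]] by simp
      also have "s (a + a') - s (b + b') = (s a - s b) + (s a' - s b')" by (simp add: s_add)
      also have "I.cls q \<dots> = B q S \<otimes>\<^bsub>I.H q\<^esub> B q T"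
        unfolding ab(3) ab'(3) Bcls[OF ab(1,2)] Bcls[OF ab'(1,2)]
        by (rule I.cls_add[OF I.Z_closed(4)[OF s_Z(1)[OF ab(1)] s_Z(2)[OF ab(2)]]
              I.Z_closed(4)[OF s_Z(1)[OF ab'(1)] s_Z(2)[OF ab'(2)]], symmetric])
      finally show "B q (S \<otimes>\<^bsub>U.H q \<times>\<times> V.H q\<^esub> T) = B q S \<otimes>\<^bsub>I.H q\<^esub> B q T" .
    qed
    then show ?thesis using gUV I.group_H by (simp add: group_hom_def group_hom_axioms_def)
  qed
  define g where "g = (\<lambda>q c. SOME w. conn q c w)"
  have g: "conn q c (g q c)" if "c \<in> I.Z q" for q c
    unfolding g_def using conn_total[OF that] by (rule someI_ex)
  have "\<exists>h. group_hom (I.H q) (M.H (Suc q)) h \<and> (\<forall>c\<in>I.Z q. h (I.cls q c) = M.cls (Suc q) (g q c))" for q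
  proof (rule I.lift[OF M.group_H])
    fix c assume c: "c \<in> I.Z q"
    show "M.cls (Suc q) (g q c) \<in> carrier (M.H (Suc q))" by (rule M.cls_in[OF conn_Z[OF g[OF c]]])
    fix c' assume c': "c' \<in> I.Z q"
    have "M.cls (Suc q) (g q (c + c')) = M.cls (Suc q) (g q c + g q c')"
      unfolding M.cls_eq_iff by (rule conn_unique[OF g[OF I.Z_closed(2)[OF c c']] conn_add[OF g[OF c] g[OF c']]])
    then show "M.cls (Suc q) (g q (c + c')) = M.cls (Suc q) (g q c) \<otimes>\<^bsub>M.H (Suc q)\<^esub> M.cls (Suc q) (g q c')"
      using M.cls_add[OF conn_Z[OF g[OF c]] conn_Z[OF g[OF c']]] by simp
  next
    fix c assume c: "c \<in> I.B q"
    show "M.cls (Suc q) (g q c) = \<one>\<^bsub>M.H (Suc q)\<^esub>"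
      unfolding M.cls_eq_one_iff by (rule conn_B[OF c g[OF subsetD[OF I.B_Z c]]])
  qed
  then obtain \<delta> where \<delta>: "\<And>q. group_hom (I.H q) (M.H (Suc q)) (\<delta> q)"
    "\<And>q c. c \<in> I.Z q \<Longrightarrow> \<delta> q (I.cls q c) = M.cls (Suc q) (g q c)" by metis
  have \<delta>c: "\<delta> q (I.cls q c) = M.cls (Suc q) w" if "c \<in> I.Z q" "conn q c w" for q c w
    unfolding \<delta>(2)[OF that(1)] M.cls_eq_iff by (rule conn_unique[OF g[OF that(1)] that(2)])
  have scale: "\<delta> q (I.cls q (sc k c)) = M.cls (Suc q) (sc k w)"
    if c: "c \<in> I.Z q" and w: "w \<in> M.Z (Suc q)" and e: "\<delta> q (I.cls q c) = M.cls (Suc q) w" for q k c w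
  proof -
    have "sc k c \<in> I.Z q" using c by (simp add: I.Z_def sc_in sc_d sc_diff(1))
    then have "\<delta> q (I.cls q (sc k c)) = M.cls (Suc q) (sc k (g q c))" by (rule \<delta>c[OF _ conn_scale[OF g[OF c]]])
    \<comment> \<open>The given \<open>w\<close> is only cohomologous to the chosen form; scaling a
      primitive of the difference bridges the gap.\<close>
    moreover have "g q c - w \<in> M.B (Suc q)" using e \<delta>(2)[OF c] by (simp add: M.cls_eq_iff)
    then obtain x where x: "x \<in> CM q" "g q c - w = dM q x" by (auto simp: M.B_def)
    have "sc k (g q c) - sc k w = dM q (sc k x)"
      unfolding sc_diff(3)[symmetric] x(2) by (rule sc_d(1)[OF x(1), symmetric])
    then have "sc k (g q c) - sc k w \<in> M.B (Suc q)" using M.d_in_B[OF sc_in(1)[OF x(1)]] by simp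
    ultimately show ?thesis by (simp add: M.cls_eq_iff)
  qed
  have one_UV: "(U.cls q a, V.cls q b) = \<one>\<^bsub>U.H q \<times>\<times> V.H q\<^esub> \<longleftrightarrow> a \<in> U.B q \<and> b \<in> V.B q" for q a b
    by (simp add: U.cls_eq_one_iff V.cls_eq_one_iff)
  have k0: "kernel (M.H 0) (U.H 0 \<times>\<times> V.H 0) (A 0) = {\<one>\<^bsub>M.H 0\<^esub>}"
  proof (rule equalityI; rule subsetI)
    fix S assume "S \<in> kernel (M.H 0) (U.H 0 \<times>\<times> V.H 0) (A 0)"
    then obtain x where x: "x \<in> M.Z 0" "S = M.cls 0 x" "A 0 S = \<one>\<^bsub>U.H 0 \<times>\<times> V.H 0\<^esub>"
      by (auto simp: kernel_def M.carrier_H)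
    then have "rU x \<in> U.B 0 \<and> rV x \<in> V.B 0" using A(2)[OF x(1)] one_UV[of 0 "rU x" "rV x"] by simp
    \<comment> \<open>In degree 0 the coboundaries are zero, so both restrictions of
      \<open>x\<close> vanish.\<close>
    then have "x = 0" using r_inj[of x 0] x(1) by (simp add: U.B_def V.B_def M.Z_def)
    then show "S \<in> {\<one>\<^bsub>M.H 0\<^esub>}" using x(2) by (simp add: M.one_H)
  next
    fix S assume "S \<in> {\<one>\<^bsub>M.H 0\<^esub>}"
    then show "S \<in> kernel (M.H 0) (U.H 0 \<times>\<times> V.H 0) (A 0)"
      using group_hom.hom_one[OF A(1)[of 0]] M.cls_in[OF M.Z_closed(1)[of 0]] by (simp add: kernel_def M.one_H)
  qed
  have e1: "A q ` carrier (M.H q) = kernel (U.H q \<times>\<times> V.H q) (I.H q) (B q)" for q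
  proof (rule equalityI; rule subsetI)
    fix S assume "S \<in> A q ` carrier (M.H q)"
    then obtain x where x: "x \<in> M.Z q" "S = A q (M.cls q x)" by (auto simp: M.carrier_H)
    have S: "S = (U.cls q (rU x), V.cls q (rV x))" unfolding x(2) by (rule A(2)[OF x(1)])
    have "s (rU x) - s (rV x) = 0" using s_r[of x q] x(1) by (simp add: M.Z_def)
    then have "B q S = \<one>\<^bsub>I.H q\<^esub>" unfolding S Bcls[OF r_Z(1)[OF x(1)] r_Z(2)[OF x(1)]] by (simp add: I.one_H)
    then show "S \<in> kernel (U.H q \<times>\<times> V.H q) (I.H q) (B q)"
      using S r_Z[OF x(1)] by (simp add: kernel_def U.cls_in V.cls_in)
  next
    fix S assume S: "S \<in> kernel (U.H q \<times>\<times> V.H q) (I.H q) (B q)"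
    then have Sc: "S \<in> carrier (U.H q \<times>\<times> V.H q)" "B q S = \<one>\<^bsub>I.H q\<^esub>" by (auto simp: kernel_def)
    obtain a b where ab: "a \<in> U.Z q" "b \<in> V.Z q" "S = (U.cls q a, V.cls q b)" using cUV[OF Sc(1)] by blast
    have "s a - s b \<in> I.B q" using Sc(2) unfolding ab(3) Bcls[OF ab(1,2)] I.cls_eq_one_iff .
    from B_split[OF this] obtain a0 b0 where ab0: "a0 \<in> U.B q" "b0 \<in> V.B q" "s a - s b = s a0 - s b0" by blast
    have z: "a - a0 \<in> U.Z q" "b - b0 \<in> V.Z q"
      using U.Z_closed(4)[OF ab(1) subsetD[OF U.B_Z ab0(1)]] V.Z_closed(4)[OF ab(2) subsetD[OF V.B_Z ab0(2)]] by simp_all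
    then have z': "a - a0 \<in> CU q" "dU q (a - a0) = 0" "b - b0 \<in> CV q" "dV q (b - b0) = 0"
      by (simp_all add: U.Z_def V.Z_def)
    have "s (a - a0) = s (b - b0)" using ab0(3) by (simp add: s_diff(3) algebra_simps)
    from glue[OF z'(1,3) this] obtain x where x: "x \<in> CM q" "rU x = a - a0" "rV x = b - b0" by blast
    have "dM q x = 0" by (rule r_inj[OF M.d_in[OF x(1)]]) (simp_all add: r_d[OF x(1)] x z')
    then have xZ: "x \<in> M.Z q" using x(1) by (simp add: M.Z_def)
    have "U.cls q (rU x) = U.cls q a" "V.cls q (rV x) = V.cls q b"
      using U.B_closed(3)[OF ab0(1)] V.B_closed(3)[OF ab0(2)] by (simp_all add: U.cls_eq_iff V.cls_eq_iff x)
    then have "S = A q (M.cls q x)" using A(2)[OF xZ] ab(3) by simp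
    then show "S \<in> A q ` carrier (M.H q)" using M.cls_in[OF xZ] by simp
  qed
  have e2: "B q ` carrier (U.H q \<times>\<times> V.H q) = kernel (I.H q) (M.H (Suc q)) (\<delta> q)" for q
  proof (rule equalityI; rule subsetI)
    fix S assume "S \<in> B q ` carrier (U.H q \<times>\<times> V.H q)"
    then obtain T where T: "T \<in> carrier (U.H q \<times>\<times> V.H q)" "S = B q T" by blast
    obtain a b where ab: "a \<in> U.Z q" "b \<in> V.Z q" "T = (U.cls q a, V.cls q b)" using cUV[OF T(1)] by blast
    have S: "S = I.cls q (s a - s b)" unfolding T(2) ab(3) by (rule Bcls[OF ab(1,2)])
    have c: "s a - s b \<in> I.Z q" by (rule I.Z_closed(4)[OF s_Z(1)[OF ab(1)] s_Z(2)[OF ab(2)]])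
    \<comment> \<open>For closed \<open>a\<close> and \<open>b\<close> the two derivatives glue to
      the zero form.\<close>
    have "conn q (s a - s b) 0"
      by (rule connI[of a q b]) (use ab M.zero_in in \<open>simp_all add: U.Z_def V.Z_def rU_diff(1) rV_diff(1)\<close>)
    then have "\<delta> q S = \<one>\<^bsub>M.H (Suc q)\<^esub>" unfolding S using \<delta>c[OF c] M.one_H by simp
    then show "S \<in> kernel (I.H q) (M.H (Suc q)) (\<delta> q)" using I.cls_in[OF c] S by (simp add: kernel_def)
  next
    fix S assume "S \<in> kernel (I.H q) (M.H (Suc q)) (\<delta> q)"
    then obtain c where c: "c \<in> I.Z q" "S = I.cls q c" "\<delta> q S = \<one>\<^bsub>M.H (Suc q)\<^esub>"
      by (auto simp: kernel_def I.carrier_H)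
    have "g q c \<in> M.B (Suc q)" using c(3) unfolding c(2) \<delta>(2)[OF c(1)] M.cls_eq_one_iff .
    then obtain x where x: "x \<in> CM q" "g q c = dM q x" by (auto simp: M.B_def)
    obtain a b where ab: "a \<in> CU q" "b \<in> CV q" "c = s a - s b" "rU (g q c) = dU q a" "rV (g q c) = dV q b"
      using g[OF c(1)] unfolding conn_def by blast
    \<comment> \<open>Subtracting the restrictions of the primitive \<open>x\<close> makes
      \<open>a\<close> and \<open>b\<close> closed and leaves their difference on the intersection
      unchanged.\<close>
    have a: "a - rU x \<in> U.Z q"
      using ab x U.diff_in[OF ab(1) r_in(1)[OF x(1)]] U.d_diff[OF ab(1) r_in(1)[OF x(1)]] r_d(1)[OF x(1)]
      by (simp add: U.Z_def)
    have b: "b - rV x \<in> V.Z q"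
      using ab x V.diff_in[OF ab(2) r_in(2)[OF x(1)]] V.d_diff[OF ab(2) r_in(2)[OF x(1)]] r_d(2)[OF x(1)]
      by (simp add: V.Z_def)
    have "s (a - rU x) - s (b - rV x) = c" using ab(3) s_r[OF x(1)] by (simp add: s_diff(3))
    then have "S = B q (U.cls q (a - rU x), V.cls q (b - rV x))" using Bcls[OF a b] c(2) by simp
    then show "S \<in> B q ` carrier (U.H q \<times>\<times> V.H q)" using U.cls_in[OF a] V.cls_in[OF b] by simp
  qed
  have e3: "\<delta> q ` carrier (I.H q) = kernel (M.H (Suc q)) (U.H (Suc q) \<times>\<times> V.H (Suc q)) (A (Suc q))" for q
  proof (rule equalityI; rule subsetI)
    fix S assume "S \<in> \<delta> q ` carrier (I.H q)"
    then obtain c where c: "c \<in> I.Z q" "S = \<delta> q (I.cls q c)" by (auto simp: I.carrier_H)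
    have S: "S = M.cls (Suc q) (g q c)" unfolding c(2) by (rule \<delta>(2)[OF c(1)])
    obtain a b where ab: "a \<in> CU q" "b \<in> CV q" "rU (g q c) = dU q a" "rV (g q c) = dV q b"
      using g[OF c(1)] unfolding conn_def by blast
    have "A (Suc q) S = \<one>\<^bsub>U.H (Suc q) \<times>\<times> V.H (Suc q)\<^esub>"
      unfolding S A(2)[OF conn_Z[OF g[OF c(1)]]] one_UV ab(3,4) using U.d_in_B[OF ab(1)] V.d_in_B[OF ab(2)] by simp
    then show "S \<in> kernel (M.H (Suc q)) (U.H (Suc q) \<times>\<times> V.H (Suc q)) (A (Suc q))"
      using M.cls_in[OF conn_Z[OF g[OF c(1)]]] S by (simp add: kernel_def)
  next
    fix S assume "S \<in> kernel (M.H (Suc q)) (U.H (Suc q) \<times>\<times> V.H (Suc q)) (A (Suc q))"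
    then obtain w where w: "w \<in> M.Z (Suc q)" "S = M.cls (Suc q) w" "A (Suc q) S = \<one>\<^bsub>U.H (Suc q) \<times>\<times> V.H (Suc q)\<^esub>"
      by (auto simp: kernel_def M.carrier_H)
    have "rU w \<in> U.B (Suc q) \<and> rV w \<in> V.B (Suc q)" using w(3) unfolding w(2) A(2)[OF w(1)] one_UV .
    then obtain a b where ab: "a \<in> CU q" "rU w = dU q a" "b \<in> CV q" "rV w = dV q b" by (auto simp: U.B_def V.B_def)
    have wC: "w \<in> CM (Suc q)" using w(1) by (simp add: M.Z_def)
    have "dI q (s a - s b) = s (rU w) - s (rV w)"
      using I.d_diff[OF s_in(1)[OF ab(1)] s_in(2)[OF ab(3)]] s_d(1)[OF ab(1)] s_d(2)[OF ab(3)] ab(2,4) by simp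
    then have c: "s a - s b \<in> I.Z q"
      using s_r[OF wC] I.diff_in[OF s_in(1)[OF ab(1)] s_in(2)[OF ab(3)]] by (simp add: I.Z_def)
    have "conn q (s a - s b) w" by (rule connI[OF ab(1,3) refl wC ab(2,4)])
    then have "S = \<delta> q (I.cls q (s a - s b))" using \<delta>c[OF c] w(2) by simp
    then show "S \<in> \<delta> q ` carrier (I.H q)" using I.cls_in[OF c] by simp
  qed
  show ?thesis
    by (rule exI[of _ A], rule exI[of _ B], rule exI[of _ \<delta>])
       (use A Bhom \<delta>(1) Bcls scale k0 e1 e2 e3 in simp)
qed

end

section \<open>Smooth functions on the model space\<close>

fun co :: "coord \<Rightarrow> model \<Rightarrow> real" where
  "co (ReZ a) y = Re (fst y a)"
| "co (ImZ a) y = Im (fst y a)"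
| "co (RealX b) y = snd y b"

abbreviation model_open :: "nat \<Rightarrow> nat \<Rightarrow> model set \<Rightarrow> bool" where
  "model_open m n S \<equiv> openin (top_of_set (model_space m n)) S"

lemma model_eqI:
  assumes "\<And>k. co k x = co k y"
  shows "x = y"
proof (rule prod_eqI; rule ext)
  fix a show "fst x a = fst y a"
    using assms[of "ReZ a"] assms[of "ImZ a"] by (simp add: complex_eq_iff)
next
  fix b show "snd x b = snd y b" using assms[of "RealX b"] by simp
qed

lemma co_shift: "co l (shift k s y) = co l y + (if l = k then s else 0)"
  by (cases y; cases k; cases l) auto

lemma shift_0 [simp]: "shift k 0 y = y"
  by (rule model_eqI) (simp add: co_shift)

lemma shift_shift: "shift k s (shift k t y) = shift k (s + t) y"
  by (rule model_eqI) (simp add: co_shift)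

lemma shift_commute: "shift k s (shift l t y) = shift l t (shift k s y)"
  by (rule model_eqI) (simp add: co_shift)

lemma finite_coords [simp]: "finite (coords m n)"
  by (simp add: coords_def)

lemma coords_simps [simp]:
  "ReZ a \<in> coords m n \<longleftrightarrow> a < m" "ImZ a \<in> coords m n \<longleftrightarrow> a < m" "RealX b \<in> coords m n \<longleftrightarrow> b < n"
  by (auto simp: coords_def)

lemma model_space_iff: "y \<in> model_space m n \<longleftrightarrow> (\<forall>k. k \<notin> coords m n \<longrightarrow> co k y = 0)"
proof
  assume y: "y \<in> model_space m n"
  show "\<forall>k. k \<notin> coords m n \<longrightarrow> co k y = 0"
  proof (intro allI impI)
    fix k assume "k \<notin> coords m n" then show "co k y = 0"
      using y by (cases k) (auto simp: model_space_def)
  qed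
next
  assume R: "\<forall>k. k \<notin> coords m n \<longrightarrow> co k y = 0"
  have "fst y a = 0" if "a \<ge> m" for a
    using R[rule_format, of "ReZ a"] R[rule_format, of "ImZ a"] that by (simp add: complex_eq_iff)
  moreover have "snd y b = 0" if "b \<ge> n" for b
    using R[rule_format, of "RealX b"] that by simp
  ultimately show "y \<in> model_space m n" by (auto simp: model_space_def mem_Times_iff)
qed

lemma shift_in_model_space:
  "y \<in> model_space m n \<Longrightarrow> k \<in> coords m n \<Longrightarrow> shift k s y \<in> model_space m n"
  by (auto simp: model_space_iff co_shift)

lemma continuous_on_co [continuous_intros]: "continuous_on S (co k)"
proof (cases k)
  case (ReZ a)
  have "continuous_on S (\<lambda>y::model. Re (fst y a))"
    by (intro continuous_on_Re continuous_on_product_then_coordinatewise[OF continuous_on_fst[OF continuous_on_id]])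
  then show ?thesis using ReZ by simp
next
  case (ImZ a)
  have "continuous_on S (\<lambda>y::model. Im (fst y a))"
    by (intro continuous_on_Im continuous_on_product_then_coordinatewise[OF continuous_on_fst[OF continuous_on_id]])
  then show ?thesis using ImZ by simp
next
  case (RealX b)
  have "continuous_on S (\<lambda>y::model. snd y b)"
    by (intro continuous_on_product_then_coordinatewise[OF continuous_on_snd[OF continuous_on_id]])
  then show ?thesis using RealX by simp
qed

text \<open>A basic open set of the product may constrain coordinates beyond \<open>m\<close> as
  well, but those are held fixed, so only finitely many radii have to be compared.\<close>

lemma open_fun_box:
  fixes x :: "nat \<Rightarrow> 'b::metric_space"
  assumes "open A" "x \<in> A"
  shows "\<exists>e>0. \<forall>x'. (\<forall>a<m. dist (x' a) (x a) < e) \<and> (\<forall>a\<ge>m. x' a = x a) \<longrightarrow> x' \<in> A"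
proof -
  have "openin (product_topology (\<lambda>_. euclidean) UNIV) A"
    using assms(1) by (simp add: open_fun_def)
  from product_topology_open_contains_basis[OF this assms(2)]
  obtain X where X: "x \<in> (\<Pi>\<^sub>E i\<in>UNIV. X i)" "\<And>i. openin euclidean (X i)" "(\<Pi>\<^sub>E i\<in>UNIV. X i) \<subseteq> A"
    by blast
  have "\<exists>e>0. ball (x a) e \<subseteq> X a" for a
    using X(1) X(2)[of a] by (simp add: open_contains_ball PiE_iff)
  then obtain e where e: "\<And>a. e a > 0" "\<And>a. ball (x a) (e a) \<subseteq> X a" by metis
  \<comment> \<open>The 1 keeps the minimum defined when \<open>m = 0\<close>.\<close>
  define d where "d = Min (insert 1 (e ` {..<m}))"
  have d: "d > 0" "\<And>a. a < m \<Longrightarrow> d \<le> e a" using e(1) by (auto simp: d_def)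
  show ?thesis
  proof (intro exI conjI allI impI)
    fix x' assume H: "(\<forall>a<m. dist (x' a) (x a) < d) \<and> (\<forall>a\<ge>m. x' a = x a)"
    have "x' a \<in> X a" for a
    proof (cases "a < m")
      case True
      then have "dist (x' a) (x a) < e a" using H d(2)[of a] by fastforce
      then have "x' a \<in> ball (x a) (e a)" by (simp add: dist_commute)
      then show ?thesis using e(2)[of a] by blast
    next
      case False then show ?thesis using H X(1) by auto
    qed
    then show "x' \<in> A" using X(3) by auto
  qed (rule d)
qed

lemma model_open_box:
  assumes "model_open m n S" "y \<in> S"
  shows "\<exists>e>0. \<forall>y'\<in>model_space m n. (\<forall>k\<in>coords m n. \<bar>co k y' - co k y\<bar> < e) \<longrightarrow> y' \<in> S"
proof -
  obtain T where T: "open T" "S = model_space m n \<inter> T"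
    using assms(1) by (auto simp: openin_open)
  then have "y \<in> T" using assms by auto
  obtain A B where AB: "open A" "open B" "y \<in> A \<times> B" "A \<times> B \<subseteq> T"
    using open_prod_elim[OF T(1) \<open>y \<in> T\<close>] by blast
  obtain e1 where e1: "e1 > 0"
    "\<And>x'. (\<forall>a<m. dist (x' a) (fst y a) < e1) \<and> (\<forall>a\<ge>m. x' a = fst y a) \<Longrightarrow> x' \<in> A"
    using open_fun_box[OF AB(1), of "fst y" m] AB(3) by (auto simp: mem_Times_iff)
  obtain e2 where e2: "e2 > 0"
    "\<And>x'. (\<forall>a<n. dist (x' a) (snd y a) < e2) \<and> (\<forall>a\<ge>n. x' a = snd y a) \<Longrightarrow> x' \<in> B"
    using open_fun_box[OF AB(2), of "snd y" n] AB(3) by (auto simp: mem_Times_iff)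
  have ym: "y \<in> model_space m n" using T assms by auto
  \<comment> \<open>A complex coordinate is controlled by its two real coordinates together, hence
    the factor 1/2 on \<open>e1\<close>.\<close>
  show ?thesis
  proof (intro exI[of _ "min (e1/2) e2"] conjI ballI impI)
    fix y' assume y': "y' \<in> model_space m n"
      and "\<forall>k\<in>coords m n. \<bar>co k y' - co k y\<bar> < min (e1/2) e2"
    then have c: "\<And>k. k \<in> coords m n \<Longrightarrow> \<bar>co k y' - co k y\<bar> < min (e1/2) e2" by blast
    have "dist (fst y' a) (fst y a) < e1" if "a < m" for a
    proof -
      have "dist (fst y' a) (fst y a) \<le> \<bar>Re (fst y' a - fst y a)\<bar> + \<bar>Im (fst y' a - fst y a)\<bar>"
        by (simp only: dist_norm cmod_le)
      also have "\<dots> < e1" using c[of "ReZ a"] c[of "ImZ a"] that by simp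
      finally show ?thesis .
    qed
    moreover have "\<forall>a\<ge>m. fst y' a = fst y a" using y' ym by (auto simp: model_space_def)
    ultimately have "fst y' \<in> A" using e1(2)[of "fst y'"] by blast
    have "\<forall>b<n. dist (snd y' b) (snd y b) < e2" using c[of "RealX b" for b] by (auto simp: dist_real_def)
    moreover have "\<forall>a\<ge>n. snd y' a = snd y a" using y' ym by (auto simp: model_space_def)
    ultimately have "snd y' \<in> B" using e2(2)[of "snd y'"] by blast
    with \<open>fst y' \<in> A\<close> have "y' \<in> A \<times> B" by (simp add: mem_Times_iff)
    then show "y' \<in> S" using AB(4) T y' by blast
  qed (use e1(1) e2(1) in simp)
qed

lemma model_open_imp_subset: "model_open m n S \<Longrightarrow> S \<subseteq> model_space m n"
  by (auto dest: openin_imp_subset)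

lemma continuous_on_box:
  fixes g :: "model \<Rightarrow> complex"
  assumes "model_open m n S" "y \<in> S" "continuous_on S g" "e > 0"
  shows "\<exists>d>0. \<forall>y'\<in>model_space m n. (\<forall>k\<in>coords m n. \<bar>co k y' - co k y\<bar> < d) \<longrightarrow>
       y' \<in> S \<and> norm (g y' - g y) < e"
proof -
  have "openin (top_of_set S) (S \<inter> g -` ball (g y) e)"
    by (rule continuous_openin_preimage_gen[OF assms(3)]) simp
  then have "model_open m n (S \<inter> g -` ball (g y) e)"
    using assms(1) openin_trans by blast
  moreover have "y \<in> S \<inter> g -` ball (g y) e" using assms by simp
  ultimately have "\<exists>d>0. \<forall>y'\<in>model_space m n. (\<forall>k\<in>coords m n. \<bar>co k y' - co k y\<bar> < d) \<longrightarrow>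
       y' \<in> S \<inter> g -` ball (g y) e"
    by (rule model_open_box)
  then show ?thesis by (simp add: dist_norm norm_minus_commute)
qed

lemma eventually_shift_in:
  assumes "model_open m n S" "y \<in> S" "k \<in> coords m n"
  shows "eventually (\<lambda>s. shift k s y \<in> S) (nhds 0)"
proof -
  obtain e where e: "e > 0"
    "\<And>y'. y' \<in> model_space m n \<Longrightarrow> (\<And>k. k \<in> coords m n \<Longrightarrow> \<bar>co k y' - co k y\<bar> < e) \<Longrightarrow> y' \<in> S"
    using model_open_box[OF assms(1,2)] by blast
  have "y \<in> model_space m n" using assms model_open_imp_subset by blast
  then have "shift k s y \<in> S" if "dist s 0 < e" for s
    using that e assms by (intro e(2) shift_in_model_space) (auto simp: co_shift)
  then show ?thesis using e(1) by (auto simp: eventually_nhds_metric)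
qed

lemma disc_ball_open:
  assumes "disc_ball m n D"
  shows "model_open m n D"
proof -
  obtain c r c' r' where D: "D = {z. (\<forall>a\<ge>m. z a = 0) \<and> (\<forall>a<m. cmod (z a - c a) < r a)} \<times>
     {t. (\<forall>b\<ge>n. t b = 0) \<and> sqrt (\<Sum>b<n. (t b - c' b)\<^sup>2) < (r'::real)}"
    using assms unfolding disc_ball_def polydisc_def open_ball_def by auto
  have cz: "continuous_on UNIV (\<lambda>y::model. fst y a)" for a
    by (intro continuous_on_product_then_coordinatewise[OF continuous_on_fst[OF continuous_on_id]])
  have ct: "continuous_on UNIV (\<lambda>y::model. snd y a)" for a
    by (intro continuous_on_product_then_coordinatewise[OF continuous_on_snd[OF continuous_on_id]])
  have "open ((\<Inter>a\<in>{..<m}. {y::model. cmod (fst y a - c a) < r a}) \<inter> {y. sqrt (\<Sum>b<n. (snd y b - c' b)\<^sup>2) < r'})"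
    by (intro open_Int open_INT finite_lessThan ballI open_Collect_less continuous_intros cz ct)
  moreover have "D = model_space m n \<inter> ((\<Inter>a\<in>{..<m}. {y::model. cmod (fst y a - c a) < r a}) \<inter> {y. sqrt (\<Sum>b<n. (snd y b - c' b)\<^sup>2) < r'})"
    unfolding D model_space_def by auto
  ultimately show ?thesis by (auto simp: openin_open)
qed

text \<open>Discs and balls of radius \<open>e\<close> fit into the coordinate box of half-width
  \<open>e\<close>. This provides charts of a restricted foliation around every point, since chart
  domains must be products.\<close>

lemma disc_ball_inside:
  assumes "model_open m n S" "y \<in> S"
  obtains D where "disc_ball m n D" "y \<in> D" "D \<subseteq> S"
proof -
  obtain e where e: "e > 0"
    "\<And>y'. y' \<in> model_space m n \<Longrightarrow> (\<And>k. k \<in> coords m n \<Longrightarrow> \<bar>co k y' - co k y\<bar> < e) \<Longrightarrow> y' \<in> S"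
    using model_open_box[OF assms] by blast
  have ym: "y \<in> model_space m n" using assms model_open_imp_subset by blast
  define D where "D = {z. (\<forall>a\<ge>m. z a = 0) \<and> (\<forall>a<m. cmod (z a - fst y a) < e)} \<times>
     {t. (\<forall>b\<ge>n. t b = 0) \<and> sqrt (\<Sum>b<n. (t b - snd y b)\<^sup>2) < e}"
  show thesis
  proof
    show "disc_ball m n D"
      unfolding disc_ball_def polydisc_def open_ball_def D_def using e(1)
      by (intro exI[of _ "{z. (\<forall>a\<ge>m. z a = 0) \<and> (\<forall>a<m. cmod (z a - fst y a) < e)}"]
            exI[of _ "{t. (\<forall>b\<ge>n. t b = 0) \<and> sqrt (\<Sum>b<n. (t b - snd y b)\<^sup>2) < e}"]
            conjI exI[of _ "fst y"] exI[of _ "\<lambda>_. e"] exI[of _ "snd y"] exI[of _ e]) auto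
    show "y \<in> D" using ym e(1) by (auto simp: D_def model_space_def mem_Times_iff)
    show "D \<subseteq> S"
    proof
      fix y' assume y': "y' \<in> D"
      show "y' \<in> S"
      proof (rule e(2))
        show "y' \<in> model_space m n" using y' by (auto simp: D_def model_space_def mem_Times_iff)
        fix k assume k: "k \<in> coords m n"
        show "\<bar>co k y' - co k y\<bar> < e"
        proof (cases k)
          case (ReZ a)
          then have "cmod (fst y' a - fst y a) < e" using y' k by (auto simp: D_def)
          then show ?thesis using abs_Re_le_cmod[of "fst y' a - fst y a"] ReZ by simp
        next
          case (ImZ a)
          then have "cmod (fst y' a - fst y a) < e" using y' k by (auto simp: D_def)
          then show ?thesis using abs_Im_le_cmod[of "fst y' a - fst y a"] ImZ by simp
        next
          case (RealX b)
          then have b: "b < n" using k by simp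
          have "\<bar>snd y' b - snd y b\<bar> = sqrt ((snd y' b - snd y b)\<^sup>2)" by simp
          also have "\<dots> \<le> sqrt (\<Sum>b<n. (snd y' b - snd y b)\<^sup>2)"
            using b by (intro real_sqrt_le_mono member_le_sum) auto
          also have "\<dots> < e" using y' by (auto simp: D_def)
          finally show ?thesis using RealX by simp
        qed
      qed
    qed
  qed
qed

section \<open>Partial derivatives and the classes \<open>C_k\<close>\<close>

definition has_pderiv :: "coord \<Rightarrow> (model \<Rightarrow> complex) \<Rightarrow> model \<Rightarrow> complex \<Rightarrow> bool" where
  "has_pderiv k g y D \<longleftrightarrow> ((\<lambda>s. g (shift k s y)) has_vector_derivative D) (at 0)"

lemma has_pderiv_imp: "has_pderiv k g y D \<Longrightarrow> pderiv_at k g y = D"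
  unfolding has_pderiv_def pderiv_at_def by (rule vector_derivative_at)

lemma has_pderiv_iff:
  "(\<lambda>s. g (shift k s y)) differentiable (at 0) \<longleftrightarrow> has_pderiv k g y (pderiv_at k g y)"
  unfolding has_pderiv_def pderiv_at_def vector_derivative_works ..

lemma has_pderiv_cong:
  assumes "model_open m n S" "y \<in> S" "k \<in> coords m n" "\<And>y. y \<in> S \<Longrightarrow> g y = g' y"
  shows "has_pderiv k g y D \<longleftrightarrow> has_pderiv k g' y D"
proof -
  have ev: "eventually (\<lambda>s. g (shift k s y) = g' (shift k s y)) (nhds 0)"
    using eventually_shift_in[OF assms(1-3)] by (rule eventually_mono) (use assms(4) in auto)
  show ?thesis unfolding has_pderiv_def
    by (rule has_vector_derivative_cong_ev) (use ev assms in \<open>auto elim: eventually_mono\<close>)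
qed

lemma pderiv_at_cong:
  assumes "model_open m n S" "y \<in> S" "k \<in> coords m n" "\<And>y. y \<in> S \<Longrightarrow> g y = g' y"
  shows "pderiv_at k g y = pderiv_at k g' y"
proof -
  have "has_pderiv k g y D \<longleftrightarrow> has_pderiv k g' y D" for D
    by (rule has_pderiv_cong[OF assms(1-3)]) (rule assms(4))
  then show ?thesis unfolding pderiv_at_def vector_derivative_def has_pderiv_def by simp
qed

lemma has_pderiv_const: "has_pderiv k (\<lambda>y. a) y 0"
  by (simp add: has_pderiv_def)

lemma has_pderiv_add:
  "has_pderiv k g y D \<Longrightarrow> has_pderiv k g' y D' \<Longrightarrow> has_pderiv k (\<lambda>y. g y + g' y) y (D + D')"
  unfolding has_pderiv_def by (rule has_vector_derivative_add)

lemma has_pderiv_mult: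
  "has_pderiv k g y D \<Longrightarrow> has_pderiv k g' y D' \<Longrightarrow> has_pderiv k (\<lambda>y. g y * g' y) y (g y * D' + D * g' y)"
  unfolding has_pderiv_def
  using has_vector_derivative_mult[of "\<lambda>s. g (shift k s y)" D 0 UNIV "\<lambda>s. g' (shift k s y)" D'] by simp

lemma has_pderiv_linear:
  "bounded_linear L \<Longrightarrow> has_pderiv k g y D \<Longrightarrow> has_pderiv k (\<lambda>y. L (g y)) y (L D)"
  unfolding has_pderiv_def by (rule bounded_linear.has_vector_derivative)

lemma has_pderiv_inverse:
  assumes "has_pderiv k g y D" "g y \<noteq> 0"
  shows "has_pderiv k (\<lambda>y. inverse (g y)) y (- D * (inverse (g y) * inverse (g y)))"
proof -
  have "((inverse \<circ> (\<lambda>s. g (shift k s y))) has_vector_derivative D * - (inverse (g y) * inverse (g y))) (at 0)"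
  proof (rule field_vector_diff_chain_at)
    show "((\<lambda>s. g (shift k s y)) has_vector_derivative D) (at 0)"
      using assms by (simp add: has_pderiv_def)
    show "(inverse has_field_derivative - (inverse (g y) * inverse (g y))) (at (g (shift k 0 y)))"
      using DERIV_inverse'[OF DERIV_ident, of "g y" UNIV] assms(2)
      by simp
  qed
  then show ?thesis by (simp add: has_pderiv_def o_def)
qed

lemma has_pderiv_shift:
  assumes "has_pderiv k g (shift k t y) D"
  shows "((\<lambda>s. g (shift k s y)) has_vector_derivative D) (at t)"
proof -
  have "((\<lambda>s. g (shift k s (shift k t y))) \<circ> (\<lambda>s. s - t) has_vector_derivative 1 *\<^sub>R D) (at t)"
    by (rule vector_diff_chain_at)
       (use assms in \<open>auto simp: has_pderiv_def intro!: derivative_eq_intros\<close>)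
  then show ?thesis by (simp add: o_def shift_shift)
qed

text \<open>The congruence at order \<open>r\<close> is a hypothesis because \<open>C_k_cong\<close>
  is itself proved by induction with this rule; \<open>C_k_SucI'\<close> discharges it
  afterwards.\<close>

lemma C_k_SucI:
  assumes "model_open m n S" "continuous_on S g"
    and "\<And>k y. k \<in> coords m n \<Longrightarrow> y \<in> S \<Longrightarrow> has_pderiv k g y (g' k y)"
    and "\<And>k. k \<in> coords m n \<Longrightarrow> C_k m n r S (g' k)"
    and cong: "\<And>g g'. (\<And>y. y \<in> S \<Longrightarrow> g y = g' y) \<Longrightarrow> C_k m n r S g \<Longrightarrow> C_k m n r S g'"
  shows "C_k m n (Suc r) S g"
  unfolding C_k.simps has_pderiv_iff
proof (intro conjI ballI)
  fix k assume k: "k \<in> coords m n"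
  show "C_k m n r S (pderiv_at k g)"
    by (rule cong[OF _ assms(4)[OF k]]) (rule has_pderiv_imp[OF assms(3)[OF k], symmetric])
  show "has_pderiv k g y (pderiv_at k g y)" if "y \<in> S" for y
    using assms(3)[OF k that] has_pderiv_imp[OF assms(3)[OF k that]] by simp
qed (rule assms)

lemma C_k_SucD:
  assumes "C_k m n (Suc r) S g" "k \<in> coords m n"
  shows "y \<in> S \<Longrightarrow> has_pderiv k g y (pderiv_at k g y)" "C_k m n r S (pderiv_at k g)"
  using assms by (simp_all add: has_pderiv_iff)

lemma C_k_cong:
  assumes "model_open m n S" "\<And>y. y \<in> S \<Longrightarrow> g y = g' y" "C_k m n r S g"
  shows "C_k m n r S g'"
  using assms(2,3)
proof (induction r arbitrary: g g')
  case 0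
  then show ?case using continuous_on_cong[of S S g g'] by simp
next
  case (Suc r)
  show ?case
  proof (rule C_k_SucI[where g' = "\<lambda>k. pderiv_at k g"])
    show "continuous_on S g'" using Suc.prems continuous_on_cong[of S S g g'] by simp
    show "has_pderiv k g' y (pderiv_at k g y)" if "k \<in> coords m n" "y \<in> S" for k y
    proof -
      have "has_pderiv k g y (pderiv_at k g y) \<longleftrightarrow> has_pderiv k g' y (pderiv_at k g y)"
        by (rule has_pderiv_cong[OF assms(1) that(2,1)]) (rule Suc.prems)
      then show ?thesis using C_k_SucD(1)[OF Suc.prems(2) that] by blast
    qed
    show "C_k m n r S (pderiv_at k g)" if "k \<in> coords m n" for k
      using Suc.prems(2) that by simp
    show "C_k m n r S h'" if "\<And>y. y \<in> S \<Longrightarrow> h y = h' y" "C_k m n r S h" for h h'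
      by (rule Suc.IH[OF that])
  qed (rule assms(1))
qed

lemmas C_k_SucI' = C_k_SucI[OF _ _ _ _ C_k_cong]

lemma C_k_continuous: "C_k m n r S g \<Longrightarrow> continuous_on S g"
  by (cases r) auto

lemma C_k_Suc_imp: "C_k m n (Suc r) S g \<Longrightarrow> C_k m n r S g"
proof (induction r arbitrary: g)
  case (Suc r)
  show ?case unfolding C_k.simps(2)[of m n r]
  proof (intro conjI ballI)
    show "continuous_on S g" using Suc.prems by simp
    fix k assume k: "k \<in> coords m n"
    show "C_k m n r S (pderiv_at k g)" by (rule Suc.IH[OF C_k_SucD(2)[OF Suc.prems k]])
    show "(\<lambda>s. g (shift k s y)) differentiable at 0" if "y \<in> S" for y
      using C_k_SucD(1)[OF Suc.prems k that] by (simp only: has_pderiv_iff)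
  qed
qed simp

lemma C_k_subset: "C_k m n r S g \<Longrightarrow> S' \<subseteq> S \<Longrightarrow> C_k m n r S' g"
proof (induction r arbitrary: g)
  case (Suc r)
  have "continuous_on S' g" using Suc.prems by (auto intro: continuous_on_subset)
  then show ?case using Suc by (simp add: subsetD[OF Suc.prems(2)])
qed (auto intro: continuous_on_subset)

lemma C_k_local:
  assumes "\<And>y. y \<in> S \<Longrightarrow> \<exists>S'. model_open m n S' \<and> y \<in> S' \<and> C_k m n r S' g" "S \<subseteq> model_space m n"
  shows "C_k m n r S g"
  using assms(1)
proof (induction r arbitrary: g)
  case 0
  show ?case unfolding C_k.simps continuous_on_eq_continuous_within
  proof
    fix y assume "y \<in> S"
    then obtain S' where S': "model_open m n S'" "y \<in> S'" "continuous_on S' g"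
      using 0 by (metis C_k.simps(1))
    obtain T where T: "open T" "S' = model_space m n \<inter> T" using S'(1) by (auto simp: openin_open)
    have "continuous_on (S \<inter> T) g"
      by (rule continuous_on_subset[OF S'(3)]) (use T assms(2) in blast)
    then have "continuous (at y within S \<inter> T) g"
      using S' T \<open>y \<in> S\<close> by (simp add: continuous_on_eq_continuous_within)
    moreover have "at y within (S \<inter> T) = at y within S"
      by (rule at_within_nhd[of _ T]) (use T S' in blast)+
    ultimately show "continuous (at y within S) g" by simp
  qed
next
  case (Suc r)
  have loc: "C_k m n r S h"
    if "\<And>S'. C_k m n (Suc r) S' g \<Longrightarrow> C_k m n r S' h" for h
  proof (rule Suc.IH)
    fix y assume "y \<in> S"
    then obtain S' where "model_open m n S'" "y \<in> S'" "C_k m n (Suc r) S' g"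
      using Suc.prems by metis
    then show "\<exists>S'. model_open m n S' \<and> y \<in> S' \<and> C_k m n r S' h" using that by metis
  qed
  have "C_k m n r S g" by (rule loc) (rule C_k_Suc_imp)
  then have "continuous_on S g" by (rule C_k_continuous)
  moreover have "C_k m n r S (pderiv_at k g)" if "k \<in> coords m n" for k
    by (rule loc) (rule C_k_SucD(2)[OF _ that])
  moreover have "has_pderiv k g y (pderiv_at k g y)" if "k \<in> coords m n" "y \<in> S" for k y
  proof -
    from Suc.prems[OF that(2)] obtain S' where "y \<in> S'" "C_k m n (Suc r) S' g" by metis
    then show ?thesis using C_k_SucD(1)[OF _ that(1)] by metis
  qed
  ultimately show ?case by (simp add: has_pderiv_iff)
qed

lemma C_k_const: "C_k m n r S (\<lambda>y. a)"
proof (induction r arbitrary: a)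
  case (Suc r)
  have "pderiv_at k (\<lambda>y. a) = (\<lambda>y. 0)" for k using has_pderiv_imp[OF has_pderiv_const] by blast
  then show ?case using Suc by simp
qed simp

lemma C_k_add:
  assumes S: "model_open m n S"
  shows "C_k m n r S g \<Longrightarrow> C_k m n r S g' \<Longrightarrow> C_k m n r S (\<lambda>y. g y + g' y)"
proof (induction r arbitrary: g g')
  case 0 then show ?case by (simp add: continuous_on_add)
next
  case (Suc r)
  note g = C_k_SucD[OF Suc.prems(1)] C_k_SucD[OF Suc.prems(2)]
  show ?case
  proof (rule C_k_SucI'[OF S])
    show "continuous_on S (\<lambda>y. g y + g' y)"
      using Suc.prems[THEN C_k_continuous] by (rule continuous_on_add)
    fix k assume k: "k \<in> coords m n"
    show "has_pderiv k (\<lambda>y. g y + g' y) y (pderiv_at k g y + pderiv_at k g' y)" if "y \<in> S" for y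
      by (rule has_pderiv_add[OF g(1)[OF k that] g(3)[OF k that]])
    show "C_k m n r S (\<lambda>y. pderiv_at k g y + pderiv_at k g' y)"
      by (rule Suc.IH[OF g(2)[OF k] g(4)[OF k]])
  qed (rule S)
qed

lemma C_k_mult:
  assumes S: "model_open m n S"
  shows "C_k m n r S g \<Longrightarrow> C_k m n r S g' \<Longrightarrow> C_k m n r S (\<lambda>y. g y * g' y)"
proof (induction r arbitrary: g g')
  case 0 then show ?case by (simp add: continuous_on_mult)
next
  case (Suc r)
  note g = C_k_SucD[OF Suc.prems(1)] C_k_SucD[OF Suc.prems(2)] Suc.prems[THEN C_k_Suc_imp]
  show ?case
  proof (rule C_k_SucI'[OF S])
    show "continuous_on S (\<lambda>y. g y * g' y)"
      using Suc.prems[THEN C_k_continuous] by (rule continuous_on_mult)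
    fix k assume k: "k \<in> coords m n"
    show "has_pderiv k (\<lambda>y. g y * g' y) y (g y * pderiv_at k g' y + pderiv_at k g y * g' y)" if "y \<in> S" for y
      by (rule has_pderiv_mult[OF g(1)[OF k that] g(3)[OF k that]])
    show "C_k m n r S (\<lambda>y. g y * pderiv_at k g' y + pderiv_at k g y * g' y)"
      by (rule C_k_add[OF S Suc.IH[OF g(5) g(4)[OF k]] Suc.IH[OF g(2)[OF k] g(6)]])
  qed (rule S)
qed

lemma C_k_linear:
  assumes S: "model_open m n S" and L: "bounded_linear L"
  shows "C_k m n r S g \<Longrightarrow> C_k m n r S (\<lambda>y. L (g y))"
proof (induction r arbitrary: g)
  case 0 then show ?case by (simp add: bounded_linear.continuous_on[OF L])
next
  case (Suc r)
  note g = C_k_SucD[OF Suc.prems(1)]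
  show ?case
  proof (rule C_k_SucI'[OF S])
    show "continuous_on S (\<lambda>y. L (g y))"
      by (rule bounded_linear.continuous_on[OF L C_k_continuous[OF Suc.prems]])
    fix k assume k: "k \<in> coords m n"
    show "has_pderiv k (\<lambda>y. L (g y)) y (L (pderiv_at k g y))" if "y \<in> S" for y
      by (rule has_pderiv_linear[OF L g(1)[OF k that]])
    show "C_k m n r S (\<lambda>y. L (pderiv_at k g y))"
      by (rule Suc.IH[OF g(2)[OF k]])
  qed (rule S)
qed

text \<open>The derivative of \<open>1/g\<close> is a product of a derivative of \<open>g\<close>
  with two copies of \<open>1/g\<close>, so the induction calls for \<open>1/g\<close> itself at the
  previous order only.\<close>

lemma C_k_inverse:
  assumes S: "model_open m n S" and nz: "\<And>y. y \<in> S \<Longrightarrow> g y \<noteq> 0"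
  shows "C_k m n r S g \<Longrightarrow> C_k m n r S (\<lambda>y. inverse (g y))"
proof (induction r)
  case 0 then show ?case using nz by (auto intro: continuous_on_inverse)
next
  case (Suc r)
  note g = C_k_SucD[OF Suc.prems(1)]
  note IH = Suc.IH[OF C_k_Suc_imp[OF Suc.prems]]
  show ?case
  proof (rule C_k_SucI'[OF S])
    show "continuous_on S (\<lambda>y. inverse (g y))"
      using C_k_continuous[OF Suc.prems] nz by (intro continuous_on_inverse) auto
    fix k assume k: "k \<in> coords m n"
    show "has_pderiv k (\<lambda>y. inverse (g y)) y (- pderiv_at k g y * (inverse (g y) * inverse (g y)))"
      if "y \<in> S" for y
      by (rule has_pderiv_inverse[OF g(1)[OF k that] nz[OF that]])
    show "C_k m n r S (\<lambda>y. - pderiv_at k g y * (inverse (g y) * inverse (g y)))"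
      by (rule C_k_mult[OF S C_k_linear[OF S bounded_linear_minus[OF bounded_linear_ident] g(2)[OF k]]
            C_k_mult[OF S IH IH]])
  qed (rule S)
qed

section \<open>Closure properties of smooth functions\<close>

lemma smooth_onD: "smooth_on m n S g \<Longrightarrow> C_k m n r S g"
  by (simp add: smooth_on_def)

lemma smooth_on_cong:
  assumes "model_open m n S" "\<And>y. y \<in> S \<Longrightarrow> g y = g' y" "smooth_on m n S g"
  shows "smooth_on m n S g'"
  unfolding smooth_on_def
  by (rule allI, rule C_k_cong[OF assms(1) _ smooth_onD[OF assms(3)]]) (rule assms(2))

lemma smooth_on_subset: "smooth_on m n S g \<Longrightarrow> S' \<subseteq> S \<Longrightarrow> smooth_on m n S' g"
  by (simp add: smooth_on_def C_k_subset[of m n _ S g S'])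

lemma smooth_on_local:
  assumes "\<And>y. y \<in> S \<Longrightarrow> \<exists>S'. model_open m n S' \<and> y \<in> S' \<and> smooth_on m n S' g" "S \<subseteq> model_space m n"
  shows "smooth_on m n S g"
  unfolding smooth_on_def
proof
  fix r show "C_k m n r S g"
  proof (rule C_k_local[OF _ assms(2)])
    fix y assume "y \<in> S"
    from assms(1)[OF this] obtain S' where "model_open m n S' \<and> y \<in> S' \<and> smooth_on m n S' g" ..
    then show "\<exists>S'. model_open m n S' \<and> y \<in> S' \<and> C_k m n r S' g"
      by (intro exI[of _ S']) (simp add: smooth_on_def)
  qed
qed

lemma smooth_on_const: "smooth_on m n S (\<lambda>y. a)"
  by (simp add: smooth_on_def C_k_const)

lemma smooth_on_add:
  "model_open m n S \<Longrightarrow> smooth_on m n S g \<Longrightarrow> smooth_on m n S g' \<Longrightarrow> smooth_on m n S (\<lambda>y. g y + g' y)"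
  by (simp only: smooth_on_def C_k_add simp_thms)

lemma smooth_on_mult:
  "model_open m n S \<Longrightarrow> smooth_on m n S g \<Longrightarrow> smooth_on m n S g' \<Longrightarrow> smooth_on m n S (\<lambda>y. g y * g' y)"
  by (simp only: smooth_on_def C_k_mult simp_thms)

lemma smooth_on_linear:
  "model_open m n S \<Longrightarrow> bounded_linear L \<Longrightarrow> smooth_on m n S g \<Longrightarrow> smooth_on m n S (\<lambda>y. L (g y))"
  by (simp only: smooth_on_def C_k_linear simp_thms)

lemma smooth_on_inverse:
  "model_open m n S \<Longrightarrow> (\<And>y. y \<in> S \<Longrightarrow> g y \<noteq> 0) \<Longrightarrow> smooth_on m n S g \<Longrightarrow> smooth_on m n S (\<lambda>y. inverse (g y))"
  by (simp only: smooth_on_def C_k_inverse simp_thms)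

lemma smooth_on_sum:
  "model_open m n S \<Longrightarrow> (\<And>i. i \<in> I \<Longrightarrow> smooth_on m n S (g i)) \<Longrightarrow> smooth_on m n S (\<lambda>y. \<Sum>i\<in>I. g i y)"
  by (induction I rule: infinite_finite_induct) (auto intro: smooth_on_const smooth_on_add)

lemma smooth_on_prod:
  "model_open m n S \<Longrightarrow> (\<And>i. i \<in> I \<Longrightarrow> smooth_on m n S (g i)) \<Longrightarrow> smooth_on m n S (\<lambda>y. \<Prod>i\<in>I. g i y)"
  by (induction I rule: infinite_finite_induct) (auto intro: smooth_on_const smooth_on_mult)

lemma smooth_on_diff:
  assumes "model_open m n S" "smooth_on m n S g" "smooth_on m n S g'"
  shows "smooth_on m n S (\<lambda>y. g y - g' y)"
  using smooth_on_add[OF assms(1,2) smooth_on_linear[OF assms(1) bounded_linear_minus[OF bounded_linear_ident] assms(3)]]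
  by (simp only: diff_conv_add_uminus)

lemma smooth_on_cnj:
  "model_open m n S \<Longrightarrow> smooth_on m n S g \<Longrightarrow> smooth_on m n S (\<lambda>y. cnj (g y))"
  by (rule smooth_on_linear[OF _ bounded_linear_cnj])

lemma smooth_on_continuous: "smooth_on m n S g \<Longrightarrow> continuous_on S g"
  by (auto simp: smooth_on_def intro: C_k_continuous)

lemma smooth_on_has_pderiv:
  "smooth_on m n S g \<Longrightarrow> k \<in> coords m n \<Longrightarrow> y \<in> S \<Longrightarrow> has_pderiv k g y (pderiv_at k g y)"
  by (rule C_k_SucD(1)[OF smooth_onD])

lemma smooth_on_pderiv:
  "smooth_on m n S g \<Longrightarrow> k \<in> coords m n \<Longrightarrow> smooth_on m n S (pderiv_at k g)"
  using C_k_SucD(2)[OF smooth_onD] by (simp add: smooth_on_def)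

lemma smooth_on_co:
  assumes "model_open m n S"
  shows "smooth_on m n S (\<lambda>y. of_real (co l y))"
  unfolding smooth_on_def
proof
  fix r
  have c: "continuous_on S (\<lambda>y. of_real (co l y) :: complex)" by (intro continuous_intros)
  show "C_k m n r S (\<lambda>y. of_real (co l y))"
  proof (cases r)
    case (Suc r')
    show ?thesis unfolding Suc
    proof (rule C_k_SucI'[where g' = "\<lambda>k y. if l = k then 1 else 0"])
      fix k y
      have "((\<lambda>s. of_real (co l y + (if l = k then s else 0)) :: complex) has_vector_derivative (if l = k then 1 else 0)) (at 0)"
        by (auto intro!: derivative_eq_intros)
      then show "has_pderiv k (\<lambda>y. of_real (co l y)) y (if l = k then 1 else 0)"
        by (simp add: has_pderiv_def co_shift)
    qed (use c assms in \<open>auto intro: C_k_const\<close>)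
  qed (use c in simp)
qed

text \<open>The mean value inequality for the map sending \<open>t\<close> to
  \<open>g (shift k t z) - t *\<^sub>R A\<close>: its derivative \<open>g' t - A\<close> is bounded
  by \<open>e\<close>.\<close>

lemma shift_bound:
  assumes "\<And>t. \<bar>t\<bar> \<le> \<bar>s\<bar> \<Longrightarrow> has_pderiv k g (shift k t z) (g' t)"
    and "\<And>t. \<bar>t\<bar> \<le> \<bar>s\<bar> \<Longrightarrow> norm (g' t - A) \<le> e"
  shows "norm (g (shift k s z) - g z - s *\<^sub>R A) \<le> e * \<bar>s\<bar>"
proof -
  define u where "u = (\<lambda>t. g (shift k t z) - t *\<^sub>R A)"
  have ss: "\<bar>t\<bar> \<le> \<bar>s\<bar>" if "t \<in> closed_segment 0 s" for t
    using that by (auto simp: closed_segment_eq_real_ivl split: if_splits)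
  have "norm (u s - u 0) \<le> e * norm (s - 0)"
  proof (rule differentiable_bound[of "closed_segment 0 s" u "\<lambda>t h. h *\<^sub>R (g' t - A)"])
    fix t assume "t \<in> closed_segment 0 s"
    note t = ss[OF this]
    have "(u has_vector_derivative (g' t - 1 *\<^sub>R A)) (at t within closed_segment 0 s)"
      unfolding u_def
      by (intro has_vector_derivative_diff has_vector_derivative_at_within[OF has_pderiv_shift[OF assms(1)[OF t]]])
         (auto intro!: derivative_eq_intros)
    then show "(u has_derivative (\<lambda>h. h *\<^sub>R (g' t - A))) (at t within closed_segment 0 s)"
      by (simp add: has_vector_derivative_def)
    show "onorm (\<lambda>h. h *\<^sub>R (g' t - A)) \<le> e"
      by (rule onorm_le) (use mult_left_mono[OF assms(2)[OF t] abs_ge_zero] in \<open>simp add: mult.commute\<close>)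
  qed auto
  then show ?thesis by (simp add: u_def algebra_simps)
qed

lemma pderiv_box:
  assumes S: "model_open m n S" and y: "y \<in> S" and g: "C_k m n 1 S g" and e: "e > 0"
  shows "\<exists>d>0. \<forall>y'\<in>model_space m n. (\<forall>k\<in>coords m n. \<bar>co k y' - co k y\<bar> < d) \<longrightarrow>
     y' \<in> S \<and> (\<forall>k\<in>coords m n. norm (pderiv_at k g y' - pderiv_at k g y) < e)"
proof -
  \<comment> \<open>Only the set \<open>K\<close> of controlled derivatives runs through the
    induction; the box always refers to all coordinates.\<close>
  have "\<exists>d>0. \<forall>y'\<in>model_space m n. (\<forall>k\<in>coords m n. \<bar>co k y' - co k y\<bar> < d) \<longrightarrow>
     y' \<in> S \<and> (\<forall>k\<in>K. norm (pderiv_at k g y' - pderiv_at k g y) < e)"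
    if "finite K" "K \<subseteq> coords m n" for K
    using that
  proof (induction K rule: finite_induct)
    case empty
    then show ?case using model_open_box[OF S y] by simp
  next
    case (insert k K)
    then obtain d1 where d1: "d1 > 0" "\<forall>y'\<in>model_space m n. (\<forall>k\<in>coords m n. \<bar>co k y' - co k y\<bar> < d1) \<longrightarrow>
     y' \<in> S \<and> (\<forall>k\<in>K. norm (pderiv_at k g y' - pderiv_at k g y) < e)" by auto
    have "continuous_on S (pderiv_at k g)"
      using g insert.prems by simp
    from continuous_on_box[OF S y this e]
    obtain d2 where d2: "d2 > 0" "\<forall>y'\<in>model_space m n. (\<forall>k\<in>coords m n. \<bar>co k y' - co k y\<bar> < d2) \<longrightarrow>
       y' \<in> S \<and> norm (pderiv_at k g y' - pderiv_at k g y) < e" by auto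
    show ?case
    proof (intro exI[of _ "min d1 d2"] conjI ballI impI)
      fix y' assume y': "y' \<in> model_space m n" "\<forall>k\<in>coords m n. \<bar>co k y' - co k y\<bar> < min d1 d2"
      then have "\<forall>k\<in>coords m n. \<bar>co k y' - co k y\<bar> < d1" "\<forall>k\<in>coords m n. \<bar>co k y' - co k y\<bar> < d2" by auto
      then have *: "y' \<in> S \<and> (\<forall>k\<in>K. norm (pderiv_at k g y' - pderiv_at k g y) < e)"
        "norm (pderiv_at k g y' - pderiv_at k g y) < e"
        using d1(2) d2(2) y'(1) by blast+
      then show "y' \<in> S" by blast
      fix l assume "l \<in> insert k K"
      then show "norm (pderiv_at l g y' - pderiv_at l g y) < e" using * by blast
    qed (use d1(1) d2(1) in simp)
  qed
  from this[OF finite_coords order_refl] show ?thesis .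
qed

text \<open>Both iterated derivatives are limits of the same symmetric second difference quotient.\<close>

lemma second_difference_bound:
  assumes S: "model_open m n S" and y: "y \<in> S" and g: "C_k m n 2 S g"
    and k: "k \<in> coords m n" and l: "l \<in> coords m n" and e: "e > 0"
  shows "\<exists>d>0. \<forall>s. \<bar>s\<bar> < d \<longrightarrow>
     norm (g (shift k s (shift l s y)) - g (shift k s y) - g (shift l s y) + g y
           - (s * s) *\<^sub>R pderiv_at l (pderiv_at k g) y) \<le> e * (s * s)"
proof -
  have g1: "C_k m n 1 S (pderiv_at k g)" "C_k m n 1 S g"
    using g k by (auto simp: numeral_2_eq_2)
  obtain d where d: "d > 0" "\<forall>y'\<in>model_space m n. (\<forall>k\<in>coords m n. \<bar>co k y' - co k y\<bar> < d) \<longrightarrow>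
     y' \<in> S \<and> (\<forall>l\<in>coords m n. norm (pderiv_at l (pderiv_at k g) y' - pderiv_at l (pderiv_at k g) y) < e)"
    using pderiv_box[OF S y g1(1) e] by blast
  define A where "A = pderiv_at l (pderiv_at k g) y"
  have ym: "y \<in> model_space m n" using y S model_open_imp_subset by blast
  \<comment> \<open>The two shifts may act on the same coordinate, so each gets half of
    \<open>d\<close>.\<close>
  have box: "shift k t (shift l s y) \<in> S \<and> norm (pderiv_at l (pderiv_at k g) (shift k t (shift l s y)) - A) \<le> e"
    if "\<bar>s\<bar> < d/2" "\<bar>t\<bar> < d/2" for s t
  proof -
    have "shift k t (shift l s y) \<in> model_space m n" using ym k l by (intro shift_in_model_space)
    moreover have "\<forall>i\<in>coords m n. \<bar>co i (shift k t (shift l s y)) - co i y\<bar> < d"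
      using that d(1) by (auto simp: co_shift)
    ultimately show ?thesis using d(2) l unfolding A_def by (meson less_imp_le)
  qed
  have pk: "has_pderiv k g z (pderiv_at k g z)" if "z \<in> S" for z
    using C_k_SucD(1)[of m n 0] g1(2) k that by simp
  have pl: "has_pderiv l (pderiv_at k g) z (pderiv_at l (pderiv_at k g) z)" if "z \<in> S" for z
    using C_k_SucD(1)[of m n 0] g1(1) l that by simp
  have main: "norm (g (shift k s (shift l s y)) - g (shift k s y) - g (shift l s y) + g y - (s * s) *\<^sub>R A) \<le> e * (s * s)"
    if s: "\<bar>s\<bar> < d/2" for s
  proof -
    \<comment> \<open>The mean value inequality is used twice, in direction \<open>l\<close> for
      \<open>pderiv_at k g\<close> and then in direction \<open>k\<close> for the difference
      \<open>h\<close>, each use contributing one factor \<open>s\<close>.\<close>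
    define h where "h = (\<lambda>z. g (shift l s z) - g z)"
    have inner: "norm (pderiv_at k g (shift l s (shift k t y)) - pderiv_at k g (shift k t y) - s *\<^sub>R A) \<le> e * \<bar>s\<bar>"
      if t: "\<bar>t\<bar> \<le> \<bar>s\<bar>" for t
    proof (rule shift_bound)
      fix r assume r: "\<bar>r\<bar> \<le> \<bar>s\<bar>"
      have "shift l r (shift k t y) = shift k t (shift l r y)" by (rule shift_commute)
      then have *: "shift l r (shift k t y) \<in> S \<and> norm (pderiv_at l (pderiv_at k g) (shift l r (shift k t y)) - A) \<le> e"
        using box[of r t] r t s by simp
      show "has_pderiv l (pderiv_at k g) (shift l r (shift k t y)) (pderiv_at l (pderiv_at k g) (shift l r (shift k t y)))"
        using pl * by blast
      show "norm (pderiv_at l (pderiv_at k g) (shift l r (shift k t y)) - A) \<le> e" using * by blast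
    qed
    have "norm (h (shift k s y) - h y - s *\<^sub>R (s *\<^sub>R A)) \<le> (e * \<bar>s\<bar>) * \<bar>s\<bar>"
    proof (rule shift_bound)
      fix t assume t: "\<bar>t\<bar> \<le> \<bar>s\<bar>"
      have 1: "shift l s (shift k t y) \<in> S" using box[of s t] s t by (simp add: shift_commute[of l])
      have 2: "shift k t y \<in> S" using box[of 0 t] s t d(1) by simp
      have "((\<lambda>r. g (shift k r (shift l s (shift k t y)))) has_vector_derivative pderiv_at k g (shift l s (shift k t y))) (at 0)"
        using pk[OF 1] by (simp add: has_pderiv_def)
      moreover have "((\<lambda>r. g (shift k r (shift k t y))) has_vector_derivative pderiv_at k g (shift k t y)) (at 0)"
        using pk[OF 2] by (simp add: has_pderiv_def)
      ultimately have "((\<lambda>r. g (shift k r (shift l s (shift k t y))) - g (shift k r (shift k t y))) has_vector_derivative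
         pderiv_at k g (shift l s (shift k t y)) - pderiv_at k g (shift k t y)) (at 0)"
        by (rule has_vector_derivative_diff)
      moreover have "(\<lambda>r. g (shift k r (shift l s (shift k t y))) - g (shift k r (shift k t y))) = (\<lambda>r. h (shift k r (shift k t y)))"
        by (rule ext) (simp add: h_def shift_commute[of l s k])
      ultimately show "has_pderiv k h (shift k t y) (pderiv_at k g (shift l s (shift k t y)) - pderiv_at k g (shift k t y))"
        by (simp add: has_pderiv_def)
    qed (rule inner)
    moreover have "h (shift k s y) - h y - s *\<^sub>R (s *\<^sub>R A) =
      g (shift k s (shift l s y)) - g (shift k s y) - g (shift l s y) + g y - (s * s) *\<^sub>R A"
      by (simp add: h_def shift_commute[of l s k])
    ultimately show ?thesis by (simp only: mult.assoc)
  qed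
  show ?thesis by (rule exI[of _ "d/2"]) (use main d(1) in \<open>simp add: A_def\<close>)
qed

lemma pderiv_commute:
  assumes S: "model_open m n S" and y: "y \<in> S" and g: "smooth_on m n S g"
    and k: "k \<in> coords m n" and l: "l \<in> coords m n"
  shows "pderiv_at k (pderiv_at l g) y = pderiv_at l (pderiv_at k g) y"
proof -
  have "norm (pderiv_at k (pderiv_at l g) y - pderiv_at l (pderiv_at k g) y) \<le> e" if "e > 0" for e
  proof -
    note g2 = smooth_onD[OF g, of 2]
    have e: "e/2 > 0" using that by simp
    obtain d1 where d1: "d1 > 0" "\<forall>s. \<bar>s\<bar> < d1 \<longrightarrow>
     norm (g (shift k s (shift l s y)) - g (shift k s y) - g (shift l s y) + g y
           - (s * s) *\<^sub>R pderiv_at l (pderiv_at k g) y) \<le> e/2 * (s * s)"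
      using second_difference_bound[OF S y g2 k l e] by blast
    obtain d2 where d2: "d2 > 0" "\<forall>s. \<bar>s\<bar> < d2 \<longrightarrow>
     norm (g (shift l s (shift k s y)) - g (shift l s y) - g (shift k s y) + g y
           - (s * s) *\<^sub>R pderiv_at k (pderiv_at l g) y) \<le> e/2 * (s * s)"
      using second_difference_bound[OF S y g2 l k e] by blast
    define s where "s = min d1 d2 / 2"
    have s: "s > 0" "\<bar>s\<bar> < d1" "\<bar>s\<bar> < d2" using d1(1) d2(1) by (auto simp: s_def)
    define H where "H = g (shift k s (shift l s y)) - g (shift k s y) - g (shift l s y) + g y"
    have H2: "g (shift l s (shift k s y)) - g (shift l s y) - g (shift k s y) + g y = H"
      by (simp add: H_def shift_commute[of l s k])
    have a: "norm (H - (s * s) *\<^sub>R pderiv_at l (pderiv_at k g) y) \<le> e/2 * (s * s)"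
      using d1(2)[rule_format, OF s(2)] by (simp add: H_def)
    have b: "norm (H - (s * s) *\<^sub>R pderiv_at k (pderiv_at l g) y) \<le> e/2 * (s * s)"
      using d2(2)[rule_format, OF s(3)] unfolding H2 .
    have "(s * s) *\<^sub>R (pderiv_at k (pderiv_at l g) y - pderiv_at l (pderiv_at k g) y) =
      (H - (s * s) *\<^sub>R pderiv_at l (pderiv_at k g) y) - (H - (s * s) *\<^sub>R pderiv_at k (pderiv_at l g) y)"
      by (simp add: algebra_simps)
    then have "norm ((s * s) *\<^sub>R (pderiv_at k (pderiv_at l g) y - pderiv_at l (pderiv_at k g) y)) \<le> e/2 * (s * s) + e/2 * (s * s)"
      using norm_triangle_le_diff[of "H - (s * s) *\<^sub>R pderiv_at l (pderiv_at k g) y" "H - (s * s) *\<^sub>R pderiv_at k (pderiv_at l g) y"] a b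
      by simp
    then have "(s * s) * norm (pderiv_at k (pderiv_at l g) y - pderiv_at l (pderiv_at k g) y) \<le> (s * s) * e"
      by (simp add: mult.commute)
    then show ?thesis using s(1) by simp
  qed
  then have "norm (pderiv_at k (pderiv_at l g) y - pderiv_at l (pderiv_at k g) y) \<le> 0"
    by (metis dense_ge)
  then show ?thesis by simp
qed

section \<open>Total differentiability and derivatives along curves\<close>

primrec translate :: "coord list \<Rightarrow> (coord \<Rightarrow> real) \<Rightarrow> model \<Rightarrow> model" where
  "translate [] h y = y"
| "translate (k # ks) h y = shift k (h k) (translate ks h y)"

lemma co_translate: "distinct ks \<Longrightarrow> co l (translate ks h y) = co l y + (if l \<in> set ks then h l else 0)"
  by (induction ks) (auto simp: co_shift)

lemma translate_in_model_space:
  "y \<in> model_space m n \<Longrightarrow> set ks \<subseteq> coords m n \<Longrightarrow> translate ks h y \<in> model_space m n"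
  by (induction ks) (auto intro: shift_in_model_space)

text \<open>Continuous partial derivatives give total differentiability: the displacement is made
  one coordinate at a time, and \<open>shift_bound\<close> compares each move with the derivative at
  the starting point \<open>y\<close>.\<close>

lemma translate_bound:
  assumes S: "model_open m n S" and y: "y \<in> S" and g: "C_k m n 1 S g" and e: "e > 0"
  shows "\<exists>d>0. \<forall>h. (\<forall>k\<in>coords m n. \<bar>h k\<bar> < d) \<longrightarrow>
    (\<forall>ks. distinct ks \<and> set ks \<subseteq> coords m n \<longrightarrow>
       norm (g (translate ks h y) - g y - (\<Sum>k\<in>set ks. h k *\<^sub>R pderiv_at k g y)) \<le> e * (\<Sum>k\<in>set ks. \<bar>h k\<bar>))"
proof -
  obtain d where d: "d > 0" "\<forall>y'\<in>model_space m n. (\<forall>k\<in>coords m n. \<bar>co k y' - co k y\<bar> < d) \<longrightarrow>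
     y' \<in> S \<and> (\<forall>k\<in>coords m n. norm (pderiv_at k g y' - pderiv_at k g y) < e)"
    using pderiv_box[OF S y g e] by blast
  have ym: "y \<in> model_space m n" using y S model_open_imp_subset by blast
  have pk: "has_pderiv k g z (pderiv_at k g z)" if "z \<in> S" "k \<in> coords m n" for z k
    using C_k_SucD(1)[of m n 0] g that by simp
  have "norm (g (translate ks h y) - g y - (\<Sum>k\<in>set ks. h k *\<^sub>R pderiv_at k g y)) \<le> e * (\<Sum>k\<in>set ks. \<bar>h k\<bar>)"
    if h: "\<forall>k\<in>coords m n. \<bar>h k\<bar> < d" and ks: "distinct ks" "set ks \<subseteq> coords m n" for h ks
    using ks
  proof (induction ks)
    case (Cons k ks)
    define z where "z = translate ks h y"
    have k: "k \<in> coords m n" "k \<notin> set ks" using Cons.prems by auto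
    have box: "shift k t z \<in> S \<and> (\<forall>i\<in>coords m n. norm (pderiv_at i g (shift k t z) - pderiv_at i g y) < e)"
      if "\<bar>t\<bar> \<le> \<bar>h k\<bar>" for t
    proof -
      have a: "shift k t z \<in> model_space m n" unfolding z_def
        using ym Cons.prems by (intro shift_in_model_space translate_in_model_space) auto
      have b: "\<forall>i\<in>coords m n. \<bar>co i (shift k t z) - co i y\<bar> < d"
      proof
        fix i assume i: "i \<in> coords m n"
        show "\<bar>co i (shift k t z) - co i y\<bar> < d"
          using that h[rule_format, OF i] h[rule_format, OF k(1)] d(1) Cons.prems k(2)
          by (auto simp: co_shift z_def co_translate)
      qed
      show ?thesis by (rule mp[OF bspec[OF d(2) a] b])
    qed
    have "norm (g (shift k (h k) z) - g z - h k *\<^sub>R pderiv_at k g y) \<le> e * \<bar>h k\<bar>"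
    proof (rule shift_bound)
      fix t assume t: "\<bar>t\<bar> \<le> \<bar>h k\<bar>"
      show "has_pderiv k g (shift k t z) (pderiv_at k g (shift k t z))" using pk box[OF t] k by blast
      show "norm (pderiv_at k g (shift k t z) - pderiv_at k g y) \<le> e" using box[OF t] k less_imp_le by blast
    qed
    moreover have "norm (g z - g y - (\<Sum>k\<in>set ks. h k *\<^sub>R pderiv_at k g y)) \<le> e * (\<Sum>k\<in>set ks. \<bar>h k\<bar>)"
      using Cons unfolding z_def by simp
    ultimately have "norm ((g (shift k (h k) z) - g z - h k *\<^sub>R pderiv_at k g y) + (g z - g y - (\<Sum>k\<in>set ks. h k *\<^sub>R pderiv_at k g y)))
       \<le> e * \<bar>h k\<bar> + e * (\<Sum>k\<in>set ks. \<bar>h k\<bar>)" by (rule norm_triangle_mono)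
    then show ?case using k(2) by (simp add: z_def algebra_simps)
  qed simp
  then show ?thesis using d(1) by blast
qed

text \<open>\<open>translate_bound\<close> is applied to the displacement of the curve, which is at
  most a constant times \<open>\<bar>s\<bar>\<close>, so the error is \<open>o(s)\<close>. In
  \<open>has_pderiv_compose\<close> the curve is known to stay in the model space only for small
  parameters, hence the eventual condition.\<close>

lemma has_vector_derivative_along_curve:
  assumes S: "model_open m n S" and g: "C_k m n 1 S g"
    and \<gamma>: "\<gamma> 0 \<in> S" "eventually (\<lambda>s. \<gamma> s \<in> model_space m n) (nhds (0::real))"
    and d\<gamma>: "\<And>k. k \<in> coords m n \<Longrightarrow> ((\<lambda>s. co k (\<gamma> s)) has_real_derivative c k) (at 0)"
  shows "((\<lambda>s. g (\<gamma> s)) has_vector_derivative (\<Sum>k\<in>coords m n. c k *\<^sub>R pderiv_at k g (\<gamma> 0))) (at 0)"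
proof -
  define y where "y = \<gamma> 0"
  have ym: "y \<in> model_space m n" using \<gamma>(1) S model_open_imp_subset y_def by blast
  obtain ks where ks: "distinct ks" "set ks = coords m n"
    using finite_distinct_list[OF finite_coords] by blast
  define h where "h = (\<lambda>s k. co k (\<gamma> s) - co k y)"
  have tr: "translate ks (h s) y = \<gamma> s" if "\<gamma> s \<in> model_space m n" for s
  proof (rule model_eqI)
    fix k show "co k (translate ks (h s) y) = co k (\<gamma> s)"
      using that ym ks by (auto simp: co_translate h_def model_space_iff)
  qed
  define R where "R = (\<lambda>s. g (\<gamma> s) - g y - (\<Sum>k\<in>coords m n. h s k *\<^sub>R pderiv_at k g y))"
  \<comment> \<open>A bound for the sum of the Lipschitz constants near 0, hence for each of them;
    the last 1 keeps it positive when there are no coordinates.\<close>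
  define C where "C = (\<Sum>k\<in>coords m n. \<bar>c k\<bar> + 1) + 1"
  have Cpos: "C > 0" unfolding C_def by (intro add_nonneg_pos sum_nonneg) auto
  have hbound: "eventually (\<lambda>s. \<bar>h s k\<bar> \<le> (\<bar>c k\<bar> + 1) * \<bar>s\<bar>) (nhds 0)" if "k \<in> coords m n" for k
  proof -
    have "((\<lambda>s. co k (\<gamma> s)) has_derivative (\<lambda>s. c k * s)) (at 0)"
      using d\<gamma>[OF that] by (simp add: has_field_derivative_def)
    then obtain d where d: "d > 0" "\<And>s. \<bar>s\<bar> < d \<Longrightarrow> \<bar>co k (\<gamma> s) - co k (\<gamma> 0) - c k * s\<bar> \<le> 1 * \<bar>s\<bar>"
      unfolding has_derivative_at_alt by (metis diff_zero real_norm_def zero_less_one)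
    have "\<bar>h s k\<bar> \<le> (\<bar>c k\<bar> + 1) * \<bar>s\<bar>" if "\<bar>s\<bar> < d" for s
    proof -
      have "\<bar>h s k\<bar> \<le> \<bar>c k * s\<bar> + 1 * \<bar>s\<bar>" using d(2)[OF that] unfolding h_def y_def by linarith
      then show ?thesis by (simp add: abs_mult algebra_simps)
    qed
    then show ?thesis using d(1) by (auto simp: eventually_nhds_metric dist_real_def)
  qed
  have hb: "eventually (\<lambda>s. \<forall>k\<in>coords m n. \<bar>h s k\<bar> \<le> (\<bar>c k\<bar> + 1) * \<bar>s\<bar>) (nhds 0)"
    using hbound by (simp add: eventually_ball_finite)
  have "(R has_derivative (\<lambda>s. 0)) (at 0)"
    unfolding has_derivative_at_alt
  proof (intro conjI allI impI)
    fix e :: real assume e: "e > 0"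
    then have e': "e / C > 0" using Cpos by simp
    obtain d where d: "d > 0" "\<forall>h. (\<forall>k\<in>coords m n. \<bar>h k\<bar> < d) \<longrightarrow>
    (\<forall>ks. distinct ks \<and> set ks \<subseteq> coords m n \<longrightarrow>
       norm (g (translate ks h y) - g y - (\<Sum>k\<in>set ks. h k *\<^sub>R pderiv_at k g y)) \<le> e / C * (\<Sum>k\<in>set ks. \<bar>h k\<bar>))"
      using translate_bound[OF S \<gamma>(1)[folded y_def] g e'] by (elim exE conjE) (rule that)
    have dC: "d / C > 0" using d(1) Cpos by simp
    obtain d1 where d1: "d1 > 0" "\<And>s. \<bar>s\<bar> < d1 \<Longrightarrow> \<gamma> s \<in> model_space m n"
      "\<And>s k. \<bar>s\<bar> < d1 \<Longrightarrow> k \<in> coords m n \<Longrightarrow> \<bar>h s k\<bar> \<le> (\<bar>c k\<bar> + 1) * \<bar>s\<bar>"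
      using eventually_conj[OF \<gamma>(2) hb] by (auto simp: eventually_nhds_metric dist_real_def)
    show "\<exists>d>0. \<forall>s. norm (s - 0) < d \<longrightarrow> norm (R s - R 0 - 0) \<le> e * norm (s - 0)"
    proof (intro exI[of _ "min d1 (d / C)"] conjI allI impI)
      fix s :: real assume "norm (s - 0) < min d1 (d / C)"
      then have s: "\<bar>s\<bar> < d1" "\<bar>s\<bar> < d / C" by auto
      have le: "(\<bar>c k\<bar> + 1) \<le> C" if "k \<in> coords m n" for k
        using member_le_sum[OF that, of "\<lambda>k. \<bar>c k\<bar> + 1"] unfolding C_def by simp
      have hd: "\<forall>k\<in>coords m n. \<bar>h s k\<bar> < d"
      proof
        fix k assume k: "k \<in> coords m n"
        have "\<bar>h s k\<bar> \<le> C * \<bar>s\<bar>"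
          using d1(3)[OF s(1) k] mult_right_mono[OF le[OF k], of "\<bar>s\<bar>"] by simp
        also have "\<dots> < d" using s(2) Cpos by (simp add: field_simps)
        finally show "\<bar>h s k\<bar> < d" .
      qed
      have "norm (g (translate ks (h s) y) - g y - (\<Sum>k\<in>set ks. h s k *\<^sub>R pderiv_at k g y)) \<le> e / C * (\<Sum>k\<in>set ks. \<bar>h s k\<bar>)"
        by (rule mp[OF spec[OF mp[OF spec[OF d(2)] hd]]]) (simp add: ks)
      then have "norm (R s) \<le> e / C * (\<Sum>k\<in>coords m n. \<bar>h s k\<bar>)"
        using tr[OF d1(2)[OF s(1)]] ks by (simp add: R_def)
      also have "\<dots> \<le> e / C * (C * \<bar>s\<bar>)"
      proof (rule mult_left_mono)
        have "(\<Sum>k\<in>coords m n. \<bar>h s k\<bar>) \<le> (\<Sum>k\<in>coords m n. (\<bar>c k\<bar> + 1) * \<bar>s\<bar>)"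
          by (intro sum_mono d1(3) s)
        also have "\<dots> = (\<Sum>k\<in>coords m n. \<bar>c k\<bar> + 1) * \<bar>s\<bar>"
          by (simp only: sum_distrib_right)
        also have "\<dots> \<le> C * \<bar>s\<bar>" unfolding C_def by (intro mult_right_mono) auto
        finally show "(\<Sum>k\<in>coords m n. \<bar>h s k\<bar>) \<le> C * \<bar>s\<bar>" .
      qed (rule less_imp_le[OF e'])
      finally have "norm (R s) \<le> e / C * (C * \<bar>s\<bar>)" .
      then have "norm (R s) \<le> e * \<bar>s\<bar>" using Cpos by simp
      moreover have "R 0 = 0" by (simp add: R_def h_def y_def)
      ultimately show "norm (R s - R 0 - 0) \<le> e * norm (s - 0)" by simp
    qed (use d1(1) dC in simp)
  qed simp
  then have R: "(R has_vector_derivative 0) (at 0)" by (simp add: has_vector_derivative_def)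
  have "((\<lambda>s. h s k) has_real_derivative c k - 0) (at 0)" if "k \<in> coords m n" for k
    unfolding h_def by (intro DERIV_diff d\<gamma> that) simp
  then have "((\<lambda>s. \<Sum>k\<in>coords m n. h s k *\<^sub>R pderiv_at k g y) has_vector_derivative (\<Sum>k\<in>coords m n. c k *\<^sub>R pderiv_at k g y)) (at 0)"
    by (intro has_vector_derivative_sum has_vector_derivative_scaleR[THEN has_vector_derivative_eq_rhs] has_vector_derivative_const) auto
  from has_vector_derivative_add[OF has_vector_derivative_add[OF R this] has_vector_derivative_const[of "g y"]]
  show ?thesis by (simp add: R_def y_def)
qed

section \<open>Wirtinger derivatives\<close>

text \<open>With \<open>\<sigma> = -\<i>\<close> this is the derivative by \<open>z\<^sup>a\<close>,
  with \<open>\<sigma> = \<i>\<close> the one by its conjugate, so that each rule is proved once for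
  both.\<close>

definition dd :: "complex \<Rightarrow> nat \<Rightarrow> (model \<Rightarrow> complex) \<Rightarrow> model \<Rightarrow> complex" where
  "dd \<sigma> a g y = (pderiv_at (ReZ a) g y + \<sigma> * pderiv_at (ImZ a) g y) / 2"

lemma d_dz_eq: "d_dz = dd (- \<i>)"
  by (intro ext) (simp add: d_dz_def dd_def)

lemma d_dzbar_eq: "d_dzbar = dd \<i>"
  by (intro ext) (simp add: d_dzbar_def dd_def)

lemma dd_cong:
  assumes "model_open m n S" "y \<in> S" "a < m" "\<And>y. y \<in> S \<Longrightarrow> g y = g' y"
  shows "dd \<sigma> a g y = dd \<sigma> a g' y"
proof -
  have "pderiv_at (ReZ a) g y = pderiv_at (ReZ a) g' y"
    by (rule pderiv_at_cong[OF assms(1,2)]) (use assms(3) in simp, rule assms(4))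
  moreover have "pderiv_at (ImZ a) g y = pderiv_at (ImZ a) g' y"
    by (rule pderiv_at_cong[OF assms(1,2)]) (use assms(3) in simp, rule assms(4))
  ultimately show ?thesis by (simp add: dd_def)
qed

lemma pderiv_const [simp]: "pderiv_at k (\<lambda>y. a) y = 0"
  by (rule has_pderiv_imp[OF has_pderiv_const])

lemma dd_const [simp]: "dd \<sigma> a (\<lambda>y. c) y = 0"
  by (simp add: dd_def)

lemma pderiv_add:
  assumes "smooth_on m n S g" "smooth_on m n S g'" "y \<in> S" "k \<in> coords m n"
  shows "pderiv_at k (\<lambda>y. g y + g' y) y = pderiv_at k g y + pderiv_at k g' y"
  by (rule has_pderiv_imp[OF has_pderiv_add]) (rule smooth_on_has_pderiv; use assms in simp)+

lemma pderiv_mult: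
  assumes "smooth_on m n S g" "smooth_on m n S g'" "y \<in> S" "k \<in> coords m n"
  shows "pderiv_at k (\<lambda>y. g y * g' y) y = g y * pderiv_at k g' y + pderiv_at k g y * g' y"
  by (rule has_pderiv_imp[OF has_pderiv_mult]) (rule smooth_on_has_pderiv; use assms in simp)+

lemma pderiv_linear:
  assumes "bounded_linear L" "smooth_on m n S g" "y \<in> S" "k \<in> coords m n"
  shows "pderiv_at k (\<lambda>y. L (g y)) y = L (pderiv_at k g y)"
  by (rule has_pderiv_imp[OF has_pderiv_linear[OF assms(1)]]) (rule smooth_on_has_pderiv; use assms in simp)

lemma dd_add:
  assumes "smooth_on m n S g" "smooth_on m n S g'" "y \<in> S" "a < m"
  shows "dd \<sigma> a (\<lambda>y. g y + g' y) y = dd \<sigma> a g y + dd \<sigma> a g' y"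
  by (simp add: dd_def pderiv_add[OF assms(1-3)] assms(4) algebra_simps add_divide_distrib)

lemma dd_mult:
  assumes "smooth_on m n S g" "smooth_on m n S g'" "y \<in> S" "a < m"
  shows "dd \<sigma> a (\<lambda>y. g y * g' y) y = g y * dd \<sigma> a g' y + dd \<sigma> a g y * g' y"
  by (simp add: dd_def pderiv_mult[OF assms(1-3)] assms(4) algebra_simps add_divide_distrib)

lemma dd_cmult:
  assumes "smooth_on m n S g" "y \<in> S" "a < m"
  shows "dd \<sigma> a (\<lambda>y. c * g y) y = c * dd \<sigma> a g y"
  using dd_mult[OF smooth_on_const assms, of \<sigma> c] by simp

lemma dd_cnj:
  assumes "smooth_on m n S g" "y \<in> S" "a < m"
  shows "dd \<sigma> a (\<lambda>y. cnj (g y)) y = cnj (dd (cnj \<sigma>) a g y)"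
  by (simp add: dd_def pderiv_linear[OF bounded_linear_cnj assms(1,2)] assms(3))

lemma smooth_on_dd:
  assumes "model_open m n S" "smooth_on m n S g" "a < m"
  shows "smooth_on m n S (dd \<sigma> a g)"
proof -
  have "smooth_on m n S (\<lambda>y. (pderiv_at (ReZ a) g y + \<sigma> * pderiv_at (ImZ a) g y) * (1/2))"
    by (intro smooth_on_add smooth_on_mult smooth_on_const smooth_on_pderiv[OF assms(2)] assms(1)) (use assms(3) in auto)
  moreover have "(\<lambda>y. (pderiv_at (ReZ a) g y + \<sigma> * pderiv_at (ImZ a) g y) * (1/2)) = dd \<sigma> a g"
    by (rule ext) (simp add: dd_def)
  ultimately show ?thesis by simp
qed

lemma pderiv_dd:
  assumes S: "model_open m n S" and g: "smooth_on m n S g" and y: "y \<in> S" and a: "a < m" and k: "k \<in> coords m n"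
  shows "pderiv_at k (dd \<sigma> a g) y = (pderiv_at k (pderiv_at (ReZ a) g) y + \<sigma> * pderiv_at k (pderiv_at (ImZ a) g) y) / 2"
proof -
  have s: "smooth_on m n S (pderiv_at (ReZ a) g)" "smooth_on m n S (pderiv_at (ImZ a) g)"
    using smooth_on_pderiv[OF g] a by auto
  have "dd \<sigma> a g = (\<lambda>y. (1/2) * (pderiv_at (ReZ a) g y + \<sigma> * pderiv_at (ImZ a) g y))"
    by (rule ext) (simp add: dd_def)
  then have "pderiv_at k (dd \<sigma> a g) y = (1/2) * (pderiv_at k (pderiv_at (ReZ a) g) y + \<sigma> * pderiv_at k (pderiv_at (ImZ a) g) y)"
    by (simp only: pderiv_mult[OF smooth_on_const smooth_on_add[OF S s(1) smooth_on_mult[OF S smooth_on_const s(2)]] y k]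
       pderiv_add[OF s(1) smooth_on_mult[OF S smooth_on_const s(2)] y k] pderiv_mult[OF smooth_on_const s(2) y k]
       pderiv_const mult_zero_left add_0_right)
  then show ?thesis by simp
qed

lemma dd_commute:
  assumes S: "model_open m n S" and g: "smooth_on m n S g" and y: "y \<in> S" and a: "a < m" and b: "b < m"
  shows "dd \<sigma> a (dd \<tau> b g) y = dd \<tau> b (dd \<sigma> a g) y"
proof -
  have c: "pderiv_at k (pderiv_at l g) y = pderiv_at l (pderiv_at k g) y"
    if "k \<in> coords m n" "l \<in> coords m n" for k l using pderiv_commute[OF S y g that] .
  have [simp]: "ReZ a \<in> coords m n" "ReZ b \<in> coords m n" "ImZ a \<in> coords m n" "ImZ b \<in> coords m n"
    using a b by auto
  note [simp] = pderiv_dd[OF S g y]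
  show ?thesis unfolding dd_def[of \<sigma> a "dd \<tau> b g"] dd_def[of \<tau> b "dd \<sigma> a g"]
    using c[of "ReZ a" "ReZ b"] c[of "ReZ a" "ImZ b"] c[of "ImZ a" "ReZ b"] c[of "ImZ a" "ImZ b"] a b
    by (simp add: field_simps)
qed

text \<open>The factor is 1 for \<open>\<sigma> = -\<i>\<close> and 0 for
  \<open>\<sigma> = \<i>\<close>.\<close>

lemma dd_fst:
  assumes a: "a < m"
  shows "dd \<sigma> a (\<lambda>y. fst y b) y = (if a = b then (1 + \<i> * \<sigma>) / 2 else 0)"
proof -
  have "(\<lambda>s. fst (shift (ReZ a) s y) b) = (\<lambda>s. fst y b + (if a = b then of_real s else 0))"
    by (cases y) auto
  then have 1: "pderiv_at (ReZ a) (\<lambda>y. fst y b) y = (if a = b then 1 else 0)"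
    by (intro has_pderiv_imp) (auto simp: has_pderiv_def intro!: derivative_eq_intros)
  have "(\<lambda>s. fst (shift (ImZ a) s y) b) = (\<lambda>s. fst y b + (if a = b then \<i> * of_real s else 0))"
    by (cases y) auto
  then have 2: "pderiv_at (ImZ a) (\<lambda>y. fst y b) y = (if a = b then \<i> else 0)"
    by (intro has_pderiv_imp) (auto simp: has_pderiv_def intro!: derivative_eq_intros)
  show ?thesis by (simp add: dd_def 1 2 mult.commute)
qed

text \<open>The chain rule is the derivative of \<open>g\<close> along the curve \<open>s \<mapsto> T (shift k s y)\<close>.\<close>

lemma has_pderiv_compose:
  assumes S: "model_open m n S" and S': "model_open m n S'" and g: "smooth_on m n S' g"
    and T: "T ` S \<subseteq> S'" and sm: "\<And>l. l \<in> coords m n \<Longrightarrow> smooth_on m n S (\<lambda>y. of_real (co l (T y)))"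
    and y: "y \<in> S" and k: "k \<in> coords m n"
  shows "has_pderiv k (\<lambda>y. g (T y)) y
    (\<Sum>l\<in>coords m n. pderiv_at l g (T y) * pderiv_at k (\<lambda>y. of_real (co l (T y))) y)"
proof -
  define c where "c = (\<lambda>l. Re (pderiv_at k (\<lambda>y. of_real (co l (T y))) y))"
  define \<gamma> where "\<gamma> = (\<lambda>s. T (shift k s y))"
  have d: "((\<lambda>s. of_real (co l (\<gamma> s)) :: complex) has_vector_derivative pderiv_at k (\<lambda>y. of_real (co l (T y))) y) (at 0)"
    if "l \<in> coords m n" for l
    using smooth_on_has_pderiv[OF sm[OF that] k y] by (simp add: has_pderiv_def \<gamma>_def)
  have dre: "((\<lambda>s. co l (\<gamma> s)) has_real_derivative c l) (at 0)" if "l \<in> coords m n" for l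
    using bounded_linear.has_vector_derivative[OF bounded_linear_Re d[OF that]]
    by (simp add: c_def has_real_derivative_iff_has_vector_derivative)
  have real: "pderiv_at k (\<lambda>y. of_real (co l (T y))) y = of_real (c l)" if "l \<in> coords m n" for l
  proof -
    have "((\<lambda>s. of_real (co l (\<gamma> s)) :: complex) has_vector_derivative of_real (c l)) (at 0)"
      using bounded_linear.has_vector_derivative[OF bounded_linear_of_real dre[OF that, unfolded has_real_derivative_iff_has_vector_derivative]] .
    from vector_derivative_unique_at[OF d[OF that] this] show ?thesis .
  qed
  have "((\<lambda>s. g (\<gamma> s)) has_vector_derivative (\<Sum>l\<in>coords m n. c l *\<^sub>R pderiv_at l g (\<gamma> 0))) (at 0)"
  proof (rule has_vector_derivative_along_curve[OF S' smooth_onD[OF g]])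
    show "\<gamma> 0 \<in> S'" using T y by (auto simp: \<gamma>_def)
    show "eventually (\<lambda>s. \<gamma> s \<in> model_space m n) (nhds 0)"
      using eventually_shift_in[OF S y k]
      by (rule eventually_mono) (use T model_open_imp_subset[OF S'] in \<open>auto simp: \<gamma>_def\<close>)
  qed (rule dre)
  then have "has_pderiv k (\<lambda>y. g (T y)) y (\<Sum>l\<in>coords m n. c l *\<^sub>R pderiv_at l g (T y))"
    by (simp add: has_pderiv_def \<gamma>_def)
  moreover have "(\<Sum>l\<in>coords m n. c l *\<^sub>R pderiv_at l g (T y)) =
      (\<Sum>l\<in>coords m n. pderiv_at l g (T y) * pderiv_at k (\<lambda>y. of_real (co l (T y))) y)"
    by (rule sum.cong) (auto simp: real scaleR_conv_of_real)
  ultimately show ?thesis by simp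
qed

lemmas pderiv_compose = has_pderiv_compose[THEN has_pderiv_imp]

lemma sum_coords:
  fixes F :: "coord \<Rightarrow> 'b::comm_monoid_add"
  shows "(\<Sum>l\<in>coords m n. F l) = (\<Sum>b<m. F (ReZ b) + F (ImZ b)) + (\<Sum>b<n. F (RealX b))"
proof -
  have "(\<Sum>l\<in>coords m n. F l) = (\<Sum>l\<in>ReZ ` {..<m} \<union> ImZ ` {..<m}. F l) + (\<Sum>l\<in>RealX ` {..<n}. F l)"
    unfolding coords_def by (rule sum.union_disjoint) auto
  also have "(\<Sum>l\<in>ReZ ` {..<m} \<union> ImZ ` {..<m}. F l) = (\<Sum>l\<in>ReZ ` {..<m}. F l) + (\<Sum>l\<in>ImZ ` {..<m}. F l)"
    by (rule sum.union_disjoint) auto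
  finally show ?thesis
    by (simp add: sum.reindex inj_on_def sum.distrib)
qed

text \<open>The real chain rule, with the terms of the real and imaginary part of each complex
  coordinate regrouped into Wirtinger derivatives. The sum over the transverse coordinates
  disappears for coordinate changes of a foliation (\<open>transition_leaf\<close>).\<close>

lemma dd_compose:
  assumes S: "model_open m n S" and S': "model_open m n S'" and g: "smooth_on m n S' g"
    and T: "T ` S \<subseteq> S'"
    and sz: "\<And>b. b < m \<Longrightarrow> smooth_on m n S (\<lambda>y. fst (T y) b)"
    and st: "\<And>b. b < n \<Longrightarrow> smooth_on m n S (\<lambda>y. of_real (snd (T y) b))"
    and y: "y \<in> S" and a: "a < m"
  shows "dd \<sigma> a (\<lambda>y. g (T y)) y =
    (\<Sum>b<m. dd (-\<i>) b g (T y) * dd \<sigma> a (\<lambda>y. fst (T y) b) y + dd \<i> b g (T y) * dd \<sigma> a (\<lambda>y. cnj (fst (T y) b)) y)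
     + (\<Sum>b<n. pderiv_at (RealX b) g (T y) * dd \<sigma> a (\<lambda>y. of_real (snd (T y) b)) y)"
proof -
  have Re: "smooth_on m n S (\<lambda>y. of_real (Re (fst (T y) b)))" if "b < m" for b
    by (rule smooth_on_linear[OF S bounded_linear_compose[OF bounded_linear_of_real bounded_linear_Re] sz[OF that]])
  have Im: "smooth_on m n S (\<lambda>y. of_real (Im (fst (T y) b)))" if "b < m" for b
    by (rule smooth_on_linear[OF S bounded_linear_compose[OF bounded_linear_of_real bounded_linear_Im] sz[OF that]])
  have sm: "smooth_on m n S (\<lambda>y. of_real (co l (T y)))" if "l \<in> coords m n" for l
    using that Re Im st by (cases l) auto
  have pc: "pderiv_at k (\<lambda>y. g (T y)) y =
    (\<Sum>l\<in>coords m n. pderiv_at l g (T y) * pderiv_at k (\<lambda>y. of_real (co l (T y))) y)"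
    if "k \<in> coords m n" for k
    by (rule pderiv_compose[OF S S' g T _ y that]) (rule sm)
  have "dd \<sigma> a (\<lambda>y. g (T y)) y = (\<Sum>l\<in>coords m n. pderiv_at l g (T y) * dd \<sigma> a (\<lambda>y. of_real (co l (T y))) y)"
    unfolding dd_def using pc[of "ReZ a"] pc[of "ImZ a"] a
    by (simp add: sum_distrib_left sum.distrib[symmetric] sum_divide_distrib ring_distribs mult_ac)
  also have "\<dots> = (\<Sum>b<m. pderiv_at (ReZ b) g (T y) * dd \<sigma> a (\<lambda>y. of_real (Re (fst (T y) b))) y +
       pderiv_at (ImZ b) g (T y) * dd \<sigma> a (\<lambda>y. of_real (Im (fst (T y) b))) y)
     + (\<Sum>b<n. pderiv_at (RealX b) g (T y) * dd \<sigma> a (\<lambda>y. of_real (snd (T y) b)) y)"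
    by (simp add: sum_coords)
  also have "(\<Sum>b<m. pderiv_at (ReZ b) g (T y) * dd \<sigma> a (\<lambda>y. of_real (Re (fst (T y) b))) y +
       pderiv_at (ImZ b) g (T y) * dd \<sigma> a (\<lambda>y. of_real (Im (fst (T y) b))) y) =
     (\<Sum>b<m. dd (-\<i>) b g (T y) * dd \<sigma> a (\<lambda>y. fst (T y) b) y + dd \<i> b g (T y) * dd \<sigma> a (\<lambda>y. cnj (fst (T y) b)) y)"
  proof (rule sum.cong[OF refl])
    fix b assume "b \<in> {..<m}"
    then have b: "b < m" by simp
    have im: "smooth_on m n S (\<lambda>y. c * of_real (Im (fst (T y) b)))" for c
      by (rule smooth_on_mult[OF S smooth_on_const Im[OF b]])
    have "(\<lambda>y. fst (T y) b) = (\<lambda>y. of_real (Re (fst (T y) b)) + \<i> * of_real (Im (fst (T y) b)))"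
      by (rule ext) (simp add: complex_eq)
    then have "dd \<sigma> a (\<lambda>y. fst (T y) b) y = dd \<sigma> a (\<lambda>y. of_real (Re (fst (T y) b)) + \<i> * of_real (Im (fst (T y) b))) y"
      by (rule arg_cong[where f = "\<lambda>g. dd \<sigma> a g y"])
    then have 1: "dd \<sigma> a (\<lambda>y. fst (T y) b) y = dd \<sigma> a (\<lambda>y. of_real (Re (fst (T y) b))) y + \<i> * dd \<sigma> a (\<lambda>y. of_real (Im (fst (T y) b))) y"
      by (simp only: dd_add[OF Re[OF b] im y a] dd_cmult[OF Im[OF b] y a])
    have "(\<lambda>y. cnj (fst (T y) b)) = (\<lambda>y. of_real (Re (fst (T y) b)) + (- \<i>) * of_real (Im (fst (T y) b)))"
      by (rule ext) (simp add: complex_eq_iff)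
    then have "dd \<sigma> a (\<lambda>y. cnj (fst (T y) b)) y = dd \<sigma> a (\<lambda>y. of_real (Re (fst (T y) b)) + (- \<i>) * of_real (Im (fst (T y) b))) y"
      by (rule arg_cong[where f = "\<lambda>g. dd \<sigma> a g y"])
    then have 2: "dd \<sigma> a (\<lambda>y. cnj (fst (T y) b)) y = dd \<sigma> a (\<lambda>y. of_real (Re (fst (T y) b))) y + (- \<i>) * dd \<sigma> a (\<lambda>y. of_real (Im (fst (T y) b))) y"
      by (simp only: dd_add[OF Re[OF b] im y a] dd_cmult[OF Im[OF b] y a])
    show "pderiv_at (ReZ b) g (T y) * dd \<sigma> a (\<lambda>y. of_real (Re (fst (T y) b))) y +
       pderiv_at (ImZ b) g (T y) * dd \<sigma> a (\<lambda>y. of_real (Im (fst (T y) b))) y =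
       dd (-\<i>) b g (T y) * dd \<sigma> a (\<lambda>y. fst (T y) b) y + dd \<i> b g (T y) * dd \<sigma> a (\<lambda>y. cnj (fst (T y) b)) y"
      unfolding 1 2 dd_def[of "-\<i>" b] dd_def[of "\<i>" b] by (simp add: field_simps)
  qed
  finally show ?thesis .
qed

text \<open>For \<open>k = 0\<close> this is the standard smooth function that is flat at 0.
  Derivatives of members are combinations of members with higher powers, and this carries the
  induction in \<open>smooth_on_flat\<close>.\<close>

definition flat :: "nat \<Rightarrow> real \<Rightarrow> real" where
  "flat k t = (if t > 0 then exp (- (1 / t)) / t ^ k else 0)"

text \<open>From the right, \<open>x = 1/t\<close> turns the claim into the decay of
  \<open>x ^ k / exp x\<close> at infinity.\<close>

lemma flat_tendsto: "(flat k \<longlongrightarrow> 0) (at 0)"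
proof -
  have "((\<lambda>x::real. x ^ k / exp x) \<longlongrightarrow> 0) at_top" by (rule tendsto_power_div_exp_0)
  then have "((\<lambda>t. inverse t ^ k / exp (inverse t)) \<longlongrightarrow> (0::real)) (at_right 0)"
    by (rule filterlim_compose[OF _ filterlim_inverse_at_top_right])
  moreover have "eventually (\<lambda>t::real. inverse t ^ k / exp (inverse t) = flat k t) (at_right 0)"
    unfolding eventually_at_right_field
    by (intro exI[of _ 1]) (auto simp: flat_def exp_minus field_simps)
  ultimately have "(flat k \<longlongrightarrow> 0) (at_right 0)" by (rule Lim_transform_eventually)
  moreover have "(flat k \<longlongrightarrow> 0) (at_left 0)"
    by (rule tendsto_eventually) (auto simp: eventually_at_left_field flat_def intro: exI[of _ "-1"])
  ultimately show ?thesis by (simp add: filterlim_at_split)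
qed

lemma flat_deriv: "(flat k has_real_derivative (flat (k + 2) t - real k * flat (k + 1) t)) (at t)"
proof (cases t "0::real" rule: linorder_cases)
  case less
  have "((\<lambda>_. 0) has_real_derivative 0) (at t)" by simp
  then have "(flat k has_real_derivative 0) (at t)"
    by (rule has_field_derivative_transform_within_open[where S = "{..<0}"]) (use less in \<open>auto simp: flat_def\<close>)
  then show ?thesis using less by (simp add: flat_def)
next
  case equal
  \<comment> \<open>The difference quotient at 0 is the next member \<open>flat (k + 1)\<close> of
    the family.\<close>
  have "((\<lambda>s. flat k s / s) \<longlongrightarrow> 0) (at 0)"
    by (rule Lim_transform_eventually[OF flat_tendsto[of "k+1"]])
       (auto simp: eventually_at_filter flat_def intro!: always_eventually)
  then show ?thesis using equal by (simp add: has_field_derivative_iff flat_def)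
next
  case greater
  have "((\<lambda>t. exp (- (1 / t)) / t ^ k) has_real_derivative (flat (k + 2) t - real k * flat (k + 1) t)) (at t)"
  proof -
    have p: "((\<lambda>t. t ^ k) has_real_derivative real k * t ^ k / t) (at t)"
      using DERIV_pow[of k t] greater by (cases k) auto
    have e: "((\<lambda>t. exp (- (1 / t))) has_real_derivative exp (- (1 / t)) / (t * t)) (at t)"
      using greater by (auto intro!: derivative_eq_intros simp: power2_eq_square)
    have "exp (- (1 / t)) / (t * t) * t ^ k - exp (- (1 / t)) * (real k * t ^ k / t) =
      (flat (k + 2) t - real k * flat (k + 1) t) * (t ^ k * t ^ k)"
      using greater by (simp add: flat_def field_simps power2_eq_square)
    then show ?thesis using DERIV_divide[OF e p] greater by simp
  qed
  then show ?thesis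
    by (rule has_field_derivative_transform_within_open[where S = "{0<..}"]) (use greater in \<open>auto simp: flat_def\<close>)
qed

lemma smooth_on_flat:
  assumes S: "model_open m n S" and u: "smooth_on m n S (\<lambda>y. of_real (u y))"
  shows "smooth_on m n S (\<lambda>y. of_real (flat k (u y)))"
  unfolding smooth_on_def
proof
  fix r
  have cu: "continuous_on S u"
    using continuous_on_Re[OF smooth_on_continuous[OF u]] by simp
  have cf: "continuous_on UNIV (flat k)" for k
    unfolding continuous_on_eq_continuous_at[OF open_UNIV] using DERIV_isCont[OF flat_deriv] by blast
  have c: "continuous_on S (\<lambda>y. of_real (flat k (u y)) :: complex)" for k
    by (intro continuous_on_of_real continuous_on_compose2[OF cf cu]) auto
  show "C_k m n r S (\<lambda>y. of_real (flat k (u y)))"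
  proof (induction r arbitrary: k)
    case 0 then show ?case using c by simp
  next
    case (Suc r)
    have pu: "has_pderiv l (\<lambda>y. of_real (u y)) y (pderiv_at l (\<lambda>y. of_real (u y)) y)" if "l \<in> coords m n" "y \<in> S" for l y
      using smooth_on_has_pderiv[OF u that] .
    show ?case
    proof (rule C_k_SucI'[OF S c])
      fix l assume l: "l \<in> coords m n"
      show "C_k m n r S (\<lambda>y. (of_real (flat (k + 2) (u y)) + (- of_nat k) * of_real (flat (k + 1) (u y))) *
          pderiv_at l (\<lambda>y. of_real (u y)) y)"
        by (intro C_k_mult C_k_add C_k_const S Suc.IH C_k_SucD(2)[OF smooth_onD[OF u] l])
      fix y assume y: "y \<in> S"
      have d: "((\<lambda>s. of_real (u (shift l s y)) :: complex) has_vector_derivative pderiv_at l (\<lambda>y. of_real (u y)) y) (at 0)"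
        using pu[OF l y] by (simp add: has_pderiv_def)
      define D where "D = Re (pderiv_at l (\<lambda>y. of_real (u y)) y)"
      have dre: "((\<lambda>s. u (shift l s y)) has_real_derivative D) (at 0)"
        using bounded_linear.has_vector_derivative[OF bounded_linear_Re d]
        by (simp add: D_def has_real_derivative_iff_has_vector_derivative)
      have "((\<lambda>s. of_real (u (shift l s y)) :: complex) has_vector_derivative of_real D) (at 0)"
        using bounded_linear.has_vector_derivative[OF bounded_linear_of_real dre[unfolded has_real_derivative_iff_has_vector_derivative]] .
      from vector_derivative_unique_at[OF d this]
      have D: "pderiv_at l (\<lambda>y. of_real (u y)) y = of_real D" .
      have "((\<lambda>s. flat k (u (shift l s y))) has_real_derivative (flat (k + 2) (u y) - real k * flat (k + 1) (u y)) * D) (at 0)"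
        using DERIV_chain2[OF flat_deriv[of k "u (shift l 0 y)"] dre] by simp
      from bounded_linear.has_vector_derivative[OF bounded_linear_of_real this[unfolded has_real_derivative_iff_has_vector_derivative]]
      show "has_pderiv l (\<lambda>y. of_real (flat k (u y))) y ((of_real (flat (k + 2) (u y)) + (- of_nat k) * of_real (flat (k + 1) (u y))) *
          pderiv_at l (\<lambda>y. of_real (u y)) y)"
        by (simp add: has_pderiv_def D)
    qed (rule S)
  qed
qed

section \<open>Alternating forms\<close>

text \<open>Laplace expansion with an arbitrary summand: \<open>wedge1\<close> and the exterior
  derivative in a frame are both instances, so the sign cancellations behind
  \<open>\<alpha> \<and> \<alpha> = 0\<close> and \<open>\<partial>bar\<^sup>2 = 0\<close> are
  proved once.\<close>

definition alt_sum :: "('v \<Rightarrow> 'v list \<Rightarrow> complex) \<Rightarrow> 'v list \<Rightarrow> complex" where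
  "alt_sum G Xs = (\<Sum>i<length Xs. (-1) ^ i * G (Xs ! i) (take i Xs @ drop (Suc i) Xs))"

lemma alt_sum_Nil [simp]: "alt_sum G [] = 0"
  by (simp add: alt_sum_def)

lemma alt_sum_Cons: "alt_sum G (x # xs) = G x xs - alt_sum (\<lambda>v r. G v (x # r)) xs"
  by (simp add: alt_sum_def sum.lessThan_Suc_shift sum_negf del: sum.lessThan_Suc)

lemma alt_sum_cong:
  assumes "\<And>v r. v \<in> set Xs \<Longrightarrow> set r \<subseteq> set Xs \<Longrightarrow> length Xs = Suc (length r) \<Longrightarrow> G v r = G' v r"
  shows "alt_sum G Xs = alt_sum G' Xs"
  unfolding alt_sum_def
proof (rule sum.cong[OF refl])
  fix i assume "i \<in> {..<length Xs}"
  then show "(-1) ^ i * G (Xs ! i) (take i Xs @ drop (Suc i) Xs) = (-1) ^ i * G' (Xs ! i) (take i Xs @ drop (Suc i) Xs)"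
    by (subst assms) (auto dest: in_set_takeD in_set_dropD)
qed

lemma alt_sum_add: "alt_sum (\<lambda>v r. G v r + G' v r) Xs = alt_sum G Xs + alt_sum G' Xs"
  by (simp add: alt_sum_def distrib_left sum.distrib)

lemma alt_sum_cmult: "alt_sum (\<lambda>v r. c * G v r) Xs = c * alt_sum G Xs"
  by (simp add: alt_sum_def sum_distrib_left mult.left_commute)

lemma alt_sum_diff: "alt_sum (\<lambda>v r. G v r - G' v r) Xs = alt_sum G Xs - alt_sum G' Xs"
  by (simp add: alt_sum_def right_diff_distrib sum_subtractf)

lemma alt_sum_sum: "alt_sum (\<lambda>v r. \<Sum>i\<in>I. G i v r) Xs = (\<Sum>i\<in>I. alt_sum (G i) Xs)"
  by (simp add: alt_sum_def sum_distrib_left) (rule sum.swap)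

lemma alt_sum_zero [simp]: "alt_sum (\<lambda>v r. 0) Xs = 0"
  by (simp add: alt_sum_def)

text \<open>Two entries removed in the opposite order come with the opposite sign. In the induction,
  the pairs containing the head \<open>x\<close> form two sums of opposite sign that the swap
  exchanges; the other pairs are covered by the hypothesis.\<close>

lemma alt_sum_alt_sum_swap:
  "alt_sum (\<lambda>v. alt_sum (F v)) Xs = - alt_sum (\<lambda>v. alt_sum (\<lambda>w. F w v)) Xs"
proof (induction Xs arbitrary: F)
  case (Cons x xs)
  have e: "alt_sum (\<lambda>v. alt_sum (F v)) (x # xs) = alt_sum (F x) xs - alt_sum (\<lambda>v. F v x) xs
     + alt_sum (\<lambda>v. alt_sum (\<lambda>w s. F v w (x # s))) xs" for F
    by (simp add: alt_sum_Cons alt_sum_diff)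
  show ?case unfolding e using Cons.IH[of "\<lambda>v w s. F v w (x # s)"] by simp
qed simp

lemma alt_sum_alt_sum_symmetric:
  assumes "\<And>v w s. F v w s = F w v s"
  shows "alt_sum (\<lambda>v. alt_sum (F v)) Xs = 0"
proof -
  have "(\<lambda>v. alt_sum (\<lambda>w. F w v)) = (\<lambda>v. alt_sum (F v))"
    by (intro ext arg_cong[where f = "\<lambda>G. alt_sum G _"]) (rule assms)
  then show ?thesis using alt_sum_alt_sum_swap[of F Xs] by simp
qed

lemma alt_sum_alt_sum_add:
  "alt_sum (\<lambda>v. alt_sum (\<lambda>w s. F v w s + G v w s)) Xs =
     alt_sum (\<lambda>v. alt_sum (F v)) Xs + alt_sum (\<lambda>v. alt_sum (G v)) Xs"
proof -
  have "alt_sum (\<lambda>v. alt_sum (\<lambda>w s. F v w s + G v w s)) Xs = alt_sum (\<lambda>v r. alt_sum (F v) r + alt_sum (G v) r) Xs"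
    by (rule alt_sum_cong) (rule alt_sum_add)
  then show ?thesis by (simp only: alt_sum_add)
qed

lemma alt_sum_alt_sum_cmult:
  "alt_sum (\<lambda>v. alt_sum (\<lambda>w s. c v * F v w s)) Xs = alt_sum (\<lambda>v r. c v * alt_sum (F v) r) Xs"
  by (rule alt_sum_cong) (rule alt_sum_cmult)

lemma alt_sum_map: "alt_sum G (map h vs) = alt_sum (\<lambda>v r. G (h v) (map h r)) vs"
  by (simp add: alt_sum_def take_map drop_map)

lemma wedge1_eq: "wedge1 \<alpha> \<omega> = alt_sum (\<lambda>X Ys. \<alpha> X * \<omega> Ys)"
  by (rule ext) (simp add: wedge1_def alt_sum_def mult.assoc)

lemma wedge1_cmult: "wedge1 \<alpha> (\<lambda>Xs. c * \<omega> Xs) Xs = c * wedge1 \<alpha> \<omega> Xs"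
  by (simp add: wedge1_eq mult.left_commute[of _ c] alt_sum_cmult)

lemma wedge1_cmult_left: "wedge1 (\<lambda>X. c * \<alpha> X) \<omega> Xs = c * wedge1 \<alpha> \<omega> Xs"
  by (simp add: wedge1_eq mult.assoc alt_sum_cmult)

lemma wedge1_sum: "wedge1 \<alpha> (\<lambda>Xs. \<Sum>i\<in>I. \<omega> i Xs) Xs = (\<Sum>i\<in>I. wedge1 \<alpha> (\<omega> i) Xs)"
  by (simp add: wedge1_eq sum_distrib_left alt_sum_sum)

lemma wedge1_sum_left: "wedge1 (\<lambda>X. \<Sum>i\<in>I. \<alpha> i X) \<omega> Xs = (\<Sum>i\<in>I. wedge1 (\<alpha> i) \<omega> Xs)"
  by (simp add: wedge1_eq sum_distrib_right alt_sum_sum)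

lemma wedge1_swap: "wedge1 \<alpha> (wedge1 \<beta> \<omega>) Xs = - wedge1 \<beta> (wedge1 \<alpha> \<omega>) Xs"
  using alt_sum_alt_sum_swap[of "\<lambda>v w s. \<alpha> v * (\<beta> w * \<omega> s)" Xs]
  by (simp add: wedge1_eq alt_sum_cmult[symmetric] mult.left_commute)

lemma wedge1_same: "wedge1 \<alpha> (wedge1 \<alpha> \<omega>) Xs = 0"
  using wedge1_swap[of \<alpha> \<alpha> \<omega> Xs] by simp

section \<open>Exterior products of lists of covectors\<close>

lemma wedge_list_Nil: "wedge_list [] Xs = (if Xs = [] then 1 else 0)"
  by (simp add: wedge_list_def)

lemma wedge_list_Cons: "wedge_list (\<alpha> # \<alpha>s) = wedge1 \<alpha> (wedge_list \<alpha>s)"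
  by (simp add: wedge_list_def)

lemma wedge_list_map: "wedge_list \<alpha>s (map h vs) = wedge_list (map (\<lambda>\<alpha> v. \<alpha> (h v)) \<alpha>s) vs"
proof (induction \<alpha>s arbitrary: vs)
  case (Cons \<alpha> \<alpha>s)
  then show ?case by (simp add: wedge_list_Cons wedge1_eq alt_sum_map)
qed (simp add: wedge_list_Nil)

lemma wedge_list_eq_0:
  assumes "X \<in> set Xs" "\<And>\<alpha>. \<alpha> \<in> set \<alpha>s \<Longrightarrow> \<alpha> X = 0"
  shows "wedge_list \<alpha>s Xs = 0"
  using assms
proof (induction \<alpha>s arbitrary: Xs)
  case (Cons \<alpha> \<alpha>s)
  show ?case unfolding wedge_list_Cons wedge1_def
  proof (rule sum.neutral, rule ballI)
    fix i assume "i \<in> {..<length Xs}"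
    then have i: "i < length Xs" by simp
    show "(-1) ^ i * \<alpha> (Xs ! i) * wedge_list \<alpha>s (take i Xs @ drop (Suc i) Xs) = 0"
    proof (cases "Xs ! i = X")
      case True then show ?thesis using Cons.prems(2) by simp
    next
      case False
      have "X \<in> set (take i Xs @ Xs ! i # drop (Suc i) Xs)"
        using Cons.prems(1) id_take_nth_drop[OF i] by metis
      then have "X \<in> set (take i Xs @ drop (Suc i) Xs)" using False by auto
      then show ?thesis using Cons by simp
    qed
  qed
qed (auto simp: wedge_list_Nil)

text \<open>Expand along the first covector \<open>i\<close>, with \<open>j\<close> the index of the
  first vector. If \<open>i \<le> j\<close>, then \<open>i\<close> pairs to 0 with all later, larger
  indices. If \<open>i > j\<close>, the covectors after \<open>i\<close> all pair to 0 with
  \<open>fr j\<close>. So the terms that remove a later vector vanish in both cases.\<close>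

lemma wedge_list_dual:
  fixes I J :: "nat list"
  assumes "sorted_wrt (<) I" "sorted_wrt (<) J"
    and "\<And>i j. i \<in> set I \<Longrightarrow> j \<in> set J \<Longrightarrow> cov i (fr j) = (if i = j then 1 else 0)"
  shows "wedge_list (map cov I) (map fr J) = (if I = J then 1 else 0)"
  using assms
proof (induction I arbitrary: J)
  case Nil then show ?case by (simp add: wedge_list_Nil)
next
  case (Cons i I)
  show ?case
  proof (cases J)
    case Nil then show ?thesis by (simp add: wedge_list_Cons wedge1_def)
  next
    case (Cons j J')
    have ij: "cov i (fr j) = (if i = j then 1 else 0)" using Cons.prems(3) \<open>J = j # J'\<close> by simp
    have IH: "wedge_list (map cov I) (map fr J') = (if I = J' then 1 else 0)"
      by (rule Cons.IH) (use Cons.prems \<open>J = j # J'\<close> in auto)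
    have e: "wedge_list (map cov (i # I)) (map fr J) = cov i (fr j) * wedge_list (map cov I) (map fr J')
       - alt_sum (\<lambda>v r. cov i (fr v) * wedge_list (map cov I) (fr j # map fr r)) J'"
      by (simp add: \<open>J = j # J'\<close> wedge_list_Cons wedge1_eq alt_sum_Cons alt_sum_map)
    have z: "alt_sum (\<lambda>v r. cov i (fr v) * wedge_list (map cov I) (fr j # map fr r)) J' = 0"
    proof (cases "i \<le> j")
      case True
      have "alt_sum (\<lambda>v r. cov i (fr v) * wedge_list (map cov I) (fr j # map fr r)) J' = alt_sum (\<lambda>v r. 0) J'"
      proof (rule alt_sum_cong)
        fix v r assume v: "v \<in> set J'"
        then have "i \<noteq> v" using True Cons.prems(2) \<open>J = j # J'\<close> by auto
        then show "cov i (fr v) * wedge_list (map cov I) (fr j # map fr r) = 0"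
          using Cons.prems(3)[of i v] v \<open>J = j # J'\<close> by simp
      qed
      then show ?thesis by simp
    next
      case False
      have "wedge_list (map cov I) (fr j # map fr r) = 0" for r
      proof (rule wedge_list_eq_0[of "fr j"])
        fix \<alpha> assume "\<alpha> \<in> set (map cov I)"
        then obtain k where k: "k \<in> set I" "\<alpha> = cov k" by auto
        then have "k \<noteq> j" using False Cons.prems(1) by auto
        then show "\<alpha> (fr j) = 0" using Cons.prems(3)[of k j] k \<open>J = j # J'\<close> by simp
      qed simp
      then show ?thesis by simp
    qed
    show ?thesis unfolding e z ij IH using \<open>J = j # J'\<close> by simp
  qed
qed

lemma wedge1_wedge_list_insert:
  "wedge1 \<alpha> (wedge_list (\<beta>s @ \<gamma>s)) Xs = (-1) ^ length \<beta>s * wedge_list (\<beta>s @ \<alpha> # \<gamma>s) Xs"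
proof (induction \<beta>s arbitrary: Xs)
  case (Cons \<beta> \<beta>s)
  have "wedge1 \<alpha> (wedge_list ((\<beta> # \<beta>s) @ \<gamma>s)) Xs = - wedge1 \<beta> (wedge1 \<alpha> (wedge_list (\<beta>s @ \<gamma>s))) Xs"
    by (simp add: wedge_list_Cons) (rule wedge1_swap)
  also have "wedge1 \<alpha> (wedge_list (\<beta>s @ \<gamma>s)) = (\<lambda>Xs. (-1) ^ length \<beta>s * wedge_list (\<beta>s @ \<alpha> # \<gamma>s) Xs)"
    by (rule ext) (rule Cons.IH)
  finally show ?case by (simp add: wedge1_cmult wedge_list_Cons)
qed (simp add: wedge_list_Cons)

lemma wedge_list_repeat: "wedge_list (\<beta>s @ \<alpha> # \<alpha> # \<gamma>s) Xs = 0"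
proof (induction \<beta>s arbitrary: Xs)
  case Nil then show ?case by (simp add: wedge_list_Cons wedge1_same)
next
  case (Cons \<beta> \<beta>s)
  then have "wedge_list (\<beta>s @ \<alpha> # \<alpha> # \<gamma>s) = (\<lambda>Xs. 0)" by blast
  then show ?case by (simp add: wedge_list_Cons wedge1_eq)
qed

lemma insort_append:
  fixes a :: nat
  shows "\<exists>P Q. xs = P @ Q \<and> insort a xs = P @ a # Q"
proof (induction xs)
  case (Cons x xs)
  then obtain P Q where PQ: "xs = P @ Q" "insort a xs = P @ a # Q" by blast
  show ?case
  proof (cases "a \<le> x")
    case True
    then have "x # xs = [] @ (x # xs) \<and> insort a (x # xs) = [] @ a # (x # xs)" by simp
    then show ?thesis by blast
  next
    case False
    then have "x # xs = (x # P) @ Q \<and> insort a (x # xs) = (x # P) @ a # Q" using PQ by simp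
    then show ?thesis by blast
  qed
qed simp

text \<open>The covector moves to its sorted place at the cost of a sign, left unspecified because
  it can be absorbed into a coefficient.\<close>

lemma wedge1_sorted_insert:
  fixes a :: nat
  assumes "finite B" "a \<notin> B"
  shows "\<exists>s. \<forall>Xs. wedge1 (cov a) (wedge_list (\<alpha>s @ map cov (sorted_list_of_set B))) Xs =
     s * wedge_list (\<alpha>s @ map cov (sorted_list_of_set (insert a B))) Xs"
proof -
  obtain P Q where PQ: "sorted_list_of_set B = P @ Q" "insort a (sorted_list_of_set B) = P @ a # Q"
    using insort_append[of "sorted_list_of_set B" a] by (elim exE conjE) (rule that)
  have "sorted_list_of_set (insert a B) = P @ a # Q"
    using assms PQ by (simp add: sorted_list_of_set_insert)
  then show ?thesis using wedge1_wedge_list_insert[of "cov a" "\<alpha>s @ map cov P" "map cov Q"] PQ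
    by (intro exI[of _ "(-1) ^ length (\<alpha>s @ map cov P)"]) simp
qed

lemma wedge1_sorted_repeat:
  fixes a :: nat
  assumes "finite B" "a \<in> B"
  shows "wedge1 (cov a) (wedge_list (\<alpha>s @ map cov (sorted_list_of_set B))) Xs = 0"
proof -
  obtain P Q where PQ: "sorted_list_of_set B = P @ a # Q"
    using split_list[of a "sorted_list_of_set B"] assms by auto
  then show ?thesis
    using wedge1_wedge_list_insert[of "cov a" "\<alpha>s @ map cov P" "map cov (a # Q)" Xs]
      wedge_list_repeat[of "\<alpha>s @ map cov P" "cov a" "map cov Q" Xs] by simp
qed

text \<open>Components of a complexified leaf vector in the frame of a chart: the first function
  belongs to the directions \<open>\<partial>/\<partial>z\<^sup>a\<close>, the second to their
  conjugates. The two are independent of each other.\<close>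

type_synonym lvec = "(nat \<Rightarrow> complex) \<times> (nat \<Rightarrow> complex)"

text \<open>The (0,1)-part of the field with constant components \<open>v\<close>, acting as a
  derivation.\<close>

definition dbv :: "nat \<Rightarrow> lvec \<Rightarrow> (model \<Rightarrow> complex) \<Rightarrow> model \<Rightarrow> complex" where
  "dbv m v g y = (\<Sum>a<m. snd v a * dd \<i> a g y)"

text \<open>The invariant formula for the exterior derivative on fields with constant components:
  their brackets vanish, so only the derivative terms are left, here in the (0,1)
  directions.\<close>

definition chart_d :: "nat \<Rightarrow> (model \<Rightarrow> lvec list \<Rightarrow> complex) \<Rightarrow> model \<Rightarrow> lvec list \<Rightarrow> complex" where
  "chart_d m \<omega> y = alt_sum (\<lambda>v r. dbv m v (\<lambda>y. \<omega> y r) y)"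

lemma smooth_on_alt_sum:
  assumes "model_open m n S" "\<And>v r. smooth_on m n S (\<lambda>y. G y v r)"
  shows "smooth_on m n S (\<lambda>y. alt_sum (G y) Xs)"
  unfolding alt_sum_def by (intro smooth_on_sum smooth_on_mult smooth_on_const assms)

lemma smooth_on_dbv:
  assumes "model_open m n S" "smooth_on m n S g"
  shows "smooth_on m n S (dbv m v g)"
  unfolding dbv_def
  by (rule smooth_on_sum[OF assms(1)], rule smooth_on_mult[OF assms(1) smooth_on_const], rule smooth_on_dd[OF assms]) simp

lemma dbv_cong:
  assumes "model_open m n S" "y \<in> S" "\<And>y. y \<in> S \<Longrightarrow> g y = g' y"
  shows "dbv m v g y = dbv m v g' y"
  unfolding dbv_def
  by (rule sum.cong[OF refl], rule arg_cong[where f = "(*) _"], rule dd_cong[OF assms(1,2) _ assms(3)]) auto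

lemma dbv_mult:
  assumes "smooth_on m n S g" "smooth_on m n S h" "y \<in> S"
  shows "dbv m v (\<lambda>y. g y * h y) y = g y * dbv m v h y + dbv m v g y * h y"
proof -
  have "dbv m v (\<lambda>y. g y * h y) y = (\<Sum>a<m. snd v a * (g y * dd \<i> a h y + dd \<i> a g y * h y))"
    unfolding dbv_def by (rule sum.cong) (simp_all add: dd_mult[OF assms])
  then show ?thesis unfolding dbv_def
    by (simp add: algebra_simps sum.distrib sum_distrib_left sum_distrib_right)
qed

lemma dbv_const [simp]: "dbv m v (\<lambda>y. c) y = 0"
  by (simp add: dbv_def)

lemma dbv_add:
  assumes "smooth_on m n S g" "smooth_on m n S h" "y \<in> S"
  shows "dbv m v (\<lambda>y. g y + h y) y = dbv m v g y + dbv m v h y"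
  unfolding dbv_def by (simp add: dd_add[OF assms] distrib_left sum.distrib)

lemma dbv_cmult:
  assumes "smooth_on m n S h" "y \<in> S"
  shows "dbv m v (\<lambda>y. c * h y) y = c * dbv m v h y"
  using dbv_mult[OF smooth_on_const assms, of v c] by simp

lemma dbv_sum:
  assumes S: "model_open m n S" and g: "\<And>i. i \<in> I \<Longrightarrow> smooth_on m n S (g i)" and y: "y \<in> S"
  shows "dbv m v (\<lambda>y. \<Sum>i\<in>I. g i y) y = (\<Sum>i\<in>I. dbv m v (g i) y)"
  using g
proof (induction I rule: infinite_finite_induct)
  case (insert i I)
  have "dbv m v (\<lambda>y. g i y + (\<Sum>i\<in>I. g i y)) y = dbv m v (g i) y + dbv m v (\<lambda>y. \<Sum>i\<in>I. g i y) y"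
    by (rule dbv_add[OF _ smooth_on_sum[OF S] y]) (use insert.prems in auto)
  with insert show ?case by simp
qed auto

lemma dbv_alt_sum:
  assumes S: "model_open m n S" and G: "\<And>v r. smooth_on m n S (\<lambda>y. G y v r)" and y: "y \<in> S"
  shows "dbv m u (\<lambda>y. alt_sum (G y) Xs) y = alt_sum (\<lambda>v r. dbv m u (\<lambda>y. G y v r) y) Xs"
proof -
  have "dbv m u (\<lambda>y. alt_sum (G y) Xs) y =
     (\<Sum>i<length Xs. dbv m u (\<lambda>y. (-1) ^ i * G y (Xs ! i) (take i Xs @ drop (Suc i) Xs)) y)"
    unfolding alt_sum_def by (rule dbv_sum[OF S _ y]) (intro smooth_on_mult S smooth_on_const G)
  then show ?thesis unfolding alt_sum_def by (simp add: dbv_cmult[OF G y])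
qed

lemma dbv_commute:
  assumes S: "model_open m n S" and g: "smooth_on m n S g" and y: "y \<in> S"
  shows "dbv m u (dbv m v g) y = dbv m v (dbv m u g) y"
proof -
  have s: "smooth_on m n S (dd \<i> b g)" if "b < m" for b using smooth_on_dd[OF S g that] .
  have e: "dbv m u (dbv m v g) y = (\<Sum>b<m. \<Sum>a<m. snd u a * snd v b * dd \<i> a (dd \<i> b g) y)" for u v
  proof -
    have "dbv m u (\<lambda>y. \<Sum>b<m. snd v b * dd \<i> b g y) y = (\<Sum>b<m. dbv m u (\<lambda>y. snd v b * dd \<i> b g y) y)"
      by (rule dbv_sum[OF S _ y]) (rule smooth_on_mult[OF S smooth_on_const s], simp)
    also have "\<dots> = (\<Sum>b<m. snd v b * dbv m u (dd \<i> b g) y)"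
      by (rule sum.cong[OF refl]) (rule dbv_cmult[OF s y], simp)
    finally have "dbv m u (\<lambda>y. \<Sum>b<m. snd v b * dd \<i> b g y) y = (\<Sum>b<m. snd v b * dbv m u (dd \<i> b g) y)" .
    moreover have "dbv m v g = (\<lambda>y. \<Sum>b<m. snd v b * dd \<i> b g y)" by (rule ext) (simp add: dbv_def)
    ultimately show ?thesis by (simp add: dbv_def sum_distrib_left mult_ac)
  qed
  show ?thesis unfolding e[of u v] e[of v u]
    by (subst sum.swap) (auto intro!: sum.cong simp: dd_commute[OF S g y] mult_ac)
qed

lemma chart_d_cong:
  assumes "model_open m n S" "y \<in> S" "\<And>y r. y \<in> S \<Longrightarrow> \<omega> y r = \<omega>' y r"
  shows "chart_d m \<omega> y Xs = chart_d m \<omega>' y Xs"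
  unfolding chart_d_def
  by (rule alt_sum_cong, rule dbv_cong[OF assms(1,2)]) (rule assms(3))

lemma chart_d_mult:
  assumes S: "model_open m n S" and y: "y \<in> S" and g: "smooth_on m n S g" and \<omega>: "\<And>r. smooth_on m n S (\<lambda>y. \<omega> y r)"
  shows "chart_d m (\<lambda>y r. g y * \<omega> y r) y Xs = wedge1 (\<lambda>v. dbv m v g y) (\<omega> y) Xs + g y * chart_d m \<omega> y Xs"
  unfolding chart_d_def wedge1_eq dbv_mult[OF g \<omega> y]
  by (simp add: alt_sum_add alt_sum_cmult)

lemma chart_d_sum:
  assumes S: "model_open m n S" and y: "y \<in> S" and \<omega>: "\<And>i r. i \<in> I \<Longrightarrow> smooth_on m n S (\<lambda>y. \<omega> i y r)"
  shows "chart_d m (\<lambda>y r. \<Sum>i\<in>I. \<omega> i y r) y Xs = (\<Sum>i\<in>I. chart_d m (\<omega> i) y Xs)"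
proof -
  have "dbv m v (\<lambda>y. \<Sum>i\<in>I. \<omega> i y r) y = (\<Sum>i\<in>I. dbv m v (\<lambda>y. \<omega> i y r) y)" for v r
    by (rule dbv_sum[OF S _ y]) (rule \<omega>)
  then show ?thesis by (simp add: chart_d_def alt_sum_sum)
qed

text \<open>The hypothesis \<open>closed\<close> expresses that \<open>\<partial>bar\<close>
  annihilates \<open>\<alpha>\<close>: the derivatives of \<open>\<alpha>\<close> are symmetric in
  the two removed vectors and cancel. The remaining terms change sign when the order of removal is
  exchanged.\<close>

lemma chart_d_wedge1:
  assumes S: "model_open m n S" and y: "y \<in> S"
    and \<alpha>: "\<And>v. smooth_on m n S (\<lambda>y. \<alpha> y v)" and \<omega>: "\<And>r. smooth_on m n S (\<lambda>y. \<omega> y r)"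
    and closed: "\<And>u v. dbv m u (\<lambda>y. \<alpha> y v) y = dbv m v (\<lambda>y. \<alpha> y u) y"
  shows "chart_d m (\<lambda>y. wedge1 (\<alpha> y) (\<omega> y)) y Xs = - wedge1 (\<alpha> y) (chart_d m \<omega> y) Xs"
proof -
  have sm: "smooth_on m n S (\<lambda>y. \<alpha> y w * \<omega> y s)" for w s by (rule smooth_on_mult[OF S \<alpha> \<omega>])
  have "chart_d m (\<lambda>y. wedge1 (\<alpha> y) (\<omega> y)) y Xs =
     alt_sum (\<lambda>v. alt_sum (\<lambda>w s. \<alpha> y w * dbv m v (\<lambda>y. \<omega> y s) y + dbv m v (\<lambda>y. \<alpha> y w) y * \<omega> y s)) Xs"
    unfolding chart_d_def wedge1_eq dbv_alt_sum[OF S sm y] dbv_mult[OF \<alpha> \<omega> y] ..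
  also have "\<dots> = alt_sum (\<lambda>v. alt_sum (\<lambda>w s. \<alpha> y w * dbv m v (\<lambda>y. \<omega> y s) y)) Xs +
      alt_sum (\<lambda>v. alt_sum (\<lambda>w s. dbv m v (\<lambda>y. \<alpha> y w) y * \<omega> y s)) Xs"
    by (rule alt_sum_alt_sum_add)
  also have "alt_sum (\<lambda>v. alt_sum (\<lambda>w s. dbv m v (\<lambda>y. \<alpha> y w) y * \<omega> y s)) Xs = 0"
    by (rule alt_sum_alt_sum_symmetric) (rule arg_cong[where f = "\<lambda>x. x * _"], rule closed)
  also have "alt_sum (\<lambda>v. alt_sum (\<lambda>w s. \<alpha> y w * dbv m v (\<lambda>y. \<omega> y s) y)) Xs =
      - alt_sum (\<lambda>v. alt_sum (\<lambda>w s. \<alpha> y v * dbv m w (\<lambda>y. \<omega> y s) y)) Xs"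
    by (rule alt_sum_alt_sum_swap)
  finally show ?thesis by (simp add: chart_d_def wedge1_eq alt_sum_alt_sum_cmult)
qed

lemma smooth_on_wedge1:
  assumes S: "model_open m n S"
    and \<alpha>: "\<And>v. smooth_on m n S (\<lambda>y. \<alpha> y v)" and \<omega>: "\<And>r. smooth_on m n S (\<lambda>y. \<omega> y r)"
  shows "smooth_on m n S (\<lambda>y. wedge1 (\<alpha> y) (\<omega> y) Xs)"
  unfolding wedge1_eq by (intro smooth_on_alt_sum smooth_on_mult S \<alpha> \<omega>)

lemma smooth_on_wedge_list:
  assumes S: "model_open m n S" and "\<And>\<alpha> v. \<alpha> \<in> set \<alpha>s \<Longrightarrow> smooth_on m n S (\<lambda>y. \<alpha> y v)"
  shows "smooth_on m n S (\<lambda>y. wedge_list (map (\<lambda>\<alpha>. \<alpha> y) \<alpha>s) Xs)"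
  using assms(2)
proof (induction \<alpha>s arbitrary: Xs)
  case Nil then show ?case by (simp add: wedge_list_Nil smooth_on_const)
next
  case (Cons \<alpha> \<alpha>s)
  show ?case unfolding list.map wedge_list_Cons
    by (rule smooth_on_wedge1[OF S]) (use Cons in auto)
qed

lemma chart_d_wedge_list:
  assumes S: "model_open m n S" and y: "y \<in> S"
    and \<alpha>: "\<And>\<alpha> v. \<alpha> \<in> set \<alpha>s \<Longrightarrow> smooth_on m n S (\<lambda>y. \<alpha> y v)"
    and closed: "\<And>\<alpha> u v. \<alpha> \<in> set \<alpha>s \<Longrightarrow> dbv m u (\<lambda>y. \<alpha> y v) y = dbv m v (\<lambda>y. \<alpha> y u) y"
  shows "chart_d m (\<lambda>y. wedge_list (map (\<lambda>\<alpha>. \<alpha> y) \<alpha>s)) y Xs = 0"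
  using \<alpha> closed
proof (induction \<alpha>s arbitrary: Xs)
  case Nil then show ?case by (simp add: wedge_list_Nil chart_d_def)
next
  case (Cons \<alpha> \<alpha>s)
  have "chart_d m (\<lambda>y. wedge1 (\<alpha> y) (wedge_list (map (\<lambda>\<alpha>. \<alpha> y) \<alpha>s))) y Xs
    = - wedge1 (\<alpha> y) (chart_d m (\<lambda>y. wedge_list (map (\<lambda>\<alpha>. \<alpha> y) \<alpha>s)) y) Xs"
    by (rule chart_d_wedge1[OF S y]) (use Cons.prems in \<open>auto intro: smooth_on_wedge_list[OF S]\<close>)
  moreover have "chart_d m (\<lambda>y. wedge_list (map (\<lambda>\<alpha>. \<alpha> y) \<alpha>s)) y = (\<lambda>Xs. 0)"
    by (rule ext, rule Cons.IH) (use Cons.prems in auto)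
  ultimately show ?case by (simp add: wedge_list_Cons wedge1_eq)
qed

lemma smooth_on_chart_d:
  assumes S: "model_open m n S" and \<omega>: "\<And>r. smooth_on m n S (\<lambda>y. \<omega> y r)"
  shows "smooth_on m n S (\<lambda>y. chart_d m \<omega> y Xs)"
  unfolding chart_d_def by (rule smooth_on_alt_sum[OF S], rule smooth_on_dbv[OF S \<omega>])

text \<open>Commuting derivatives make the summand of a doubly alternating sum symmetric.\<close>

lemma chart_d_chart_d:
  assumes S: "model_open m n S" and y: "y \<in> S" and \<omega>: "\<And>r. smooth_on m n S (\<lambda>y. \<omega> y r)"
  shows "chart_d m (chart_d m \<omega>) y Xs = 0"
proof -
  have "chart_d m (chart_d m \<omega>) y Xs = alt_sum (\<lambda>v. alt_sum (\<lambda>w s. dbv m v (dbv m w (\<lambda>y. \<omega> y s)) y)) Xs"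
    unfolding chart_d_def dbv_alt_sum[OF S smooth_on_dbv[OF S \<omega>] y] ..
  also have "\<dots> = 0"
    by (rule alt_sum_alt_sum_symmetric) (rule dbv_commute[OF S \<omega> y])
  finally show ?thesis .
qed

section \<open>Forms in a chart\<close>

lemma co_cases_smooth:
  assumes S: "model_open m n S"
    and sz: "\<And>b. b < m \<Longrightarrow> smooth_on m n S (\<lambda>y. fst (T y) b)"
    and st: "\<And>b. b < n \<Longrightarrow> smooth_on m n S (\<lambda>y. of_real (snd (T y) b))"
    and l: "l \<in> coords m n"
  shows "smooth_on m n S (\<lambda>y. of_real (co l (T y)))"
proof (cases l)
  case (ReZ b)
  then have "smooth_on m n S (\<lambda>y. of_real (Re (fst (T y) b)))"
    using l by (intro smooth_on_linear[OF S bounded_linear_compose[OF bounded_linear_of_real bounded_linear_Re]] sz) simp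
  then show ?thesis using ReZ by simp
next
  case (ImZ b)
  then have "smooth_on m n S (\<lambda>y. of_real (Im (fst (T y) b)))"
    using l by (intro smooth_on_linear[OF S bounded_linear_compose[OF bounded_linear_of_real bounded_linear_Im]] sz) simp
  then show ?thesis using ImZ by simp
qed (use l st in simp)

text \<open>By the chain rule each derivative of \<open>g (T y)\<close> is a sum of products of a
  function of the same shape, with a derivative of \<open>g\<close> in place of \<open>g\<close>,
  and a smooth factor; hence the induction with arbitrary \<open>g\<close>. Since \<open>T\<close>
  is given through its components, its continuity is put together coordinatewise.\<close>

lemma smooth_on_compose:
  assumes S: "model_open m n S" and S': "model_open m n S'" and T: "T ` S \<subseteq> S'"
    and sz: "\<And>b. b < m \<Longrightarrow> smooth_on m n S (\<lambda>y. fst (T y) b)"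
    and st: "\<And>b. b < n \<Longrightarrow> smooth_on m n S (\<lambda>y. of_real (snd (T y) b))"
    and g: "smooth_on m n S' g"
  shows "smooth_on m n S (\<lambda>y. g (T y))"
proof -
  have ms: "T y \<in> model_space m n" if "y \<in> S" for y
    using T that model_open_imp_subset[OF S'] by blast
  have "continuous_on S (\<lambda>y. fst (T y) b)" for b
  proof (cases "b < m")
    case True then show ?thesis by (intro smooth_on_continuous[OF sz])
  next
    case False
    have "continuous_on S (\<lambda>y. 0::complex)" by simp
    then show ?thesis
      by (rule continuous_on_eq) (use ms False in \<open>simp add: model_space_def mem_Times_iff\<close>)
  qed
  moreover have "continuous_on S (\<lambda>y. snd (T y) b)" for b
  proof (cases "b < n")
    case True then show ?thesis using continuous_on_Re[OF smooth_on_continuous[OF st[OF True]]] by simp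
  next
    case False
    have "continuous_on S (\<lambda>y. 0::real)" by simp
    then show ?thesis
      by (rule continuous_on_eq) (use ms False in \<open>simp add: model_space_def mem_Times_iff\<close>)
  qed
  ultimately have "continuous_on S (\<lambda>y. (fst (T y), snd (T y)))"
    by (intro continuous_on_Pair continuous_on_coordinatewise_then_product)
  then have Tc: "continuous_on S T" by simp
  show ?thesis unfolding smooth_on_def
  proof
    fix r show "C_k m n r S (\<lambda>y. g (T y))"
      using g
    proof (induction r arbitrary: g)
      case 0
      then show ?case using continuous_on_compose2[OF smooth_on_continuous Tc T] by simp
    next
      case (Suc r)
      have sum: "C_k m n r S (\<lambda>y. \<Sum>l\<in>L. h l y)" if "\<And>l. l \<in> L \<Longrightarrow> C_k m n r S (h l)" for L :: "coord set" and h
        using that by (induction L rule: infinite_finite_induct) (auto intro: C_k_const C_k_add[OF S])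
      show ?case
      proof (rule C_k_SucI'[OF S])
        show "continuous_on S (\<lambda>y. g (T y))" by (rule C_k_continuous[OF Suc.IH[OF Suc.prems]])
        fix k assume k: "k \<in> coords m n"
        show "C_k m n r S (\<lambda>y. \<Sum>l\<in>coords m n. pderiv_at l g (T y) * pderiv_at k (\<lambda>y. of_real (co l (T y))) y)"
        proof (rule sum, rule C_k_mult[OF S])
          fix l assume l: "l \<in> coords m n"
          show "C_k m n r S (\<lambda>y. pderiv_at l g (T y))" by (rule Suc.IH[OF smooth_on_pderiv[OF Suc.prems l]])
          have "smooth_on m n S (\<lambda>y. of_real (co l (T y)))"
            by (rule co_cases_smooth[OF S _ _ l]) (rule sz st; assumption)+
          from smooth_on_pderiv[OF this k]
          show "C_k m n r S (pderiv_at k (\<lambda>y. of_real (co l (T y))))" by (rule smooth_onD)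
        qed
        show "has_pderiv k (\<lambda>y. g (T y)) y (\<Sum>l\<in>coords m n. pderiv_at l g (T y) * pderiv_at k (\<lambda>y. of_real (co l (T y))) y)"
          if y: "y \<in> S" for y
        proof -
          have sm: "smooth_on m n S (\<lambda>y. of_real (co l (T y)))" if "l \<in> coords m n" for l
            by (rule co_cases_smooth[OF S _ _ that]) (rule sz st; assumption)+
          show ?thesis by (rule has_pderiv_compose[OF S S' Suc.prems T _ y k]) (rule sm)
        qed
      qed (rule S)
    qed
  qed
qed

section \<open>Basis forms and local expressions\<close>

definition mi :: "nat \<Rightarrow> nat \<Rightarrow> nat set set" where
  "mi m p = {A. A \<subseteq> {..<m} \<and> card A = p}"

lemma mindex_eq: "mindex F p = mi (cdim F) p"
  by (simp add: mindex_def mi_def)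

lemma finite_mi [simp]: "finite (mi m p)"
  by (rule finite_subset[of _ "Pow {..<m}"]) (auto simp: mi_def)

lemma mi_finite: "A \<in> mi m p \<Longrightarrow> finite A"
  by (auto simp: mi_def dest: finite_subset)

text \<open>The form \<open>dz\<^sup>A \<and> dzbar\<^sup>B\<close> as a functional of component
  lists; in this shape it does not depend on the base point, so \<open>chart_d\<close> kills
  it.\<close>

definition basisV :: "nat set \<Rightarrow> nat set \<Rightarrow> lvec list \<Rightarrow> complex" where
  "basisV A B = wedge_list (map (\<lambda>a v. fst v a) (sorted_list_of_set A) @ map (\<lambda>b v. snd v b) (sorted_list_of_set B))"

definition frameV :: "nat set \<Rightarrow> nat set \<Rightarrow> lvec list" where
  "frameV A B = map (\<lambda>a. (\<lambda>b. if b = a then 1 else 0, \<lambda>b. 0)) (sorted_list_of_set A) @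
     map (\<lambda>a. (\<lambda>b. 0, \<lambda>b. if b = a then 1 else 0)) (sorted_list_of_set B)"

lemma basisV_frameV:
  assumes A: "A \<in> mi m p" and B: "B \<in> mi m q" and A': "A' \<in> mi m p" and B': "B' \<in> mi m q"
  shows "basisV A B (frameV A' B') = (if A = A' \<and> B = B' then 1 else 0)"
proof -
  \<comment> \<open>The conjugate index \<open>b\<close> is coded as \<open>m + b\<close>, so that
    the two kinds of covectors form one strictly increasing list and \<open>wedge_list_dual\<close>
    applies.\<close>
  define cov where "cov = (\<lambda>i (v::lvec). if i < m then fst v i else snd v (i - m))"
  define fr where "fr = (\<lambda>i. if i < m then (\<lambda>b. if b = i then 1 else 0, \<lambda>b. 0) else (\<lambda>b. 0, \<lambda>b. if b = i - m then 1 else 0) :: lvec)"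
  define ix where "ix = (\<lambda>A B. sorted_list_of_set A @ map (\<lambda>b. m + b) (sorted_list_of_set B))"
  note fin = mi_finite[OF A] mi_finite[OF B] mi_finite[OF A'] mi_finite[OF B']
  have sub: "A \<subseteq> {..<m}" "A' \<subseteq> {..<m}" "B \<subseteq> {..<m}" "B' \<subseteq> {..<m}" using A A' B B' by (auto simp: mi_def)
  have b: "map (\<lambda>a v. fst v a) (sorted_list_of_set A) @ map (\<lambda>b v. snd v b) (sorted_list_of_set B) = map cov (ix A B)"
    unfolding ix_def map_append map_map
    by (intro arg_cong2[where f = "(@)"] map_cong refl ext) (use sub fin in \<open>auto simp: cov_def\<close>)
  have f: "frameV A' B' = map fr (ix A' B')"
    unfolding ix_def frameV_def map_append map_map
    by (intro arg_cong2[where f = "(@)"] map_cong refl) (use sub fin in \<open>auto simp: fr_def\<close>)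
  have srt: "sorted_wrt (<) (ix C D)" if C: "C \<subseteq> {..<m}" "finite C" for C D
  proof -
    have "a < m + b" if "a \<in> C" for a b using that C(1) by (auto intro: trans_less_add1)
    then show ?thesis
      using C(2) strict_sorted_list_of_set[of D] strict_sorted_list_of_set[of C]
      by (cases "finite D") (simp_all add: ix_def sorted_wrt_append sorted_wrt_map)
  qed
  have "wedge_list (map cov (ix A B)) (map fr (ix A' B')) = (if ix A B = ix A' B' then 1 else 0)"
  proof (rule wedge_list_dual)
    show "sorted_wrt (<) (ix A B)" by (rule srt[OF sub(1) fin(1)])
    show "sorted_wrt (<) (ix A' B')" by (rule srt[OF sub(2) fin(3)])
    show "cov i (fr j) = (if i = j then 1 else 0)" for i j
      by (cases "i < m"; cases "j < m") (simp_all add: cov_def fr_def eq_diff_iff)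
  qed
  moreover have "ix A B = ix A' B' \<longleftrightarrow> A = A' \<and> B = B'"
  proof
    assume e: "ix A B = ix A' B'"
    have "set (ix C D) \<inter> {..<m} = C \<and> {b. m + b \<in> set (ix C D)} = D"
      if "C \<subseteq> {..<m}" "finite C" "finite D" for C D
      using that by (auto simp: ix_def)
    from this[OF sub(1) fin(1,2)] this[OF sub(2) fin(3,4)]
    show "A = A' \<and> B = B'" unfolding e by blast
  qed simp
  ultimately show ?thesis by (simp add: basisV_def b f)
qed

text \<open>The local expressions \<open>\<Sum> g\<^sub>A\<^sub>B dz\<^sup>A \<and> dzbar\<^sup>B\<close>, with tangent vectors given by their
  components in the coordinate frame.\<close>

definition local_form :: "nat \<Rightarrow> nat \<Rightarrow> nat \<Rightarrow> nat \<Rightarrow> model set \<Rightarrow> (model \<Rightarrow> lvec list \<Rightarrow> complex) \<Rightarrow> bool" where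
  "local_form m n p q S \<omega> \<longleftrightarrow> (\<exists>g. (\<forall>A\<in>mi m p. \<forall>B\<in>mi m q. smooth_on m n S (g A B)) \<and>
     (\<forall>y\<in>S. \<forall>vs. \<omega> y vs = (\<Sum>A\<in>mi m p. \<Sum>B\<in>mi m q. g A B y * basisV A B vs)))"

lemma local_formI:
  assumes "\<And>A B. A \<in> mi m p \<Longrightarrow> B \<in> mi m q \<Longrightarrow> smooth_on m n S (g A B)"
    and "\<And>y vs. y \<in> S \<Longrightarrow> \<omega> y vs = (\<Sum>A\<in>mi m p. \<Sum>B\<in>mi m q. g A B y * basisV A B vs)"
  shows "local_form m n p q S \<omega>"
  unfolding local_form_def
  by (rule exI[of _ g], intro conjI ballI allI) (rule assms; assumption)+

lemma local_formE:
  assumes "local_form m n p q S \<omega>"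
  obtains g where "\<And>A B. A \<in> mi m p \<Longrightarrow> B \<in> mi m q \<Longrightarrow> smooth_on m n S (g A B)"
    "\<And>y vs. y \<in> S \<Longrightarrow> \<omega> y vs = (\<Sum>A\<in>mi m p. \<Sum>B\<in>mi m q. g A B y * basisV A B vs)"
proof -
  from assms obtain g where g: "(\<forall>A\<in>mi m p. \<forall>B\<in>mi m q. smooth_on m n S (g A B)) \<and>
     (\<forall>y\<in>S. \<forall>vs. \<omega> y vs = (\<Sum>A\<in>mi m p. \<Sum>B\<in>mi m q. g A B y * basisV A B vs))"
    unfolding local_form_def ..
  show thesis
    by (rule that[of g]) (simp_all add: g[THEN conjunct1, rule_format] g[THEN conjunct2, rule_format])
qed

lemma local_form_cong:
  assumes "local_form m n p q S \<omega>" "\<And>y vs. y \<in> S \<Longrightarrow> \<omega> y vs = \<omega>' y vs"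
  shows "local_form m n p q S \<omega>'"
proof -
  obtain g where g: "\<And>A B. A \<in> mi m p \<Longrightarrow> B \<in> mi m q \<Longrightarrow> smooth_on m n S (g A B)"
    "\<And>y vs. y \<in> S \<Longrightarrow> \<omega> y vs = (\<Sum>A\<in>mi m p. \<Sum>B\<in>mi m q. g A B y * basisV A B vs)"
    by (rule local_formE[OF assms(1)]) (rule that)
  show ?thesis
    by (rule local_formI[of _ _ _ _ _ g]) (use g(1) in simp, simp add: g(2) assms(2)[symmetric])
qed

lemma local_form_subset:
  assumes "local_form m n p q S \<omega>" "S' \<subseteq> S"
  shows "local_form m n p q S' \<omega>"
proof -
  obtain g where g: "\<And>A B. A \<in> mi m p \<Longrightarrow> B \<in> mi m q \<Longrightarrow> smooth_on m n S (g A B)"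
    "\<And>y vs. y \<in> S \<Longrightarrow> \<omega> y vs = (\<Sum>A\<in>mi m p. \<Sum>B\<in>mi m q. g A B y * basisV A B vs)"
    by (rule local_formE[OF assms(1)]) (rule that)
  show ?thesis
    by (rule local_formI[of _ _ _ _ _ g], rule smooth_on_subset[OF g(1) assms(2)], assumption, assumption)
       (rule g(2)[OF subsetD[OF assms(2)]])
qed

lemma local_form_smooth:
  assumes S: "model_open m n S" and \<omega>: "local_form m n p q S \<omega>"
  shows "smooth_on m n S (\<lambda>y. \<omega> y vs)"
proof -
  obtain g where g: "\<And>A B. A \<in> mi m p \<Longrightarrow> B \<in> mi m q \<Longrightarrow> smooth_on m n S (g A B)"
    "\<And>y vs. y \<in> S \<Longrightarrow> \<omega> y vs = (\<Sum>A\<in>mi m p. \<Sum>B\<in>mi m q. g A B y * basisV A B vs)"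
    by (rule local_formE[OF \<omega>]) (rule that)
  have "smooth_on m n S (\<lambda>y. \<Sum>A\<in>mi m p. \<Sum>B\<in>mi m q. g A B y * basisV A B vs)"
    by (intro smooth_on_sum smooth_on_mult smooth_on_const S g(1))
  then show ?thesis by (rule smooth_on_cong[OF S, rotated]) (rule g(2)[symmetric])
qed

lemma local_form_zero: "local_form m n p q S (\<lambda>y vs. 0)"
  by (rule local_formI[of _ _ _ _ _ "\<lambda>A B y. 0"]) (auto intro: smooth_on_const)

lemma local_form_add:
  assumes S: "model_open m n S" and 1: "local_form m n p q S \<omega>" and 2: "local_form m n p q S \<omega>'"
  shows "local_form m n p q S (\<lambda>y vs. \<omega> y vs + \<omega>' y vs)"
proof -
  obtain g where g: "\<And>A B. A \<in> mi m p \<Longrightarrow> B \<in> mi m q \<Longrightarrow> smooth_on m n S (g A B)"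
    "\<And>y vs. y \<in> S \<Longrightarrow> \<omega> y vs = (\<Sum>A\<in>mi m p. \<Sum>B\<in>mi m q. g A B y * basisV A B vs)"
    by (rule local_formE[OF 1]) (rule that)
  obtain g' where g': "\<And>A B. A \<in> mi m p \<Longrightarrow> B \<in> mi m q \<Longrightarrow> smooth_on m n S (g' A B)"
    "\<And>y vs. y \<in> S \<Longrightarrow> \<omega>' y vs = (\<Sum>A\<in>mi m p. \<Sum>B\<in>mi m q. g' A B y * basisV A B vs)"
    by (rule local_formE[OF 2]) (rule that)
  show ?thesis
    by (rule local_formI[of _ _ _ _ _ "\<lambda>A B y. g A B y + g' A B y"])
       (auto intro!: smooth_on_add S g(1) g'(1) simp: g(2) g'(2) distrib_right sum.distrib)
qed

lemma local_form_mult: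
  assumes S: "model_open m n S" and h: "smooth_on m n S h" and 1: "local_form m n p q S \<omega>"
  shows "local_form m n p q S (\<lambda>y vs. h y * \<omega> y vs)"
proof -
  obtain g where g: "\<And>A B. A \<in> mi m p \<Longrightarrow> B \<in> mi m q \<Longrightarrow> smooth_on m n S (g A B)"
    "\<And>y vs. y \<in> S \<Longrightarrow> \<omega> y vs = (\<Sum>A\<in>mi m p. \<Sum>B\<in>mi m q. g A B y * basisV A B vs)"
    by (rule local_formE[OF 1]) (rule that)
  show ?thesis
    by (rule local_formI[of _ _ _ _ _ "\<lambda>A B y. h y * g A B y"])
       (auto intro!: smooth_on_mult S h g(1) simp: g(2) sum_distrib_left mult.assoc)
qed

lemma local_form_sum:
  assumes S: "model_open m n S" and "\<And>i. i \<in> I \<Longrightarrow> local_form m n p q S (\<omega> i)"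
  shows "local_form m n p q S (\<lambda>y vs. \<Sum>i\<in>I. \<omega> i y vs)"
  using assms(2)
  by (induction I rule: infinite_finite_induct) (auto intro: local_form_zero local_form_add[OF S])

lemma local_form_basis:
  assumes A: "A \<in> mi m p" and B: "B \<in> mi m q" and h: "smooth_on m n S h"
  shows "local_form m n p q S (\<lambda>y vs. h y * basisV A B vs)"
proof (rule local_formI[of _ _ _ _ _ "\<lambda>A' B' y. if A' = A \<and> B' = B then h y else 0"])
  fix A' B' show "smooth_on m n S (\<lambda>y. if A' = A \<and> B' = B then h y else 0)"
    using h smooth_on_const[of m n S 0] by (cases "A' = A"; cases "B' = B") simp_all
next
  fix y vs
  have "(\<Sum>A'\<in>mi m p. \<Sum>B'\<in>mi m q. (if A' = A \<and> B' = B then h y else 0) * basisV A' B' vs) =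
    (\<Sum>A'\<in>mi m p. \<Sum>B'\<in>mi m q. if B' = B then if A' = A then h y * basisV A B vs else 0 else 0)"
    by (intro sum.cong refl) auto
  then show "h y * basisV A B vs = (\<Sum>A'\<in>mi m p. \<Sum>B'\<in>mi m q. (if A' = A \<and> B' = B then h y else 0) * basisV A' B' vs)"
    using A B by simp
qed

text \<open>A repeated index gives 0; otherwise \<open>a\<close> is inserted into \<open>B\<close>,
  and the sign goes into the coefficient.\<close>

lemma local_form_dzbar_basis:
  assumes S: "model_open m n S" and A: "A \<in> mi m p" and B: "B \<in> mi m q" and a: "a < m" and h: "smooth_on m n S h"
  shows "local_form m n p (Suc q) S (\<lambda>y vs. h y * wedge1 (\<lambda>v. snd v a) (basisV A B) vs)"
proof (cases "a \<in> B")
  case True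
  then have "wedge1 (\<lambda>v. snd v a) (basisV A B) vs = 0" for vs
    unfolding basisV_def
    using wedge1_sorted_repeat[OF mi_finite[OF B], of a "\<lambda>b v. snd v b"] by simp
  then show ?thesis by (simp add: local_form_zero)
next
  case False
  obtain s where s: "\<And>vs. wedge1 (\<lambda>v. snd v a) (basisV A B) vs = s * basisV A (insert a B) vs"
    unfolding basisV_def
    using wedge1_sorted_insert[OF mi_finite[OF B] False, of "\<lambda>b v. snd v b"] by blast
  have "insert a B \<in> mi m (Suc q)" using B a False mi_finite[OF B] by (auto simp: mi_def)
  then have "local_form m n p (Suc q) S (\<lambda>y vs. (h y * s) * basisV A (insert a B) vs)"
    by (intro local_form_basis A smooth_on_mult[OF S h smooth_on_const])
  then show ?thesis by (simp only: s mult.assoc)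
qed

lemma local_form_wedge_dbv:
  assumes S: "model_open m n S" and h: "smooth_on m n S h" and \<omega>: "local_form m n p q S \<omega>"
  shows "local_form m n p (Suc q) S (\<lambda>y. wedge1 (\<lambda>v. dbv m v h y) (\<omega> y))"
proof -
  obtain g where g: "\<And>A B. A \<in> mi m p \<Longrightarrow> B \<in> mi m q \<Longrightarrow> smooth_on m n S (g A B)"
    "\<And>y vs. y \<in> S \<Longrightarrow> \<omega> y vs = (\<Sum>A\<in>mi m p. \<Sum>B\<in>mi m q. g A B y * basisV A B vs)"
    by (rule local_formE[OF \<omega>]) (rule that)
  have "local_form m n p (Suc q) S (\<lambda>y vs. \<Sum>a<m. \<Sum>A\<in>mi m p. \<Sum>B\<in>mi m q.
      (dd \<i> a h y * g A B y) * wedge1 (\<lambda>v. snd v a) (basisV A B) vs)"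
    by (intro local_form_sum S local_form_dzbar_basis smooth_on_mult smooth_on_dd[OF S h] g(1)) auto
  then show ?thesis
  proof (rule local_form_cong)
    fix y vs assume y: "y \<in> S"
    have e: "\<omega> y = (\<lambda>vs. \<Sum>A\<in>mi m p. \<Sum>B\<in>mi m q. g A B y * basisV A B vs)"
      by (rule ext) (rule g(2)[OF y])
    have f: "(\<lambda>v. dbv m v h y) = (\<lambda>v. \<Sum>a<m. dd \<i> a h y * snd v a)"
      by (rule ext) (simp add: dbv_def mult.commute)
    show "(\<Sum>a<m. \<Sum>A\<in>mi m p. \<Sum>B\<in>mi m q. (dd \<i> a h y * g A B y) * wedge1 (\<lambda>v. snd v a) (basisV A B) vs) =
      wedge1 (\<lambda>v. dbv m v h y) (\<omega> y) vs"
      unfolding e f by (simp add: wedge1_sum_left wedge1_cmult_left wedge1_sum wedge1_cmult sum_distrib_left mult.assoc)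
  qed
qed

lemma chart_d_basis: "chart_d m (\<lambda>y vs. basisV A B vs) y Xs = 0"
  by (simp add: chart_d_def)

text \<open>Here \<open>b\<close> is any frame of closed forms. It is used with the constant basis
  of the chart itself and, in \<open>pull_dbar\<close>, with the basis of another chart, whose
  values vary with the point.\<close>

lemma local_form_expand_d:
  assumes S: "model_open m n S" and y: "y \<in> S"
    and g: "\<And>A B. A \<in> mi m p \<Longrightarrow> B \<in> mi m q \<Longrightarrow> smooth_on m n S (g A B)"
    and b: "\<And>A B r. A \<in> mi m p \<Longrightarrow> B \<in> mi m q \<Longrightarrow> smooth_on m n S (\<lambda>y. b A B y r)"
    and b0: "\<And>A B. A \<in> mi m p \<Longrightarrow> B \<in> mi m q \<Longrightarrow> chart_d m (b A B) y Xs = 0"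
    and \<omega>: "\<And>y vs. y \<in> S \<Longrightarrow> \<omega> y vs = (\<Sum>A\<in>mi m p. \<Sum>B\<in>mi m q. g A B y * b A B y vs)"
  shows "chart_d m \<omega> y Xs = (\<Sum>A\<in>mi m p. \<Sum>B\<in>mi m q. wedge1 (\<lambda>v. dbv m v (g A B) y) (b A B y) Xs)"
proof -
  have sm: "smooth_on m n S (\<lambda>y. g A B y * b A B y r)" if "A \<in> mi m p" "B \<in> mi m q" for A B r
    by (rule smooth_on_mult[OF S g[OF that] b[OF that]])
  have "chart_d m \<omega> y Xs = chart_d m (\<lambda>y vs. \<Sum>A\<in>mi m p. \<Sum>B\<in>mi m q. g A B y * b A B y vs) y Xs"
    by (rule chart_d_cong[OF S y]) (rule \<omega>)
  also have "\<dots> = (\<Sum>A\<in>mi m p. chart_d m (\<lambda>y vs. \<Sum>B\<in>mi m q. g A B y * b A B y vs) y Xs)"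
    by (rule chart_d_sum[OF S y]) (intro smooth_on_sum S sm)
  also have "\<dots> = (\<Sum>A\<in>mi m p. \<Sum>B\<in>mi m q. chart_d m (\<lambda>y vs. g A B y * b A B y vs) y Xs)"
    by (rule sum.cong[OF refl], rule chart_d_sum[OF S y]) (rule sm)
  also have "\<dots> = (\<Sum>A\<in>mi m p. \<Sum>B\<in>mi m q. wedge1 (\<lambda>v. dbv m v (g A B) y) (b A B y) Xs)"
  proof (intro sum.cong refl)
    fix A B assume AB: "A \<in> mi m p" "B \<in> mi m q"
    have "chart_d m (\<lambda>y vs. g A B y * b A B y vs) y Xs =
       wedge1 (\<lambda>v. dbv m v (g A B) y) (b A B y) Xs + g A B y * chart_d m (b A B) y Xs"
      by (rule chart_d_mult[OF S y g[OF AB]]) (rule b[OF AB])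
    then show "chart_d m (\<lambda>y vs. g A B y * b A B y vs) y Xs = wedge1 (\<lambda>v. dbv m v (g A B) y) (b A B y) Xs"
      using b0[OF AB] by simp
  qed
  finally show ?thesis .
qed

lemma local_form_chart_d:
  assumes S: "model_open m n S" and \<omega>: "local_form m n p q S \<omega>"
  shows "local_form m n p (Suc q) S (chart_d m \<omega>)"
proof -
  obtain g where g: "\<And>A B. A \<in> mi m p \<Longrightarrow> B \<in> mi m q \<Longrightarrow> smooth_on m n S (g A B)"
    "\<And>y vs. y \<in> S \<Longrightarrow> \<omega> y vs = (\<Sum>A\<in>mi m p. \<Sum>B\<in>mi m q. g A B y * basisV A B vs)"
    by (rule local_formE[OF \<omega>]) (rule that)
  have "local_form m n p (Suc q) S (\<lambda>y vs. \<Sum>A\<in>mi m p. \<Sum>B\<in>mi m q. wedge1 (\<lambda>v. dbv m v (g A B) y) (basisV A B) vs)"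
  proof (intro local_form_sum S)
    fix A B assume AB: "A \<in> mi m p" "B \<in> mi m q"
    have "local_form m n p q S (\<lambda>y vs. 1 * basisV A B vs)"
      by (intro local_form_basis AB smooth_on_const)
    then have "local_form m n p q S (\<lambda>y. basisV A B)" by simp
    then show "local_form m n p (Suc q) S (\<lambda>y. wedge1 (\<lambda>v. dbv m v (g A B) y) (basisV A B))"
      by (rule local_form_wedge_dbv[OF S g(1)[OF AB]])
  qed
  then show ?thesis
  proof (rule local_form_cong)
    fix y vs assume y: "y \<in> S"
    show "(\<Sum>A\<in>mi m p. \<Sum>B\<in>mi m q. wedge1 (\<lambda>v. dbv m v (g A B) y) (basisV A B) vs) = chart_d m \<omega> y vs"
      by (rule local_form_expand_d[OF S y g(1) _ _ g(2), symmetric])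
         (simp_all add: smooth_on_const chart_d_basis)
  qed
qed

text \<open>The chart expression of \<open>dbar_f\<close>, with \<open>k\<close> standing for the
  weight \<open>p + q\<close>.\<close>

definition twisted_d :: "nat \<Rightarrow> complex \<Rightarrow> (model \<Rightarrow> complex) \<Rightarrow> (model \<Rightarrow> lvec list \<Rightarrow> complex) \<Rightarrow> model \<Rightarrow> lvec list \<Rightarrow> complex" where
  "twisted_d m k f \<omega> y vs = f y * chart_d m \<omega> y vs - k * wedge1 (\<lambda>v. dbv m v f y) (\<omega> y) vs"

lemma twisted_d_cong:
  assumes "model_open m n S" "y \<in> S" "\<And>y r. y \<in> S \<Longrightarrow> \<omega> y r = \<omega>' y r"
  shows "twisted_d m k f \<omega> y vs = twisted_d m k f \<omega>' y vs"
proof -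
  have "\<omega> y = \<omega>' y" by (rule ext) (rule assms(3)[OF assms(2)])
  moreover have "chart_d m \<omega> y vs = chart_d m \<omega>' y vs" by (rule chart_d_cong[OF assms(1,2)]) (rule assms(3))
  ultimately show ?thesis by (simp add: twisted_d_def)
qed

lemma local_form_twisted_d:
  assumes S: "model_open m n S" and f: "smooth_on m n S f" and \<omega>: "local_form m n p q S \<omega>"
  shows "local_form m n p (Suc q) S (twisted_d m k f \<omega>)"
proof -
  have "local_form m n p (Suc q) S (\<lambda>y vs. f y * chart_d m \<omega> y vs + (- k) * wedge1 (\<lambda>v. dbv m v f y) (\<omega> y) vs)"
    by (intro local_form_add local_form_mult S f smooth_on_const local_form_chart_d[OF S \<omega>] local_form_wedge_dbv[OF S f \<omega>])
  then show ?thesis by (rule local_form_cong) (simp add: twisted_d_def)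
qed

text \<open>With \<open>\<eta> = \<partial>bar f\<close> and \<open>D = \<partial>bar\<close>,
  applying \<open>D\<close> to \<open>f D\<omega> - k \<eta> \<and> \<omega>\<close> gives
  \<open>(1 + k) \<eta> \<and> D\<omega>\<close>, because \<open>D\<eta> = 0\<close>. Multiplied by
  \<open>f\<close>, this is cancelled by \<open>(k + 1) \<eta> \<and> f D\<omega>\<close>, as
  \<open>\<eta> \<and> \<eta> = 0\<close>. The cancellation relies on the second weight being
  \<open>k + 1\<close>.\<close>

lemma twisted_d_twisted_d:
  assumes S: "model_open m n S" and y: "y \<in> S" and f: "smooth_on m n S f"
    and \<omega>: "\<And>r. smooth_on m n S (\<lambda>y. \<omega> y r)"
  shows "twisted_d m (k + 1) f (twisted_d m k f \<omega>) y vs = 0"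
proof -
  define \<eta> where "\<eta> = (\<lambda>y v. dbv m v f y)"
  have \<eta>s: "smooth_on m n S (\<lambda>y. \<eta> y v)" for v using smooth_on_dbv[OF S f] by (simp add: \<eta>_def)
  have D: "smooth_on m n S (\<lambda>y. chart_d m \<omega> y r)" for r by (rule smooth_on_chart_d[OF S \<omega>])
  have W: "smooth_on m n S (\<lambda>y. wedge1 (\<eta> y) (\<omega> y) r)" for r by (rule smooth_on_wedge1[OF S \<eta>s \<omega>])
  have td: "twisted_d m k f \<omega> = (\<lambda>y r. f y * chart_d m \<omega> y r + (- k) * wedge1 (\<eta> y) (\<omega> y) r)"
    by (intro ext) (simp add: twisted_d_def \<eta>_def)
  have c1: "chart_d m (\<lambda>y r. f y * chart_d m \<omega> y r) y Xs = wedge1 (\<eta> y) (chart_d m \<omega> y) Xs" for Xs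
    using chart_d_mult[OF S y f D] chart_d_chart_d[OF S y \<omega>] by (simp add: \<eta>_def)
  have c2: "chart_d m (\<lambda>y r. (- k) * wedge1 (\<eta> y) (\<omega> y) r) y Xs = k * wedge1 (\<eta> y) (chart_d m \<omega> y) Xs" for Xs
  proof -
    have "chart_d m (\<lambda>y. wedge1 (\<eta> y) (\<omega> y)) y Xs = - wedge1 (\<eta> y) (chart_d m \<omega> y) Xs"
      by (rule chart_d_wedge1[OF S y \<eta>s \<omega>]) (simp add: \<eta>_def dbv_commute[OF S f y])
    moreover have "chart_d m (\<lambda>y r. (- k) * wedge1 (\<eta> y) (\<omega> y) r) y Xs =
        wedge1 (\<lambda>v. dbv m v (\<lambda>y. - k) y) (wedge1 (\<eta> y) (\<omega> y)) Xs + (- k) * chart_d m (\<lambda>y. wedge1 (\<eta> y) (\<omega> y)) y Xs"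
      by (rule chart_d_mult[OF S y smooth_on_const]) (rule W)
    moreover have "wedge1 (\<lambda>v. dbv m v (\<lambda>y. - k) y) (wedge1 (\<eta> y) (\<omega> y)) Xs = 0"
      by (simp add: wedge1_eq)
    ultimately show ?thesis by (simp only: add_0_left minus_mult_minus)
  qed
  have "chart_d m (twisted_d m k f \<omega>) y Xs = (1 + k) * wedge1 (\<eta> y) (chart_d m \<omega> y) Xs" for Xs
  proof -
    have "chart_d m (twisted_d m k f \<omega>) y Xs =
      alt_sum (\<lambda>v r. dbv m v (\<lambda>y. f y * chart_d m \<omega> y r) y + dbv m v (\<lambda>y. (- k) * wedge1 (\<eta> y) (\<omega> y) r) y) Xs"
      unfolding td chart_d_def[of m "\<lambda>y r. _ y r + _ y r"]
      by (rule alt_sum_cong, rule dbv_add[OF smooth_on_mult[OF S f D] smooth_on_mult[OF S smooth_on_const W] y])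
    also have "\<dots> = chart_d m (\<lambda>y r. f y * chart_d m \<omega> y r) y Xs + chart_d m (\<lambda>y r. (- k) * wedge1 (\<eta> y) (\<omega> y) r) y Xs"
      by (simp add: alt_sum_add chart_d_def)
    finally show ?thesis by (simp only: c1 c2 distrib_right mult_1_left)
  qed
  moreover have "wedge1 (\<eta> y) (twisted_d m k f \<omega> y) vs = f y * wedge1 (\<eta> y) (chart_d m \<omega> y) vs"
  proof -
    have "wedge1 (\<eta> y) (\<lambda>r. f y * chart_d m \<omega> y r + (- k) * wedge1 (\<eta> y) (\<omega> y) r) vs =
      wedge1 (\<eta> y) (\<lambda>r. f y * chart_d m \<omega> y r) vs + wedge1 (\<eta> y) (\<lambda>r. (- k) * wedge1 (\<eta> y) (\<omega> y) r) vs"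
      by (simp only: wedge1_eq distrib_left alt_sum_add)
    moreover have "wedge1 (\<eta> y) (\<lambda>r. (- k) * wedge1 (\<eta> y) (\<omega> y) r) vs = 0"
      by (simp only: wedge1_cmult wedge1_same mult_zero_right)
    ultimately show ?thesis by (simp only: td wedge1_cmult add_0_right)
  qed
  ultimately show ?thesis
    unfolding twisted_d_def[of m "k + 1"] \<eta>_def by (simp add: algebra_simps)
qed

section \<open>Coordinate changes\<close>

text \<open>The leafwise differential of \<open>u\<close> at \<open>y\<close>, applied to the vector
  with components \<open>v\<close>.\<close>

definition lform :: "nat \<Rightarrow> (model \<Rightarrow> complex) \<Rightarrow> model \<Rightarrow> lvec \<Rightarrow> complex" where
  "lform m u y v = (\<Sum>b<m. fst v b * dd (-\<i>) b u y + snd v b * dd \<i> b u y)"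

definition vecof :: "'a foliated \<Rightarrow> 'a chart \<Rightarrow> model \<Rightarrow> lvec \<Rightarrow> 'a tvec" where
  "vecof F c y v = (\<lambda>f. \<Sum>a<cdim F. fst v a * vec_dz F c a y f + snd v a * vec_dzbar F c a y f)"

text \<open>Component lists do not depend on the point, so for a fixed list the value is a function
  on the chart domain that can be differentiated.\<close>

definition pull :: "'a foliated \<Rightarrow> 'a chart \<Rightarrow> 'a cform \<Rightarrow> model \<Rightarrow> lvec list \<Rightarrow> complex" where
  "pull F c \<phi> y vs = \<phi> (snd c y) (map (vecof F c y) vs)"

lemma vecof_apply:
  "vecof F c y v f = (if smooth_near F (snd c y) f then lform (cdim F) (f \<circ> snd c) y v else 0)"
  by (simp add: vecof_def lform_def vec_dz_def vec_dzbar_def d_dz_eq d_dzbar_eq)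

lemma lform_cong:
  assumes "model_open m n S" "y \<in> S" "\<And>y. y \<in> S \<Longrightarrow> g y = g' y"
  shows "lform m g y v = lform m g' y v"
proof -
  have "dd \<sigma> b g y = dd \<sigma> b g' y" if "b < m" for \<sigma> b
    by (rule dd_cong[OF assms(1,2) that]) (rule assms(3))
  then show ?thesis unfolding lform_def by (intro sum.cong refl) simp
qed

lemma smooth_on_lform:
  assumes "model_open m n S" "smooth_on m n S g"
  shows "smooth_on m n S (\<lambda>y. lform m g y v)"
  unfolding lform_def
  by (rule smooth_on_sum[OF assms(1)], rule smooth_on_add[OF assms(1)];
      rule smooth_on_mult[OF assms(1) smooth_on_const], rule smooth_on_dd[OF assms], simp)

text \<open>The differential of a holomorphic \<open>u\<close> has the coefficients
  \<open>\<partial>u/\<partial>z\<^sup>b\<close>, which are again holomorphic. Together with the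
  antiholomorphic case this supplies the hypothesis \<open>closed\<close> of
  \<open>chart_d_wedge_list\<close> for the covectors of another chart.\<close>

lemma dbv_lform_holomorphic:
  assumes S: "model_open m n S" and y: "y \<in> S" and u: "smooth_on m n S u"
    and h: "\<And>b y. b < m \<Longrightarrow> y \<in> S \<Longrightarrow> dd \<i> b u y = 0"
  shows "dbv m w (\<lambda>y. lform m u y v) y = 0"
proof -
  have s: "smooth_on m n S (dd (-\<i>) b u)" if "b < m" for b by (rule smooth_on_dd[OF S u that])
  have c: "dd \<i> a (dd (-\<i>) b u) y = 0" if "a < m" "b < m" for a b
  proof -
    have "dd \<i> a (dd (-\<i>) b u) y = dd (-\<i>) b (dd \<i> a u) y" by (rule dd_commute[OF S u y that])
    also have "\<dots> = dd (-\<i>) b (\<lambda>y. 0) y" by (rule dd_cong[OF S y that(2)]) (rule h[OF that(1)])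
    finally show ?thesis by simp
  qed
  have "dbv m w (\<lambda>y. lform m u y v) y = dbv m w (\<lambda>y. \<Sum>b<m. fst v b * dd (-\<i>) b u y) y"
  proof (rule dbv_cong[OF S y])
    fix y assume "y \<in> S"
    then show "lform m u y v = (\<Sum>b<m. fst v b * dd (-\<i>) b u y)"
      unfolding lform_def by (intro sum.cong refl) (simp add: h)
  qed
  also have "\<dots> = (\<Sum>b<m. dbv m w (\<lambda>y. fst v b * dd (-\<i>) b u y) y)"
    by (rule dbv_sum[OF S _ y]) (rule smooth_on_mult[OF S smooth_on_const s], simp)
  also have "\<dots> = (\<Sum>b<m. fst v b * dbv m w (dd (-\<i>) b u) y)"
    by (rule sum.cong[OF refl]) (rule dbv_cmult[OF s y], simp)
  also have "\<dots> = 0" by (rule sum.neutral) (simp add: dbv_def c)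
  finally show ?thesis .
qed

text \<open>For antiholomorphic \<open>u\<close> the differential is \<open>dbv\<close> itself, and
  such derivatives commute.\<close>

lemma dbv_lform_antiholomorphic:
  assumes S: "model_open m n S" and y: "y \<in> S" and u: "smooth_on m n S u"
    and h: "\<And>b y. b < m \<Longrightarrow> y \<in> S \<Longrightarrow> dd (-\<i>) b u y = 0"
  shows "dbv m w (\<lambda>y. lform m u y v) y = dbv m v (\<lambda>y. lform m u y w) y"
proof -
  have e: "dbv m w (\<lambda>y. lform m u y v) y = dbv m w (dbv m v u) y" for v w
  proof (rule dbv_cong[OF S y])
    fix y assume "y \<in> S"
    then show "lform m u y v = dbv m v u y"
      unfolding lform_def dbv_def by (intro sum.cong refl) (simp add: h)
  qed
  show ?thesis unfolding e by (rule dbv_commute[OF S u y])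
qed

lemma dbv_eq_lform:
  assumes "\<And>b. b < m \<Longrightarrow> dd (-\<i>) b u y = 0"
  shows "dbv m v u y = lform m u y v"
  unfolding lform_def dbv_def by (intro sum.cong refl) (simp add: assms)

section \<open>Charts and coordinate changes of a complex foliation\<close>

locale complex_fol =
  fixes F :: "'a foliated"
  assumes fol: "complex_foliation F"
begin

abbreviation "m \<equiv> cdim F"
abbreviation "n \<equiv> codim F"
abbreviation "X \<equiv> mtop F"

lemmas fol_facts = fol[unfolded complex_foliation_def Let_def]

lemma Hausdorff: "Hausdorff_space X"
  by (rule fol_facts[THEN conjunct1])

lemma second_countable: "second_countable X"
  by (rule fol_facts[THEN conjunct2, THEN conjunct1])

lemma cover: "(\<Union>c\<in>charts F. chart_image c) = topspace X"
  by (rule fol_facts[THEN conjunct2, THEN conjunct2, THEN conjunct2, THEN conjunct1])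

lemma chart_facts:
  assumes "c \<in> charts F"
  shows "disc_ball m n (fst c)" "openin X (chart_image c)"
    "homeomorphic_map (top_of_set (fst c)) (subtopology X (chart_image c)) (snd c)"
  using fol_facts[THEN conjunct2, THEN conjunct2, THEN conjunct1, THEN bspec, OF assms] by simp_all

lemma chart_open: "c \<in> charts F \<Longrightarrow> model_open m n (fst c)"
  by (rule disc_ball_open[OF chart_facts(1)])

lemma chart_inj: "c \<in> charts F \<Longrightarrow> inj_on (snd c) (fst c)"
  using homeomorphic_imp_injective_map[OF chart_facts(3)] by simp

lemma adapted_snd: "c \<in> charts F \<Longrightarrow> y \<in> fst c \<Longrightarrow> adapted c (snd c y) = y"
  unfolding adapted_def by (rule inv_into_f_f[OF chart_inj])

lemma snd_adapted: "x \<in> chart_image c \<Longrightarrow> snd c (adapted c x) = x"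
  unfolding adapted_def chart_image_def by (rule f_inv_into_f)

lemma adapted_in: "x \<in> chart_image c \<Longrightarrow> adapted c x \<in> fst c"
  unfolding adapted_def chart_image_def by (rule inv_into_into)

lemma chart_imageI: "y \<in> fst c \<Longrightarrow> snd c y \<in> chart_image c"
  by (simp add: chart_image_def)

lemma chart_in_space: "c \<in> charts F \<Longrightarrow> y \<in> fst c \<Longrightarrow> snd c y \<in> topspace X"
  using openin_subset[OF chart_facts(2)] chart_imageI by blast

lemma obtain_chart:
  assumes "x \<in> topspace X"
  obtains c y where "c \<in> charts F" "y \<in> fst c" "snd c y = x"
proof -
  obtain c where c: "c \<in> charts F" "x \<in> chart_image c" using assms cover by blast
  show thesis by (rule that[OF c(1) adapted_in[OF c(2)] snd_adapted[OF c(2)]])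
qed

lemma open_preimage:
  assumes c: "c \<in> charts F" and N: "openin X N"
  shows "model_open m n {y \<in> fst c. snd c y \<in> N}"
proof -
  have "continuous_map (top_of_set (fst c)) X (snd c)"
    using homeomorphic_imp_continuous_map[OF chart_facts(3)[OF c]] by (rule continuous_map_into_fulltopology)
  from openin_continuous_map_preimage[OF this N]
  have "openin (top_of_set (fst c)) {y \<in> fst c. snd c y \<in> N}" by simp
  then show ?thesis using chart_open[OF c] by (rule openin_trans)
qed

lemma open_image:
  assumes c: "c \<in> charts F" and S: "model_open m n S" "S \<subseteq> fst c"
  shows "openin X (snd c ` S)"
proof -
  have "openin (top_of_set (fst c)) S"
    using S model_open_imp_subset[OF chart_open[OF c]] by (metis openin_subset_trans)
  then have "openin (subtopology X (chart_image c)) (snd c ` S)"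
    using homeomorphic_imp_open_map[OF chart_facts(3)[OF c]] by (simp add: open_map_def)
  then show ?thesis using chart_facts(2)[OF c] by (simp add: openin_open_subtopology)
qed

lemma overlap_open: "c \<in> charts F \<Longrightarrow> c' \<in> charts F \<Longrightarrow> model_open m n (overlap c c')"
  unfolding overlap_def by (rule open_preimage[OF _ chart_facts(2)])

lemma overlapD:
  assumes "y \<in> overlap c c'"
  shows "y \<in> fst c" "transition c c' y \<in> fst c'" "snd c' (transition c c' y) = snd c y"
proof -
  have y: "y \<in> fst c" "snd c y \<in> chart_image c'" using assms by (simp_all add: overlap_def)
  show "y \<in> fst c" by (rule y)
  show "transition c c' y \<in> fst c'" "snd c' (transition c c' y) = snd c y"
    using adapted_in[OF y(2)] snd_adapted[OF y(2)] by (simp_all add: transition_def)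
qed

lemma overlapI:
  assumes "c' \<in> charts F" "y \<in> fst c" "y' \<in> fst c'" "snd c y = snd c' y'"
  shows "y \<in> overlap c c'" "transition c c' y = y'"
  using assms adapted_snd[OF assms(1,3)] by (auto simp: overlap_def transition_def chart_image_def)

lemma transition_facts:
  assumes "c \<in> charts F" "c' \<in> charts F"
  shows "a < m \<Longrightarrow> smooth_on m n (overlap c c') (\<lambda>y. fst (transition c c' y) a)"
    "b < n \<Longrightarrow> smooth_on m n (overlap c c') (\<lambda>y. of_real (snd (transition c c' y) b))"
    "a < m \<Longrightarrow> b < m \<Longrightarrow> (\<lambda>w. fst (transition c c' (z(b := w), t)) a) holomorphic_on {w. (z(b := w), t) \<in> overlap c c'}"
    "\<exists>h. \<forall>y\<in>overlap c c'. snd (transition c c' y) = h (snd y)"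
  using fol_facts[THEN conjunct2, THEN conjunct2, THEN conjunct2, THEN conjunct2, THEN bspec, THEN bspec, OF assms]
  by simp_all

text \<open>The Cauchy-Riemann equation: the slice of the overlap in direction \<open>b\<close> is
  open in the plane, and there the complex derivative \<open>D\<close> yields the real partial
  derivatives \<open>D\<close> and \<open>\<i> * D\<close>.\<close>

lemma transition_holomorphic:
  assumes c: "c \<in> charts F" "c' \<in> charts F" and y: "y \<in> overlap c c'" and a: "a < m" and b: "b < m"
  shows "dd \<i> b (\<lambda>y. fst (transition c c' y) a) y = 0"
proof -
  obtain z t where zt: "y = (z, t)" by (cases y)
  define u where "u = (\<lambda>w. fst (transition c c' (z(b := w), t)) a)"
  define W where "W = {w. (z(b := w), t) \<in> overlap c c'}"
  obtain N where N: "open N" "overlap c c' = model_space m n \<inter> N"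
    using overlap_open[OF c] by (auto simp: openin_open)
  have ms: "(z(b := w), t) \<in> model_space m n" for w
    using y b N zt by (auto simp: model_space_def)
  have "continuous_on UNIV (\<lambda>w. (z(b := w)) i)" for i
    by (cases "i = b") (auto intro: continuous_intros)
  then have "continuous_on UNIV (\<lambda>w. (z(b := w), t))"
    by (intro continuous_on_Pair continuous_on_coordinatewise_then_product continuous_on_const)
  then have "open ((\<lambda>w. (z(b := w), t)) -` N)"
    by (rule open_vimage[OF N(1)])
  moreover have "W = (\<lambda>w. (z(b := w), t)) -` N" using ms N(2) by (auto simp: W_def)
  ultimately have W: "open W" by simp
  have zb: "z b \<in> W" using y zt by (simp add: W_def)
  have "u holomorphic_on W" unfolding u_def W_def by (rule transition_facts(3)[OF c a b])
  from holomorphic_on_imp_differentiable_at[OF this W zb]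
  obtain D where D: "(u has_field_derivative D) (at (z b))" by (auto simp: field_differentiable_def)
  have d: "((\<lambda>s. u (z b + k * of_real s)) has_vector_derivative k * D) (at 0)" for k
  proof -
    have "((\<lambda>s. z b + k * of_real s) has_vector_derivative k) (at 0)"
      by (auto intro!: derivative_eq_intros)
    from field_vector_diff_chain_at[OF this, of u D] D show ?thesis by (simp add: o_def)
  qed
  have "pderiv_at (ReZ b) (\<lambda>y. fst (transition c c' y) a) y = D"
    using d[of 1] zt by (intro has_pderiv_imp) (simp add: has_pderiv_def u_def)
  moreover have "pderiv_at (ImZ b) (\<lambda>y. fst (transition c c' y) a) y = \<i> * D"
    using d[of \<i>] zt by (intro has_pderiv_imp) (simp add: has_pderiv_def u_def)
  ultimately show ?thesis by (simp add: dd_def)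
qed

text \<open>Moving along the leaf keeps \<open>snd y\<close> fixed, and the transverse part of a
  coordinate change is a function of \<open>snd y\<close>.\<close>

lemma transition_leaf:
  assumes c: "c \<in> charts F" "c' \<in> charts F" and y: "y \<in> overlap c c'" and b: "b < m"
  shows "dd \<sigma> b (\<lambda>y. of_real (snd (transition c c' y) k)) y = 0"
proof -
  obtain h where h: "\<And>y. y \<in> overlap c c' \<Longrightarrow> snd (transition c c' y) = h (snd y)"
    using transition_facts(4)[OF c] by blast
  have "pderiv_at l (\<lambda>y. of_real (snd (transition c c' y) k)) y = 0" if l: "l = ReZ b \<or> l = ImZ b" for l
  proof -
    have lc: "l \<in> coords m n" using l b by auto
    have s: "snd (shift l s y) = snd y" for s using l by (cases y) auto
    have "has_pderiv l (\<lambda>y. of_real (h (snd y) k)) y 0"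
      unfolding has_pderiv_def s by (rule has_vector_derivative_const)
    then have "has_pderiv l (\<lambda>y. of_real (snd (transition c c' y) k)) y 0"
      by (subst has_pderiv_cong[OF overlap_open[OF c] y lc]) (simp_all add: h)
    then show ?thesis by (rule has_pderiv_imp)
  qed
  then show ?thesis by (simp add: dd_def)
qed

lemma transition_cnj:
  assumes c: "c \<in> charts F" "c' \<in> charts F" and y: "y \<in> overlap c c'" and a: "a < m" and b: "b < m"
  shows "dd (-\<i>) b (\<lambda>y. cnj (fst (transition c c' y) a)) y = 0"
  using dd_cnj[OF transition_facts(1)[OF c a] y b, of "-\<i>"] transition_holomorphic[OF c y a b] by simp

lemma transition_smooth_compose:
  assumes c: "c \<in> charts F" "c' \<in> charts F" and g: "smooth_on m n (fst c') g"
  shows "smooth_on m n (overlap c c') (\<lambda>y. g (transition c c' y))"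
proof (rule smooth_on_compose[OF overlap_open[OF c] chart_open[OF c(2)] _ _ _ g])
  show "transition c c' ` overlap c c' \<subseteq> fst c'" using overlapD(2) by blast
qed (rule transition_facts[OF c]; assumption)+

text \<open>The open set \<open>N\<close> is there for functions that are smooth only near a point,
  such as the arguments of tangent vectors.\<close>

lemma dd_transition:
  assumes c: "c \<in> charts F" "c' \<in> charts F" and N: "openin X N"
    and g: "smooth_on m n {y \<in> fst c'. snd c' y \<in> N} g"
    and y: "y \<in> overlap c c'" "snd c y \<in> N" and a: "a < m"
  shows "dd \<sigma> a (\<lambda>y. g (transition c c' y)) y =
    (\<Sum>b<m. dd (-\<i>) b g (transition c c' y) * dd \<sigma> a (\<lambda>y. fst (transition c c' y) b) y +
          dd \<i> b g (transition c c' y) * dd \<sigma> a (\<lambda>y. cnj (fst (transition c c' y) b)) y)"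
proof -
  define S where "S = overlap c c' \<inter> {y \<in> fst c. snd c y \<in> N}"
  have S: "model_open m n S" unfolding S_def by (intro openin_Int overlap_open open_preimage c N)
  have so: "S \<subseteq> overlap c c'" by (simp add: S_def)
  have yS: "y \<in> S" using y overlapD(1)[OF y(1)] by (simp add: S_def)
  have T: "transition c c' ` S \<subseteq> {y \<in> fst c'. snd c' y \<in> N}"
  proof (rule image_subsetI)
    fix z assume "z \<in> S"
    then have z: "z \<in> overlap c c'" "snd c z \<in> N" by (simp_all add: S_def)
    show "transition c c' z \<in> {y \<in> fst c'. snd c' y \<in> N}"
      using overlapD(2,3)[OF z(1)] z(2) by simp
  qed
  have "dd \<sigma> a (\<lambda>y. g (transition c c' y)) y =
    (\<Sum>b<m. dd (-\<i>) b g (transition c c' y) * dd \<sigma> a (\<lambda>y. fst (transition c c' y) b) y +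
          dd \<i> b g (transition c c' y) * dd \<sigma> a (\<lambda>y. cnj (fst (transition c c' y) b)) y)
     + (\<Sum>b<n. pderiv_at (RealX b) g (transition c c' y) * dd \<sigma> a (\<lambda>y. of_real (snd (transition c c' y) b)) y)"
    by (rule dd_compose[OF S open_preimage[OF c(2) N] g T _ _ yS a])
       (rule smooth_on_subset[OF transition_facts(1)[OF c] so], assumption,
        rule smooth_on_subset[OF transition_facts(2)[OF c] so], assumption)
  then show ?thesis by (simp add: transition_leaf[OF c y(1) a])
qed

text \<open>The leafwise Jacobian of the coordinate change, acting on components. The blocks that
  vanish by holomorphy are written out, so that \<open>vecof_change\<close> is a pure chain
  rule.\<close>

definition change :: "'a chart \<Rightarrow> 'a chart \<Rightarrow> model \<Rightarrow> lvec \<Rightarrow> lvec" where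
  "change c c' y v = (\<lambda>a. lform m (\<lambda>y. fst (transition c c' y) a) y v,
     \<lambda>a. lform m (\<lambda>y. cnj (fst (transition c c' y) a)) y v)"

lemma vecof_change:
  assumes c: "c \<in> charts F" "c' \<in> charts F" and y: "y \<in> overlap c c'"
  shows "vecof F c y v = vecof F c' (transition c c' y) (change c c' y v)"
proof
  fix f
  show "vecof F c y v f = vecof F c' (transition c c' y) (change c c' y v) f"
  proof (cases "smooth_near F (snd c y) f")
    case True
    then obtain N where N: "openin X N" "snd c y \<in> N"
      "\<And>c. c \<in> charts F \<Longrightarrow> smooth_on m n {y \<in> fst c. snd c y \<in> N} (f \<circ> snd c)"
      unfolding smooth_near_def by blast
    define P where "P = (\<lambda>b. dd (-\<i>) b (f \<circ> snd c') (transition c c' y))"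
    define Q where "Q = (\<lambda>b. dd \<i> b (f \<circ> snd c') (transition c c' y))"
    have e: "dd \<sigma> a (f \<circ> snd c) y =
      (\<Sum>b<m. P b * dd \<sigma> a (\<lambda>y. fst (transition c c' y) b) y + Q b * dd \<sigma> a (\<lambda>y. cnj (fst (transition c c' y) b)) y)"
      if "a < m" for a \<sigma>
    proof -
      have "dd \<sigma> a (f \<circ> snd c) y = dd \<sigma> a (\<lambda>y. (f \<circ> snd c') (transition c c' y)) y"
        by (rule dd_cong[OF overlap_open[OF c] y that]) (simp add: overlapD(3))
      then show ?thesis unfolding P_def Q_def
        by (rule trans[OF _ dd_transition[OF c N(1) N(3)[OF c(2)] y N(2) that]])
    qed
    have "lform m (f \<circ> snd c) y v = (\<Sum>a<m. \<Sum>b<m.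
        P b * (fst v a * dd (-\<i>) a (\<lambda>y. fst (transition c c' y) b) y + snd v a * dd \<i> a (\<lambda>y. fst (transition c c' y) b) y) +
        Q b * (fst v a * dd (-\<i>) a (\<lambda>y. cnj (fst (transition c c' y) b)) y + snd v a * dd \<i> a (\<lambda>y. cnj (fst (transition c c' y) b)) y))"
      unfolding lform_def by (rule sum.cong[OF refl]) (simp add: e sum_distrib_left sum.distrib[symmetric] algebra_simps)
    also have "\<dots> = (\<Sum>b<m. \<Sum>a<m.
        P b * (fst v a * dd (-\<i>) a (\<lambda>y. fst (transition c c' y) b) y + snd v a * dd \<i> a (\<lambda>y. fst (transition c c' y) b) y) +
        Q b * (fst v a * dd (-\<i>) a (\<lambda>y. cnj (fst (transition c c' y) b)) y + snd v a * dd \<i> a (\<lambda>y. cnj (fst (transition c c' y) b)) y))"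
      by (rule sum.swap)
    also have "\<dots> = (\<Sum>b<m. P b * lform m (\<lambda>y. fst (transition c c' y) b) y v + Q b * lform m (\<lambda>y. cnj (fst (transition c c' y) b)) y v)"
      by (simp only: lform_def sum.distrib[symmetric] sum_distrib_left)
    also have "\<dots> = lform m (f \<circ> snd c') (transition c c' y) (change c c' y v)"
      unfolding lform_def[of m "f \<circ> snd c'"] change_def P_def Q_def by (simp add: mult.commute)
    finally show ?thesis using True overlapD(3)[OF y] by (simp add: vecof_apply)
  next
    case False
    then show ?thesis using overlapD(3)[OF y] by (simp add: vecof_apply)
  qed
qed

text \<open>The definition collects vectors over all charts at the point; by
  \<open>vecof_change\<close> each of them already lies in the span of a single frame.\<close>

lemma leaf_tangent_eq:
  assumes c: "c \<in> charts F" and y: "y \<in> fst c"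
  shows "leaf_tangent F (snd c y) = range (vecof F c y)"
proof (rule equalityI; rule subsetI)
  fix Z assume "Z \<in> leaf_tangent F (snd c y)"
  then obtain c' y' v w where c': "c' \<in> charts F" "y' \<in> fst c'" "snd c' y' = snd c y"
    and Z: "Z = (\<lambda>f. \<Sum>a<m. v a * vec_dz F c' a y' f + w a * vec_dzbar F c' a y' f)"
    unfolding leaf_tangent_def mem_Collect_eq by (elim bexE conjE exE) (rule that)
  have "Z = vecof F c' y' (v, w)" by (simp add: vecof_def Z)
  also have "\<dots> = vecof F c y (change c' c y' (v, w))"
    using vecof_change[OF c'(1) c overlapI(1)[OF c c'(2) y c'(3)]] overlapI(2)[OF c c'(2) y c'(3)] by simp
  finally show "Z \<in> range (vecof F c y)" by simp
next
  fix Z assume "Z \<in> range (vecof F c y)"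
  then obtain v where "Z = vecof F c y v" by (rule rangeE)
  then show "Z \<in> leaf_tangent F (snd c y)"
    unfolding leaf_tangent_def mem_Collect_eq vecof_def
    by (intro bexI[OF _ c] bexI[OF _ y] conjI refl exI[of _ "fst v"] exI[of _ "snd v"])
qed

lemma map_vecof:
  assumes "c \<in> charts F" "y \<in> fst c" "set Xs \<subseteq> leaf_tangent F (snd c y)"
  obtains vs where "Xs = map (vecof F c y) vs"
proof -
  have "\<forall>Z\<in>set Xs. \<exists>v. Z = vecof F c y v"
  proof
    fix Z assume "Z \<in> set Xs"
    then have "Z \<in> range (vecof F c y)" using assms(3) unfolding leaf_tangent_eq[OF assms(1,2)] by blast
    then obtain v where "Z = vecof F c y v" by (rule rangeE)
    then show "\<exists>v. Z = vecof F c y v" by (rule exI)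
  qed
  then have "\<exists>vs. Xs = map (vecof F c y) vs" by (rule iffD2[OF ex_map_conv])
  then obtain vs where "Xs = map (vecof F c y) vs" by (rule exE)
  then show thesis by (rule that)
qed

text \<open>Tangent vectors take the default value 0 on functions that are not smooth near the base
  point, so \<open>cov_dz\<close> and \<open>cov_dzbar\<close> can be computed once the coordinate
  functions are known to be smooth there.\<close>

lemma smooth_near_coordinate:
  assumes c: "c \<in> charts F" and x: "x \<in> chart_image c" and a: "a < m"
  shows "smooth_near F x (\<lambda>x. fst (adapted c x) a)" "smooth_near F x (\<lambda>x. cnj (fst (adapted c x) a))"
proof -
  have e: "{y \<in> fst c'. snd c' y \<in> chart_image c} = overlap c' c" for c' by (simp add: overlap_def)
  have s: "smooth_on m n (overlap c' c) (\<lambda>y. fst (transition c' c y) a)" if "c' \<in> charts F" for c'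
    by (rule transition_facts(1)[OF that c a])
  show "smooth_near F x (\<lambda>x. fst (adapted c x) a)"
    unfolding smooth_near_def
    by (rule exI[of _ "chart_image c"]) (use s chart_facts(2)[OF c] x in \<open>simp add: e o_def transition_def\<close>)
  show "smooth_near F x (\<lambda>x. cnj (fst (adapted c x) a))"
    unfolding smooth_near_def
    by (rule exI[of _ "chart_image c"])
       (use smooth_on_cnj[OF overlap_open[OF _ c] s] chart_facts(2)[OF c] x in \<open>simp add: e o_def transition_def\<close>)
qed

lemma cov_vecof:
  assumes c: "c \<in> charts F" "c' \<in> charts F" and y: "y \<in> overlap c c'" and a: "a < m"
  shows "cov_dz c' a (vecof F c y v) = lform m (\<lambda>y. fst (transition c c' y) a) y v"
    "cov_dzbar c' a (vecof F c y v) = lform m (\<lambda>y. cnj (fst (transition c c' y) a)) y v"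
  using smooth_near_coordinate[OF c(2) _ a, of "snd c y"] y
  by (simp_all add: cov_dz_def cov_dzbar_def vecof_apply overlap_def transition_def o_def)

text \<open>The form \<open>dz\<^sup>A \<and> dzbar\<^sup>B\<close> of the chart \<open>c'\<close>,
  expressed in the frame of \<open>c\<close>.\<close>

definition trans_basis :: "'a chart \<Rightarrow> 'a chart \<Rightarrow> nat set \<Rightarrow> nat set \<Rightarrow> model \<Rightarrow> lvec list \<Rightarrow> complex" where
  "trans_basis c c' A B y = wedge_list (map (\<lambda>\<alpha>. \<alpha> y)
     (map (\<lambda>a y v. lform m (\<lambda>y. fst (transition c c' y) a) y v) (sorted_list_of_set A) @
      map (\<lambda>b y v. lform m (\<lambda>y. cnj (fst (transition c c' y) b)) y v) (sorted_list_of_set B)))"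

lemma basis_vecof:
  assumes c: "c \<in> charts F" "c' \<in> charts F" and y: "y \<in> overlap c c'" and A: "A \<in> mi m p" and B: "B \<in> mi m q"
  shows "dzA_dzbarB c' A B (map (vecof F c y) vs) = trans_basis c c' A B y vs"
proof -
  have "a < m" if "a \<in> A \<union> B" for a using that A B by (auto simp: mi_def)
  then show ?thesis
    unfolding dzA_dzbarB_def wedge_list_map trans_basis_def map_append map_map
    using mi_finite[OF A] mi_finite[OF B]
    by (intro arg_cong[where f = "\<lambda>l. wedge_list l vs"] arg_cong2[where f = "(@)"] map_cong refl)
       (simp_all add: fun_eq_iff cov_vecof[OF c y])
qed

lemma lform_coordinate:
  assumes "a < m"
  shows "lform m (\<lambda>y. fst y a) y v = fst v a" "lform m (\<lambda>y. cnj (fst y a)) y v = snd v a"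
proof -
  have "dd \<sigma> b (\<lambda>y. cnj (fst y a)) y = cnj (dd (cnj \<sigma>) b (\<lambda>y. fst y a) y)" if "b < m" for b \<sigma>
  proof -
    have "dd \<sigma> b (\<lambda>y. cnj (fst y a)) y = (pderiv_at (ReZ b) (\<lambda>y. cnj (fst y a)) y + \<sigma> * pderiv_at (ImZ b) (\<lambda>y. cnj (fst y a)) y) / 2"
      by (simp add: dd_def)
    have p: "has_pderiv k (\<lambda>y. fst y a) y (pderiv_at k (\<lambda>y. fst y a) y)" for k
    proof -
      have "(\<lambda>s. fst (shift k s y) a) = (\<lambda>s. fst y a + of_real s * (if k = ReZ a then 1 else if k = ImZ a then \<i> else 0))"
        by (cases y; cases k) auto
      then have "has_pderiv k (\<lambda>y. fst y a) y (if k = ReZ a then 1 else if k = ImZ a then \<i> else 0)"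
        by (auto simp: has_pderiv_def intro!: derivative_eq_intros)
      then show ?thesis using has_pderiv_imp by metis
    qed
    have "pderiv_at k (\<lambda>y. cnj (fst y a)) y = cnj (pderiv_at k (\<lambda>y. fst y a) y)" for k
      by (rule has_pderiv_imp[OF has_pderiv_linear[OF bounded_linear_cnj p]])
    then show ?thesis by (simp add: dd_def)
  qed
  then show "lform m (\<lambda>y. cnj (fst y a)) y v = snd v a"
    using assms by (simp add: lform_def dd_fst if_distrib[of "\<lambda>x. _ * x"] if_distrib[of cnj] cong: if_cong)
  show "lform m (\<lambda>y. fst y a) y v = fst v a"
    using assms by (simp add: lform_def dd_fst if_distrib[of "\<lambda>x. _ * x"] cong: if_cong)
qed

lemma transition_self: "c \<in> charts F \<Longrightarrow> y \<in> fst c \<Longrightarrow> transition c c y = y"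
  by (simp add: transition_def adapted_snd)

lemma basis_vecof_self:
  assumes c: "c \<in> charts F" and y: "y \<in> fst c" and A: "A \<in> mi m p" and B: "B \<in> mi m q"
  shows "dzA_dzbarB c A B (map (vecof F c y) vs) = basisV A B vs"
proof -
  have o: "y \<in> overlap c c" using y by (simp add: overlap_def chart_imageI)
  have l: "a < m" if "a \<in> A \<union> B" for a using that A B by (auto simp: mi_def)
  have "lform m (\<lambda>y. fst (transition c c y) a) y v = fst v a" if "a < m" for a v
    using lform_cong[OF chart_open[OF c] y, of "\<lambda>y. fst (transition c c y) a" "\<lambda>y. fst y a" v]
      transition_self[OF c] lform_coordinate(1)[OF that] by simp
  moreover have "lform m (\<lambda>y. cnj (fst (transition c c y) a)) y v = snd v a" if "a < m" for a v
    using lform_cong[OF chart_open[OF c] y, of "\<lambda>y. cnj (fst (transition c c y) a)" "\<lambda>y. cnj (fst y a)" v]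
      transition_self[OF c] lform_coordinate(2)[OF that] by simp
  ultimately show ?thesis
    unfolding basis_vecof[OF c c o A B] trans_basis_def basisV_def map_append map_map
    using mi_finite[OF A] mi_finite[OF B] l
    by (intro arg_cong[where f = "\<lambda>l. wedge_list l vs"] arg_cong2[where f = "(@)"] map_cong refl)
       (simp_all add: fun_eq_iff)
qed

text \<open>Each factor is closed, the \<open>dz\<close> because the coordinate change is
  holomorphic along the leaves, the \<open>dzbar\<close> because its conjugate is antiholomorphic;
  the product inherits this.\<close>

lemma trans_basis_closed:
  assumes c: "c \<in> charts F" "c' \<in> charts F" and A: "A \<in> mi m p" and B: "B \<in> mi m q"
  shows "smooth_on m n (overlap c c') (\<lambda>y. trans_basis c c' A B y vs)"
    "y \<in> overlap c c' \<Longrightarrow> chart_d m (trans_basis c c' A B) y vs = 0"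
proof -
  note S = overlap_open[OF c]
  have sA: "a < m" if "a \<in> set (sorted_list_of_set A)" for a using that A mi_finite[OF A] by (auto simp: mi_def)
  have sB: "a < m" if "a \<in> set (sorted_list_of_set B)" for a using that B mi_finite[OF B] by (auto simp: mi_def)
  note sm = transition_facts(1)[OF c]
  define \<alpha>s where "\<alpha>s = map (\<lambda>a y v. lform m (\<lambda>y. fst (transition c c' y) a) y v) (sorted_list_of_set A) @
      map (\<lambda>b y v. lform m (\<lambda>y. cnj (fst (transition c c' y) b)) y v) (sorted_list_of_set B)"
  have 1: "smooth_on m n (overlap c c') (\<lambda>y. \<alpha> y v)" if "\<alpha> \<in> set \<alpha>s" for \<alpha> v
    using that sA sB sm by (auto simp: \<alpha>s_def intro!: smooth_on_lform[OF S] smooth_on_cnj[OF S])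
  have e: "trans_basis c c' A B = (\<lambda>y. wedge_list (map (\<lambda>\<alpha>. \<alpha> y) \<alpha>s))"
    by (rule ext) (simp add: trans_basis_def \<alpha>s_def)
  show "smooth_on m n (overlap c c') (\<lambda>y. trans_basis c c' A B y vs)"
    unfolding e by (rule smooth_on_wedge_list[OF S]) (rule 1)
  assume y: "y \<in> overlap c c'"
  have 2: "dbv m u (\<lambda>y. \<alpha> y v) y = dbv m v (\<lambda>y. \<alpha> y u) y" if "\<alpha> \<in> set \<alpha>s" for \<alpha> u v
  proof -
    have "(\<exists>a\<in>set (sorted_list_of_set A). \<alpha> = (\<lambda>y v. lform m (\<lambda>y. fst (transition c c' y) a) y v)) \<or>
      (\<exists>a\<in>set (sorted_list_of_set B). \<alpha> = (\<lambda>y v. lform m (\<lambda>y. cnj (fst (transition c c' y) a)) y v))"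
      using that unfolding \<alpha>s_def set_append set_map by blast
    then consider a where "a < m" "\<alpha> = (\<lambda>y v. lform m (\<lambda>y. fst (transition c c' y) a) y v)"
      | a where "a < m" "\<alpha> = (\<lambda>y v. lform m (\<lambda>y. cnj (fst (transition c c' y) a)) y v)"
      using sA sB by blast
    then show ?thesis
    proof cases
      case 1
      have "dbv m u (\<lambda>y. lform m (\<lambda>y. fst (transition c c' y) a) y v) y = 0" for u v
        by (rule dbv_lform_holomorphic[OF S y sm[OF 1(1)]]) (rule transition_holomorphic[OF c _ 1(1)])
      then show ?thesis using 1(2) by simp
    next
      case 2
      show ?thesis unfolding 2(2)
        by (rule dbv_lform_antiholomorphic[OF S y smooth_on_cnj[OF S sm[OF 2(1)]]]) (rule transition_cnj[OF c _ 2(1)])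
    qed
  qed
  show "chart_d m (trans_basis c c' A B) y vs = 0"
    unfolding e by (rule chart_d_wedge_list[OF S y]) (rule 1 2; assumption)+
qed

end

section \<open>Chart expressions of foliated forms\<close>

lemma wedge1_map: "wedge1 \<alpha> \<omega> (map h vs) = wedge1 (\<lambda>v. \<alpha> (h v)) (\<lambda>r. \<omega> (map h r)) vs"
  by (simp add: wedge1_eq alt_sum_map)

lemma local_form_coefficients:
  assumes \<omega>: "local_form m n p q S \<omega>" and y: "y \<in> S"
  shows "\<omega> y vs = (\<Sum>A\<in>mi m p. \<Sum>B\<in>mi m q. \<omega> y (frameV A B) * basisV A B vs)"
proof -
  obtain g where g: "\<And>A B. A \<in> mi m p \<Longrightarrow> B \<in> mi m q \<Longrightarrow> smooth_on m n S (g A B)"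
    "\<And>y vs. y \<in> S \<Longrightarrow> \<omega> y vs = (\<Sum>A\<in>mi m p. \<Sum>B\<in>mi m q. g A B y * basisV A B vs)"
    by (rule local_formE[OF \<omega>]) (rule that)
  have "\<omega> y (frameV A B) = g A B y" if AB: "A \<in> mi m p" "B \<in> mi m q" for A B
  proof -
    have "\<omega> y (frameV A B) = (\<Sum>A'\<in>mi m p. \<Sum>B'\<in>mi m q. g A' B' y * basisV A' B' (frameV A B))"
      by (rule g(2)[OF y])
    also have "\<dots> = (\<Sum>A'\<in>mi m p. \<Sum>B'\<in>mi m q. if B' = B then if A' = A then g A B y else 0 else 0)"
      by (intro sum.cong refl) (simp add: basisV_frameV[OF _ _ AB])
    finally show ?thesis using AB by simp
  qed
  then show ?thesis unfolding g(2)[OF y, of vs] by simp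
qed

lemma twisted_d_add:
  assumes S: "model_open m n S" and y: "y \<in> S"
    and "\<And>r. smooth_on m n S (\<lambda>y. \<omega> y r)" "\<And>r. smooth_on m n S (\<lambda>y. \<omega>' y r)"
  shows "twisted_d m k f (\<lambda>y r. \<omega> y r + \<omega>' y r) y vs = twisted_d m k f \<omega> y vs + twisted_d m k f \<omega>' y vs"
proof -
  have "chart_d m (\<lambda>y r. \<omega> y r + \<omega>' y r) y vs = chart_d m \<omega> y vs + chart_d m \<omega>' y vs"
    unfolding chart_d_def alt_sum_add[symmetric] by (rule alt_sum_cong, rule dbv_add[OF assms(3,4) y])
  then show ?thesis by (simp add: twisted_d_def wedge1_eq distrib_left alt_sum_add algebra_simps)
qed

lemma twisted_d_cmult:
  assumes S: "model_open m n S" and y: "y \<in> S" and "\<And>r. smooth_on m n S (\<lambda>y. \<omega> y r)"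
  shows "twisted_d m k f (\<lambda>y r. c * \<omega> y r) y vs = c * twisted_d m k f \<omega> y vs"
proof -
  have "chart_d m (\<lambda>y r. c * \<omega> y r) y vs = c * chart_d m \<omega> y vs"
    unfolding chart_d_def alt_sum_cmult[symmetric] by (rule alt_sum_cong, rule dbv_cmult[OF assms(3) y])
  then show ?thesis by (simp add: twisted_d_def wedge1_cmult algebra_simps)
qed

section \<open>Foliated forms over an open subset\<close>

context complex_fol
begin

definition supported :: "'a set \<Rightarrow> 'a cform \<Rightarrow> bool" where
  "supported W \<phi> \<longleftrightarrow> (\<forall>x Xs. \<not> (x \<in> W \<and> set Xs \<subseteq> leaf_tangent F x) \<longrightarrow> \<phi> x Xs = 0)"

text \<open>The neighbourhood may be any relatively open set inside the chart and over
  \<open>W\<close>, so that neighbourhoods can be intersected.\<close>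

definition locally_form :: "nat \<Rightarrow> nat \<Rightarrow> 'a set \<Rightarrow> 'a cform \<Rightarrow> 'a chart \<Rightarrow> model \<Rightarrow> bool" where
  "locally_form p q W \<phi> c y \<longleftrightarrow> (\<exists>S. model_open m n S \<and> y \<in> S \<and> S \<subseteq> {y \<in> fst c. snd c y \<in> W} \<and>
     local_form m n p q S (pull F c \<phi>))"

text \<open>Refers to the charts of \<open>F\<close> only, with the vanishing convention of
  \<open>foliated_forms\<close>. For open \<open>W\<close> these are the foliated forms of the
  restricted foliation (\<open>foliated_forms_restrict\<close>).\<close>

definition Frm :: "'a set \<Rightarrow> nat \<Rightarrow> nat \<Rightarrow> 'a cform set" where
  "Frm W p q = {\<phi>. supported W \<phi> \<and> (\<forall>c\<in>charts F. \<forall>y\<in>fst c. snd c y \<in> W \<longrightarrow> locally_form p q W \<phi> c y)}"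

lemma FrmD:
  assumes "\<phi> \<in> Frm W p q"
  shows "supported W \<phi>" "c \<in> charts F \<Longrightarrow> y \<in> fst c \<Longrightarrow> snd c y \<in> W \<Longrightarrow> locally_form p q W \<phi> c y"
  using assms by (simp_all add: Frm_def)

lemma FrmI:
  assumes "supported W \<phi>"
    "\<And>c y. c \<in> charts F \<Longrightarrow> y \<in> fst c \<Longrightarrow> snd c y \<in> W \<Longrightarrow> locally_form p q W \<phi> c y"
  shows "\<phi> \<in> Frm W p q"
  using assms by (simp add: Frm_def)

lemma locally_formE:
  assumes "locally_form p q W \<phi> c y"
  obtains S where "model_open m n S" "y \<in> S" "S \<subseteq> {y \<in> fst c. snd c y \<in> W}" "local_form m n p q S (pull F c \<phi>)"
  using assms unfolding locally_form_def by (elim exE conjE) (rule that)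

lemma locally_formI:
  "model_open m n S \<Longrightarrow> y \<in> S \<Longrightarrow> S \<subseteq> {y \<in> fst c. snd c y \<in> W} \<Longrightarrow> local_form m n p q S (pull F c \<phi>) \<Longrightarrow>
    locally_form p q W \<phi> c y"
  unfolding locally_form_def by (rule exI[of _ S]) simp

lemma supportedD: "supported W \<phi> \<Longrightarrow> \<not> (x \<in> W \<and> set Xs \<subseteq> leaf_tangent F x) \<Longrightarrow> \<phi> x Xs = 0"
  unfolding supported_def by blast

lemma form_eqI:
  assumes "supported W \<phi>" "supported W \<psi>" and W: "W \<subseteq> topspace X"
    and e: "\<And>c y vs. c \<in> charts F \<Longrightarrow> y \<in> fst c \<Longrightarrow> snd c y \<in> W \<Longrightarrow> pull F c \<phi> y vs = pull F c \<psi> y vs"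
  shows "\<phi> = \<psi>"
proof (intro ext)
  fix x Xs
  show "\<phi> x Xs = \<psi> x Xs"
  proof (cases "x \<in> W \<and> set Xs \<subseteq> leaf_tangent F x")
    case True
    then obtain c y where c: "c \<in> charts F" "y \<in> fst c" "snd c y = x"
      using obtain_chart W by blast
    then obtain vs where "Xs = map (vecof F c y) vs" using map_vecof[OF c(1,2)] True by metis
    then show ?thesis using e[OF c(1,2), of vs] c(3) True by (simp add: pull_def)
  next
    case False
    then show ?thesis using supportedD[OF assms(1)] supportedD[OF assms(2)] by metis
  qed
qed

lemma vec_eq_vecof:
  assumes "a < m"
  shows "vec_dz F c a y = vecof F c y (\<lambda>b. if b = a then 1 else 0, \<lambda>b. 0)"
    "vec_dzbar F c a y = vecof F c y (\<lambda>b. 0, \<lambda>b. if b = a then 1 else 0)"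
  using assms by (simp_all add: vecof_def fun_eq_iff if_distrib[of "\<lambda>x. x * _"] cong: if_cong)

lemma coefficient_eq_pull:
  assumes "A \<in> mi m p" "B \<in> mi m q"
  shows "coefficient F c \<phi> A B y = pull F c \<phi> y (frameV A B)"
proof -
  have l: "a < m" if "a \<in> A \<union> B" for a using that assms by (auto simp: mi_def)
  have "map (\<lambda>a. vec_dz F c a y) (sorted_list_of_set A) @ map (\<lambda>b. vec_dzbar F c b y) (sorted_list_of_set B) =
    map (vecof F c y) (frameV A B)"
    unfolding frameV_def map_append map_map
    using mi_finite[OF assms(1)] mi_finite[OF assms(2)] l
    by (intro arg_cong2[where f = "(@)"] map_cong refl) (simp_all add: vec_eq_vecof)
  then show ?thesis by (simp add: coefficient_def pull_def)
qed

lemma set_map_vecof: "c \<in> charts F \<Longrightarrow> y \<in> fst c \<Longrightarrow> set (map (vecof F c y) vs) \<subseteq> leaf_tangent F (snd c y)"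
  unfolding leaf_tangent_eq by auto

lemma fst_subset: "c \<in> charts F \<Longrightarrow> fst c \<subseteq> {y \<in> fst c. snd c y \<in> topspace X}"
  using chart_in_space by blast

text \<open>The coefficients of a local expression are its values on the frame, so the local
  expressions patch together to smooth coefficients on the whole chart.\<close>

lemma foliated_forms_eq: "foliated_forms F p q = Frm (topspace X) p q"
proof (rule equalityI; rule subsetI)
  fix \<phi> assume "\<phi> \<in> foliated_forms F p q"
  then have s: "\<forall>x Xs. \<not> (x \<in> topspace X \<and> set Xs \<subseteq> leaf_tangent F x) \<longrightarrow> \<phi> x Xs = 0"
    and c: "\<And>c. c \<in> charts F \<Longrightarrow> (\<forall>A\<in>mi m p. \<forall>B\<in>mi m q. smooth_on m n (fst c) (coefficient F c \<phi> A B)) \<and>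
            (\<forall>y\<in>fst c. \<forall>Xs. set Xs \<subseteq> leaf_tangent F (snd c y) \<longrightarrow>
               \<phi> (snd c y) Xs = (\<Sum>A\<in>mi m p. \<Sum>B\<in>mi m q. coefficient F c \<phi> A B y * dzA_dzbarB c A B Xs))"
    unfolding foliated_forms_def mindex_eq by simp_all
  show "\<phi> \<in> Frm (topspace X) p q"
  proof (rule FrmI)
    show "supported (topspace X) \<phi>" using s by (simp add: supported_def)
    fix c y assume cy: "c \<in> charts F" "y \<in> fst c" "snd c y \<in> topspace X"
    have "local_form m n p q (fst c) (pull F c \<phi>)"
    proof (rule local_formI[of _ _ _ _ _ "coefficient F c \<phi>"])
      fix A B assume "A \<in> mi m p" "B \<in> mi m q"
      then show "smooth_on m n (fst c) (coefficient F c \<phi> A B)" using c[OF cy(1)] by simp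
    next
      fix y vs assume y: "y \<in> fst c"
      have "pull F c \<phi> y vs = (\<Sum>A\<in>mi m p. \<Sum>B\<in>mi m q. coefficient F c \<phi> A B y * dzA_dzbarB c A B (map (vecof F c y) vs))"
        unfolding pull_def using c[OF cy(1), THEN conjunct2, THEN bspec, OF y] set_map_vecof[OF cy(1) y] by blast
      then show "pull F c \<phi> y vs = (\<Sum>A\<in>mi m p. \<Sum>B\<in>mi m q. coefficient F c \<phi> A B y * basisV A B vs)"
        using basis_vecof_self[OF cy(1) y] by simp
    qed
    then show "locally_form p q (topspace X) \<phi> c y"
      by (rule locally_formI[OF chart_open[OF cy(1)] cy(2) fst_subset[OF cy(1)]])
  qed
next
  fix \<phi> assume \<phi>: "\<phi> \<in> Frm (topspace X) p q"
  have "smooth_on m n (fst c) (coefficient F c \<phi> A B)" if c: "c \<in> charts F" and AB: "A \<in> mi m p" "B \<in> mi m q" for c A B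
  proof (rule smooth_on_local[OF _ model_open_imp_subset[OF chart_open[OF c]]])
    fix y assume y: "y \<in> fst c"
    obtain S where S: "model_open m n S" "y \<in> S" "S \<subseteq> {y \<in> fst c. snd c y \<in> topspace X}" "local_form m n p q S (pull F c \<phi>)"
      by (rule locally_formE[OF FrmD(2)[OF \<phi> c y chart_in_space[OF c y]]]) (rule that)
    have "smooth_on m n S (\<lambda>y. pull F c \<phi> y (frameV A B))" by (rule local_form_smooth[OF S(1,4)])
    then have "smooth_on m n S (coefficient F c \<phi> A B)" by (simp add: coefficient_eq_pull[OF AB, abs_def])
    then show "\<exists>S'. model_open m n S' \<and> y \<in> S' \<and> smooth_on m n S' (coefficient F c \<phi> A B)"
      using S(1,2) by (intro exI[of _ S] conjI)
  qed
  moreover have "\<phi> (snd c y) Xs = (\<Sum>A\<in>mi m p. \<Sum>B\<in>mi m q. coefficient F c \<phi> A B y * dzA_dzbarB c A B Xs)"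
    if c: "c \<in> charts F" and y: "y \<in> fst c" and Xs: "set Xs \<subseteq> leaf_tangent F (snd c y)" for c y Xs
  proof -
    obtain vs where vs: "Xs = map (vecof F c y) vs" by (rule map_vecof[OF c y Xs]) (rule that)
    obtain S where S: "model_open m n S" "y \<in> S" "S \<subseteq> {y \<in> fst c. snd c y \<in> topspace X}" "local_form m n p q S (pull F c \<phi>)"
      by (rule locally_formE[OF FrmD(2)[OF \<phi> c y chart_in_space[OF c y]]]) (rule that)
    have "pull F c \<phi> y vs = (\<Sum>A\<in>mi m p. \<Sum>B\<in>mi m q. pull F c \<phi> y (frameV A B) * basisV A B vs)"
      by (rule local_form_coefficients[OF S(4,2)])
    also have "\<dots> = (\<Sum>A\<in>mi m p. \<Sum>B\<in>mi m q. coefficient F c \<phi> A B y * dzA_dzbarB c A B Xs)"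
      unfolding vs by (intro sum.cong refl) (simp add: coefficient_eq_pull basis_vecof_self[OF c y])
    finally show ?thesis by (simp add: pull_def vs)
  qed
  ultimately show "\<phi> \<in> foliated_forms F p q"
    using FrmD(1)[OF \<phi>] unfolding foliated_forms_def mindex_eq supported_def by simp
qed

text \<open>The terms with \<open>\<partial>g/\<partial>z\<^sup>b\<close> drop out because the new
  coordinates are holomorphic; what remains is expressed by the conjugate covectors of
  \<open>c'\<close>.\<close>

lemma dbv_transition:
  assumes c: "c \<in> charts F" "c' \<in> charts F" and g: "smooth_on m n (fst c') g" and y: "y \<in> overlap c c'"
  shows "dbv m v (\<lambda>y. g (transition c c' y)) y =
    (\<Sum>b<m. dd \<i> b g (transition c c' y) * lform m (\<lambda>y. cnj (fst (transition c c' y) b)) y v)"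
proof -
  have g': "smooth_on m n {y \<in> fst c'. snd c' y \<in> topspace X} g"
    by (rule smooth_on_subset[OF g]) simp
  have yt: "snd c y \<in> topspace X" by (rule chart_in_space[OF c(1) overlapD(1)[OF y]])
  have "dd \<i> a (\<lambda>y. g (transition c c' y)) y =
     (\<Sum>b<m. dd \<i> b g (transition c c' y) * dd \<i> a (\<lambda>y. cnj (fst (transition c c' y) b)) y)" if "a < m" for a
    unfolding dd_transition[OF c openin_topspace g' y yt that]
    by (intro sum.cong refl) (simp add: transition_holomorphic[OF c y _ that])
  then have "dbv m v (\<lambda>y. g (transition c c' y)) y =
     (\<Sum>a<m. \<Sum>b<m. dd \<i> b g (transition c c' y) * (snd v a * dd \<i> a (\<lambda>y. cnj (fst (transition c c' y) b)) y))"
    unfolding dbv_def by (intro sum.cong refl) (simp add: sum_distrib_left mult.left_commute)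
  also have "\<dots> = (\<Sum>b<m. dd \<i> b g (transition c c' y) * dbv m v (\<lambda>y. cnj (fst (transition c c' y) b)) y)"
    by (subst sum.swap) (simp only: dbv_def sum_distrib_left)
  also have "\<dots> = (\<Sum>b<m. dd \<i> b g (transition c c' y) * lform m (\<lambda>y. cnj (fst (transition c c' y) b)) y v)"
    by (intro sum.cong refl arg_cong2[where f = "(*)"] dbv_eq_lform transition_cnj[OF c y]) auto
  finally show ?thesis .
qed

text \<open>In the coordinate frame of a chart, \<open>\<partial>bar\<close> is given by a formula that makes sense for any
  family of functionals; it is a derivation and kills \<open>dz\<^sup>A \<and> dzbar\<^sup>B\<close> of every other chart, so
  the chart chosen in the definition of \<open>\<partial>bar\<close> is irrelevant.\<close>

lemma pull_dbar:
  assumes \<phi>: "\<phi> \<in> foliated_forms F p q" and c: "c \<in> charts F" and y: "y \<in> fst c"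
  shows "pull F c (dbar F p q \<phi>) y vs = chart_d m (pull F c \<phi>) y vs"
proof -
  \<comment> \<open>This is the chart selected in the definition of \<open>dbar\<close>, so the
    coordinate formula there is evaluated in \<open>c'\<close>.\<close>
  define c' where "c' = (SOME c'. c' \<in> charts F \<and> snd c y \<in> chart_image c')"
  have "c' \<in> charts F \<and> snd c y \<in> chart_image c'"
    unfolding c'_def by (rule someI[of _ c]) (simp add: c chart_imageI[OF y])
  then have cc: "c \<in> charts F" "c' \<in> charts F" and o: "y \<in> overlap c c'"
    using c y by (simp_all add: overlap_def)
  have \<phi>': "(\<forall>A\<in>mi m p. \<forall>B\<in>mi m q. smooth_on m n (fst c') (coefficient F c' \<phi> A B)) \<and>
            (\<forall>y\<in>fst c'. \<forall>Xs. set Xs \<subseteq> leaf_tangent F (snd c' y) \<longrightarrow>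
               \<phi> (snd c' y) Xs = (\<Sum>A\<in>mi m p. \<Sum>B\<in>mi m q. coefficient F c' \<phi> A B y * dzA_dzbarB c' A B Xs))"
    using \<phi> cc(2) unfolding foliated_forms_def mindex_eq by simp
  define g where "g = (\<lambda>A B y. coefficient F c' \<phi> A B (transition c c' y))"
  have sm: "smooth_on m n (fst c') (coefficient F c' \<phi> A B)" if "A \<in> mi m p" "B \<in> mi m q" for A B
    using \<phi>'[THEN conjunct1] that by blast
  have ex: "pull F c \<phi> y vs = (\<Sum>A\<in>mi m p. \<Sum>B\<in>mi m q. g A B y * trans_basis c c' A B y vs)"
    if y: "y \<in> overlap c c'" for y vs
  proof -
    note o = overlapD[OF y]
    have "\<phi> (snd c' (transition c c' y)) (map (vecof F c y) vs) =
      (\<Sum>A\<in>mi m p. \<Sum>B\<in>mi m q. coefficient F c' \<phi> A B (transition c c' y) * dzA_dzbarB c' A B (map (vecof F c y) vs))"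
      using \<phi>'[THEN conjunct2, THEN bspec, OF o(2)] set_map_vecof[OF cc(1) o(1), of vs] unfolding o(3) by blast
    then show ?thesis using basis_vecof[OF cc y] by (simp add: pull_def o(3) g_def)
  qed
  \<comment> \<open>The coefficients are those of \<open>c'\<close>, transported to the domain of
    \<open>c\<close>; the derivative falls on them alone, since the transported basis is
    closed.\<close>
  have "chart_d m (pull F c \<phi>) y vs = (\<Sum>A\<in>mi m p. \<Sum>B\<in>mi m q. wedge1 (\<lambda>v. dbv m v (g A B) y) (trans_basis c c' A B y) vs)"
  proof (rule local_form_expand_d[OF overlap_open[OF cc] o])
    fix A B assume AB: "A \<in> mi m p" "B \<in> mi m q"
    show "smooth_on m n (overlap c c') (g A B)" unfolding g_def by (rule transition_smooth_compose[OF cc sm[OF AB]])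
    show "smooth_on m n (overlap c c') (\<lambda>y. trans_basis c c' A B y r)" for r by (rule trans_basis_closed(1)[OF cc AB])
    show "chart_d m (trans_basis c c' A B) y vs = 0" by (rule trans_basis_closed(2)[OF cc AB o])
  qed (rule ex)
  also have "\<dots> = (\<Sum>A\<in>mi m p. \<Sum>B\<in>mi m q. \<Sum>a<m. dd \<i> a (coefficient F c' \<phi> A B) (transition c c' y) *
      wedge1 (lform m (\<lambda>y. cnj (fst (transition c c' y) a)) y) (trans_basis c c' A B y) vs)"
  proof (intro sum.cong refl)
    fix A B assume AB: "A \<in> mi m p" "B \<in> mi m q"
    have "(\<lambda>v. dbv m v (g A B) y) = (\<lambda>v. \<Sum>b<m. dd \<i> b (coefficient F c' \<phi> A B) (transition c c' y) *
        lform m (\<lambda>y. cnj (fst (transition c c' y) b)) y v)"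
      unfolding g_def by (rule ext) (rule dbv_transition[OF cc sm[OF AB] o])
    then show "wedge1 (\<lambda>v. dbv m v (g A B) y) (trans_basis c c' A B y) vs =
      (\<Sum>a<m. dd \<i> a (coefficient F c' \<phi> A B) (transition c c' y) *
      wedge1 (lform m (\<lambda>y. cnj (fst (transition c c' y) a)) y) (trans_basis c c' A B y) vs)"
      by (simp only: wedge1_sum_left wedge1_cmult_left)
  qed
  also have "\<dots> = (\<Sum>A\<in>mi m p. \<Sum>a<m. \<Sum>B\<in>mi m q. dd \<i> a (coefficient F c' \<phi> A B) (transition c c' y) *
      wedge1 (lform m (\<lambda>y. cnj (fst (transition c c' y) a)) y) (trans_basis c c' A B y) vs)"
    by (intro sum.cong refl sum.swap)
  also have "\<dots> = (\<Sum>a<m. \<Sum>A\<in>mi m p. \<Sum>B\<in>mi m q. dd \<i> a (coefficient F c' \<phi> A B) (transition c c' y) *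
      wedge1 (lform m (\<lambda>y. cnj (fst (transition c c' y) a)) y) (trans_basis c c' A B y) vs)"
    by (rule sum.swap)
  also have "\<dots> = dbar_in_chart F p q c' \<phi> (snd c y) (map (vecof F c y) vs)"
    unfolding dbar_in_chart_def mindex_eq d_dzbar_eq
  proof (intro sum.cong refl arg_cong2[where f = "(*)"])
    show "dd \<i> a (coefficient F c' \<phi> A B) (transition c c' y) = dd \<i> a (coefficient F c' \<phi> A B) (adapted c' (snd c y))" for a A B
      by (simp add: transition_def)
    fix a A B assume a: "a \<in> {..<m}" and AB: "A \<in> mi m p" "B \<in> mi m q"
    have "(\<lambda>v. cov_dzbar c' a (vecof F c y v)) = lform m (\<lambda>y. cnj (fst (transition c c' y) a)) y"
      using a by (intro ext cov_vecof(2)[OF cc o]) simp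
    moreover have "(\<lambda>r. dzA_dzbarB c' A B (map (vecof F c y) r)) = trans_basis c c' A B y"
      by (rule ext) (rule basis_vecof[OF cc o AB])
    ultimately show "wedge1 (lform m (\<lambda>y. cnj (fst (transition c c' y) a)) y) (trans_basis c c' A B y) vs =
      wedge1 (cov_dzbar c' a) (dzA_dzbarB c' A B) (map (vecof F c y) vs)"
      by (simp add: wedge1_map)
  qed
  also have "\<dots> = pull F c (dbar F p q \<phi>) y vs"
    using chart_in_space[OF c y] set_map_vecof[OF c y, of vs] by (simp add: pull_def dbar_def c'_def)
  finally show ?thesis by simp
qed

lemma pull_function_form:
  assumes c: "c \<in> charts F" and y: "y \<in> fst c"
  shows "pull F c (function_form F f) y vs = (if vs = [] then f (snd c y) else 0)"
  using chart_in_space[OF c y] by (simp add: pull_def function_form_def)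

lemma mi_0: "mi m' 0 = {{}}"
  by (auto simp: mi_def dest: finite_subset)

lemma function_form_in:
  assumes f: "smooth_function F f"
  shows "function_form F f \<in> foliated_forms F 0 0"
  unfolding foliated_forms_eq
proof (rule FrmI)
  show "supported (topspace X) (function_form F f)" by (auto simp: supported_def function_form_def)
  fix c y assume c: "c \<in> charts F" "y \<in> fst c"
  have "local_form m n 0 0 (fst c) (pull F c (function_form F f))"
  proof (rule local_formI[of _ _ _ _ _ "\<lambda>A B. f \<circ> snd c"])
    show "smooth_on m n (fst c) (f \<circ> snd c)" using f c by (simp add: smooth_function_def)
  qed (simp add: pull_function_form[OF c(1)] mi_0 basisV_def wedge_list_Nil)
  then show "locally_form 0 0 (topspace X) (function_form F f) c y"
    by (rule locally_formI[OF chart_open[OF c(1)] c(2) fst_subset[OF c(1)]])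
qed

lemma dbar_function_form:
  assumes f: "smooth_function F f" and c: "c \<in> charts F" and y: "y \<in> fst c"
  shows "dbar F 0 0 (function_form F f) (snd c y) [vecof F c y v] = dbv m v (f \<circ> snd c) y"
proof -
  have "dbar F 0 0 (function_form F f) (snd c y) [vecof F c y v] = pull F c (dbar F 0 0 (function_form F f)) y [v]"
    by (simp add: pull_def)
  also have "\<dots> = chart_d m (pull F c (function_form F f)) y [v]"
    by (rule pull_dbar[OF function_form_in[OF f] c y])
  also have "\<dots> = dbv m v (\<lambda>y. pull F c (function_form F f) y []) y"
    by (simp add: chart_d_def alt_sum_Cons)
  also have "\<dots> = dbv m v (f \<circ> snd c) y"
    by (rule dbv_cong[OF chart_open[OF c] y]) (simp add: pull_function_form[OF c])
  finally show ?thesis .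
qed

text \<open>By \<open>form_eqI\<close> this determines \<open>d\<close> on \<open>Frm W p q\<close>.
  Statements about an abstract \<open>d\<close> then cover the differentials of \<open>F\<close> and
  of its restrictions alike.\<close>

definition is_d :: "'a set \<Rightarrow> ('a \<Rightarrow> complex) \<Rightarrow> nat \<Rightarrow> nat \<Rightarrow> ('a cform \<Rightarrow> 'a cform) \<Rightarrow> bool" where
  "is_d W f p q d \<longleftrightarrow> (\<forall>\<phi>\<in>Frm W p q. supported W (d \<phi>) \<and>
     (\<forall>c\<in>charts F. \<forall>y\<in>fst c. snd c y \<in> W \<longrightarrow>
        pull F c (d \<phi>) y = twisted_d m (of_nat (p + q)) (f \<circ> snd c) (pull F c \<phi>) y))"

text \<open>\<open>wedge1\<close> evaluates the removed entry and the rest of the list separately;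
  if both consist of tangent vectors, so does the whole list.\<close>

lemma supported_dbar_f:
  assumes \<phi>: "supported (topspace X) \<phi>"
  shows "supported (topspace X) (dbar_f F f p q \<phi>)"
  unfolding supported_def
proof (intro allI impI)
  fix x Xs assume H: "\<not> (x \<in> topspace X \<and> set Xs \<subseteq> leaf_tangent F x)"
  have "wedge1 (\<lambda>Z. dbar F 0 0 (function_form F f) x [Z]) (\<phi> x) Xs = 0"
    unfolding wedge1_def
  proof (rule sum.neutral, rule ballI)
    fix i assume "i \<in> {..<length Xs}"
    then have i: "i < length Xs" by simp
    show "(-1) ^ i * dbar F 0 0 (function_form F f) x [Xs ! i] * \<phi> x (take i Xs @ drop (Suc i) Xs) = 0"
    proof (cases "x \<in> topspace X \<and> Xs ! i \<in> leaf_tangent F x")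
      case True
      have sub: "set Xs \<subseteq> insert (Xs ! i) (set (take i Xs @ drop (Suc i) Xs))"
        by (subst (1) id_take_nth_drop[OF i]) simp
      have "\<not> (x \<in> topspace X \<and> set (take i Xs @ drop (Suc i) Xs) \<subseteq> leaf_tangent F x)"
      proof
        assume "x \<in> topspace X \<and> set (take i Xs @ drop (Suc i) Xs) \<subseteq> leaf_tangent F x"
        then have "set Xs \<subseteq> leaf_tangent F x"
          using True by (intro subset_trans[OF sub insert_subsetI]) simp_all
        then show False using H True by blast
      qed
      from supportedD[OF \<phi> this] show ?thesis by simp
    next
      case False
      have "dbar F 0 0 (function_form F f) x [Xs ! i] = 0"
        unfolding dbar_def by (rule if_not_P) (use False in simp)
      then show ?thesis by simp
    qed
  qed
  moreover have "dbar F p q \<phi> x Xs = 0" unfolding dbar_def by (rule if_not_P[OF H])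
  ultimately show "dbar_f F f p q \<phi> x Xs = 0" by (simp add: dbar_f_def)
qed

lemma is_d_dbar_f:
  assumes f: "smooth_function F f"
  shows "is_d (topspace X) f p q (dbar_f F f p q)"
  unfolding is_d_def
proof (intro ballI conjI impI)
  fix \<phi> assume \<phi>: "\<phi> \<in> Frm (topspace X) p q"
  show "supported (topspace X) (dbar_f F f p q \<phi>)" by (rule supported_dbar_f[OF FrmD(1)[OF \<phi>]])
  fix c y assume c: "c \<in> charts F" and y: "y \<in> fst c"
  show "pull F c (dbar_f F f p q \<phi>) y = twisted_d m (of_nat (p + q)) (f \<circ> snd c) (pull F c \<phi>) y"
  proof
    fix vs
    have w: "wedge1 (\<lambda>Z. dbar F 0 0 (function_form F f) (snd c y) [Z]) (\<phi> (snd c y)) (map (vecof F c y) vs) =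
      wedge1 (\<lambda>v. dbv m v (f \<circ> snd c) y) (pull F c \<phi> y) vs"
      unfolding wedge1_map dbar_function_form[OF f c y] by (simp add: pull_def[abs_def])
    have "pull F c (dbar_f F f p q \<phi>) y vs = f (snd c y) * pull F c (dbar F p q \<phi>) y vs -
        of_nat (p + q) * wedge1 (\<lambda>Z. dbar F 0 0 (function_form F f) (snd c y) [Z]) (\<phi> (snd c y)) (map (vecof F c y) vs)"
      by (simp add: pull_def dbar_f_def)
    then show "pull F c (dbar_f F f p q \<phi>) y vs = twisted_d m (of_nat (p + q)) (f \<circ> snd c) (pull F c \<phi>) y vs"
      unfolding w pull_dbar[OF \<phi>[folded foliated_forms_eq] c y] by (simp add: twisted_d_def)
  qed
qed

end

section \<open>Restriction to open subsets\<close>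

context complex_fol
begin

lemma restrict_sel [simp]:
  "cdim (restrict_foliation F W) = m" "codim (restrict_foliation F W) = n"
  "mtop (restrict_foliation F W) = subtopology X W"
  by (simp_all add: restrict_foliation_def)

lemma restrict_chartD:
  assumes "c' \<in> charts (restrict_foliation F W)"
  obtains c where "c \<in> charts F" "snd c = snd c'" "fst c' \<subseteq> fst c" "disc_ball m n (fst c')" "chart_image c' \<subseteq> W"
proof -
  obtain E where E: "(E, snd c') \<in> charts F" "fst c' \<subseteq> E" "disc_ball m n (fst c')" "snd c' ` fst c' \<subseteq> W"
    using assms by (cases c') (auto simp: restrict_foliation_def)
  show thesis by (rule that[of "(E, snd c')"]) (use E in \<open>simp_all add: chart_image_def\<close>)
qed

lemma restrict_chartI:
  assumes "c \<in> charts F" "D \<subseteq> fst c" "disc_ball m n D" "snd c ` D \<subseteq> W"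
  shows "(D, snd c) \<in> charts (restrict_foliation F W)"
  using assms by (cases c) (auto simp: restrict_foliation_def)

lemma restrict_chart_inside:
  assumes c: "c \<in> charts F" and S: "model_open m n S" "y \<in> S" "S \<subseteq> {y \<in> fst c. snd c y \<in> W}"
  obtains D where "(D, snd c) \<in> charts (restrict_foliation F W)" "y \<in> D" "D \<subseteq> S"
proof -
  obtain D where D: "disc_ball m n D" "y \<in> D" "D \<subseteq> S" by (rule disc_ball_inside[OF S(1,2)]) (rule that)
  have "(D, snd c) \<in> charts (restrict_foliation F W)"
    by (rule restrict_chartI[OF c _ D(1)]) (use D(3) S(3) in blast)+
  then show thesis using D that by blast
qed

text \<open>\<open>adapted\<close> inverts a parametrization on its own domain; injectivity of the
  larger chart makes its inverse agree with that of the smaller one.\<close>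

lemma restrict_transition:
  assumes c: "c \<in> charts F" "c' \<in> charts F" and s: "snd d = snd c" "snd d' = snd c'"
    and sub: "fst d \<subseteq> fst c" "fst d' \<subseteq> fst c'"
  shows "overlap d d' \<subseteq> overlap c c'"
    "y \<in> overlap d d' \<Longrightarrow> transition d d' y = transition c c' y"
proof -
  show "overlap d d' \<subseteq> overlap c c'"
    unfolding overlap_def chart_image_def s using sub by blast
  assume "y \<in> overlap d d'"
  then have "snd c y \<in> snd c' ` fst d'" by (simp add: overlap_def chart_image_def s)
  then obtain y' where y': "y' \<in> fst d'" "snd c y = snd c' y'" by (rule imageE)
  have "inj_on (snd d') (fst d')" using inj_on_subset[OF chart_inj[OF c(2)] sub(2)] by (simp add: s)
  then have "adapted d' (snd d' y') = y'" unfolding adapted_def using y'(1) by (rule inv_into_f_f)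
  moreover have "adapted c' (snd c' y') = y'" using adapted_snd[OF c(2)] y'(1) sub(2) by blast
  ultimately show "transition d d' y = transition c c' y"
    by (simp add: transition_def s y'(2))
qed

lemma complex_foliation_restrict:
  assumes W: "openin X W"
  shows "complex_foliation (restrict_foliation F W)"
  unfolding complex_foliation_def Let_def restrict_sel
proof (intro conjI ballI allI impI)
  have WX: "W \<subseteq> topspace X" using openin_subset[OF W] .
  show "Hausdorff_space (subtopology X W)" by (rule Hausdorff_space_subtopology[OF Hausdorff])
  show "second_countable (subtopology X W)" by (rule second_countable_subtopology[OF second_countable])
  show "(\<Union>c\<in>charts (restrict_foliation F W). chart_image c) = topspace (subtopology X W)"
  proof (rule equalityI; rule subsetI)
    fix x assume "x \<in> (\<Union>c\<in>charts (restrict_foliation F W). chart_image c)"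
    then obtain c' where c': "c' \<in> charts (restrict_foliation F W)" "x \<in> chart_image c'" by blast
    obtain c where "chart_image c' \<subseteq> W" by (rule restrict_chartD[OF c'(1)]) (rule that)
    then show "x \<in> topspace (subtopology X W)" using c'(2) WX by auto
  next
    fix x assume "x \<in> topspace (subtopology X W)"
    then have x: "x \<in> topspace X" "x \<in> W" by auto
    obtain c y where c: "c \<in> charts F" "y \<in> fst c" "snd c y = x" by (rule obtain_chart[OF x(1)]) (rule that)
    have "y \<in> {y \<in> fst c. snd c y \<in> W}" using c x by simp
    then obtain D where D: "(D, snd c) \<in> charts (restrict_foliation F W)" "y \<in> D"
      by (rule restrict_chart_inside[OF c(1) open_preimage[OF c(1) W] _ order_refl]) (rule that)
    then have "x \<in> chart_image (D, snd c)" using c(3) by (auto simp: chart_image_def)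
    then show "x \<in> (\<Union>c\<in>charts (restrict_foliation F W). chart_image c)" using D(1) by blast
  qed
  fix d assume d: "d \<in> charts (restrict_foliation F W)"
  obtain c where c: "c \<in> charts F" "snd c = snd d" "fst d \<subseteq> fst c" "disc_ball m n (fst d)" "chart_image d \<subseteq> W"
    by (rule restrict_chartD[OF d]) (rule that)
  show "disc_ball m n (fst d)" by (rule c(4))
  have od: "openin X (chart_image d)"
    using open_image[OF c(1) disc_ball_open[OF c(4)] c(3)] c(2) by (simp add: chart_image_def)
  then show "openin (subtopology X W) (chart_image d)" using c(5) W by (simp add: openin_open_subtopology)
  have "homeomorphic_map (subtopology (top_of_set (fst c)) (fst d)) (subtopology (subtopology X (chart_image c)) (chart_image d)) (snd c)"
  proof (rule homeomorphic_map_subtopologies[OF chart_facts(3)[OF c(1)]])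
    have "chart_image d \<subseteq> chart_image c" using c(2,3) by (auto simp: chart_image_def)
    then show "snd c ` (topspace (top_of_set (fst c)) \<inter> fst d) = topspace (subtopology X (chart_image c)) \<inter> chart_image d"
      using c(2,3) openin_subset[OF od] by (auto simp: chart_image_def)
  qed
  moreover have "subtopology (top_of_set (fst c)) (fst d) = top_of_set (fst d)"
    using c(3) by (simp add: subtopology_subtopology Int_absorb1)
  moreover have "subtopology (subtopology X (chart_image c)) (chart_image d) = subtopology (subtopology X W) (chart_image d)"
  proof -
    have "chart_image d \<subseteq> chart_image c" using c(2,3) by (auto simp: chart_image_def)
    then show ?thesis using c(5) by (simp add: subtopology_subtopology Int_absorb1)
  qed
  ultimately show "homeomorphic_map (top_of_set (fst d)) (subtopology (subtopology X W) (chart_image d)) (snd d)"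
    using c(2) by simp
  fix d' assume d': "d' \<in> charts (restrict_foliation F W)"
  obtain c' where c': "c' \<in> charts F" "snd c' = snd d'" "fst d' \<subseteq> fst c'" "disc_ball m n (fst d')" "chart_image d' \<subseteq> W"
    by (rule restrict_chartD[OF d']) (rule that)
  note tr = restrict_transition[OF c(1) c'(1) c(2)[symmetric] c'(2)[symmetric] c(3) c'(3)]
  have od': "openin X (chart_image d')"
    using open_image[OF c'(1) disc_ball_open[OF c'(4)] c'(3)] c'(2) by (simp add: chart_image_def)
  have "overlap d d' = fst d \<inter> {y \<in> fst c. snd c y \<in> chart_image d'}"
    using c(2,3) by (auto simp: overlap_def)
  then have oo: "model_open m n (overlap d d')"
    using openin_Int[OF disc_ball_open[OF c(4)] open_preimage[OF c(1) od']] by simp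
  show "smooth_on m n (overlap d d') (\<lambda>y. fst (transition d d' y) a)" if "a < m" for a
    by (rule smooth_on_cong[OF oo _ smooth_on_subset[OF transition_facts(1)[OF c(1) c'(1) that] tr(1)]])
       (simp add: tr(2))
  show "smooth_on m n (overlap d d') (\<lambda>y. of_real (snd (transition d d' y) b))" if "b < n" for b
    by (rule smooth_on_cong[OF oo _ smooth_on_subset[OF transition_facts(2)[OF c(1) c'(1) that] tr(1)]])
       (simp add: tr(2))
  show "(\<lambda>w. fst (transition d d' (z(b := w), t)) a) holomorphic_on {w. (z(b := w), t) \<in> overlap d d'}"
    if "a < m" "b < m" for a b z t
  proof (rule holomorphic_transform)
    show "(\<lambda>w. fst (transition c c' (z(b := w), t)) a) holomorphic_on {w. (z(b := w), t) \<in> overlap d d'}"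
      by (rule holomorphic_on_subset[OF transition_facts(3)[OF c(1) c'(1) that]]) (use tr(1) in blast)
  qed (simp add: tr(2))
  obtain h where h: "\<forall>y\<in>overlap c c'. snd (transition c c' y) = h (snd y)"
    using transition_facts(4)[OF c(1) c'(1)] by (rule exE)
  have "snd (transition d d' y) = h (snd y)" if "y \<in> overlap d d'" for y
    using bspec[OF h subsetD[OF tr(1) that]] tr(2)[OF that] by simp
  then show "\<exists>h. \<forall>y\<in>overlap d d'. snd (transition d d' y) = h (snd y)" by (intro exI[of _ h] ballI)
qed

text \<open>A tangent vector is a total functional whose default value is governed by
  \<open>smooth_near\<close>. Since both foliations call the same functions smooth near a point of
  \<open>W\<close>, their tangent vectors are literally equal there.\<close>

lemma smooth_near_restrict:
  assumes W: "openin X W" and x: "x \<in> W"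
  shows "smooth_near (restrict_foliation F W) x f \<longleftrightarrow> smooth_near F x f"
proof
  assume "smooth_near (restrict_foliation F W) x f"
  then obtain N where N': "openin (subtopology X W) N \<and> x \<in> N \<and>
    (\<forall>c\<in>charts (restrict_foliation F W). smooth_on m n {y \<in> fst c. snd c y \<in> N} (f \<circ> snd c))"
    unfolding smooth_near_def restrict_sel by (rule exE)
  then have N: "openin X N" "N \<subseteq> W" "x \<in> N" using openin_open_subtopology[OF W] by blast+
  have N4: "smooth_on m n {y \<in> fst c. snd c y \<in> N} (f \<circ> snd c)" if "c \<in> charts (restrict_foliation F W)" for c
    by (rule bspec[OF N'[THEN conjunct2, THEN conjunct2] that])
  have "smooth_on m n {y \<in> fst c. snd c y \<in> N} (f \<circ> snd c)" if c: "c \<in> charts F" for c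
  proof (rule smooth_on_local[OF _ model_open_imp_subset[OF open_preimage[OF c N(1)]]])
    fix y assume y: "y \<in> {y \<in> fst c. snd c y \<in> N}"
    have "{y \<in> fst c. snd c y \<in> N} \<subseteq> {y \<in> fst c. snd c y \<in> W}" using N(2) by blast
    then obtain D where D: "(D, snd c) \<in> charts (restrict_foliation F W)" "y \<in> D" "D \<subseteq> {y \<in> fst c. snd c y \<in> N}"
      by (rule restrict_chart_inside[OF c open_preimage[OF c N(1)] y]) (rule that)
    have "disc_ball m n D" by (rule restrict_chartD[OF D(1)]) simp
    moreover have "{y \<in> D. snd c y \<in> N} = D" using D(3) by blast
    then have "smooth_on m n D (f \<circ> snd c)" using N4[OF D(1)] by simp
    ultimately show "\<exists>S'. model_open m n S' \<and> y \<in> S' \<and> smooth_on m n S' (f \<circ> snd c)"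
      using D(2) disc_ball_open by (intro exI[of _ D] conjI)
  qed
  then show "smooth_near F x f" unfolding smooth_near_def using N(1,3) by (intro exI[of _ N] conjI ballI)
next
  assume "smooth_near F x f"
  then obtain N where "openin X N \<and> x \<in> N \<and> (\<forall>c\<in>charts F. smooth_on m n {y \<in> fst c. snd c y \<in> N} (f \<circ> snd c))"
    unfolding smooth_near_def by (rule exE)
  then have N: "openin X N" "x \<in> N"
    "\<And>c. c \<in> charts F \<Longrightarrow> smooth_on m n {y \<in> fst c. snd c y \<in> N} (f \<circ> snd c)"
    by simp_all
  have "smooth_on m n {y \<in> fst d. snd d y \<in> N \<inter> W} (f \<circ> snd d)" if d: "d \<in> charts (restrict_foliation F W)" for d
  proof -
    obtain c where c: "c \<in> charts F" "snd c = snd d" "fst d \<subseteq> fst c" by (rule restrict_chartD[OF d]) (rule that)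
    show ?thesis using smooth_on_subset[OF N(3)[OF c(1)], of "{y \<in> fst d. snd d y \<in> N \<inter> W}"] c(2,3) by auto
  qed
  moreover have "openin (subtopology X W) (N \<inter> W)" using N(1) by (simp add: openin_subtopology_Int)
  ultimately show "smooth_near (restrict_foliation F W) x f"
    unfolding smooth_near_def restrict_sel using N(2) x by (intro exI[of _ "N \<inter> W"] conjI ballI) auto
qed

lemma vecof_restrict:
  assumes W: "openin X W" and s: "snd d = snd c" and y: "snd c y \<in> W"
  shows "vecof (restrict_foliation F W) d y = vecof F c y"
  by (intro ext) (simp add: vecof_apply s smooth_near_restrict[OF W y])

lemma leaf_tangent_restrict:
  assumes W: "openin X W" and x: "x \<in> W"
  shows "leaf_tangent (restrict_foliation F W) x = leaf_tangent F x"
proof -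
  interpret R: complex_fol "restrict_foliation F W"
    by unfold_locales (rule complex_foliation_restrict[OF W])
  have "x \<in> topspace X" using x openin_subset[OF W] by blast
  then obtain c y where c: "c \<in> charts F" "y \<in> fst c" "snd c y = x" by (rule obtain_chart) (rule that)
  have "y \<in> {y \<in> fst c. snd c y \<in> W}" using c x by simp
  then obtain D where D: "(D, snd c) \<in> charts (restrict_foliation F W)" "y \<in> D"
    by (rule restrict_chart_inside[OF c(1) open_preimage[OF c(1) W] _ order_refl]) (rule that)
  have "leaf_tangent (restrict_foliation F W) x = range (vecof (restrict_foliation F W) (D, snd c) y)"
    using R.leaf_tangent_eq[OF D(1), of y] D(2) c(3) by simp
  also have "\<dots> = leaf_tangent F x"
    using leaf_tangent_eq[OF c(1,2)] vecof_restrict[OF W, of "(D, snd c)" c y] c(3) x by simp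
  finally show ?thesis .
qed

lemma leaf_tangent_restrict_iff:
  assumes W: "openin X W"
  shows "x \<in> W \<and> set Xs \<subseteq> leaf_tangent (restrict_foliation F W) x \<longleftrightarrow> x \<in> W \<and> set Xs \<subseteq> leaf_tangent F x"
  by (cases "x \<in> W") (simp_all add: leaf_tangent_restrict[OF W])

lemma pull_restrict:
  assumes W: "openin X W" and s: "snd d = snd c" and y: "snd c y \<in> W"
  shows "pull (restrict_foliation F W) d \<phi> y = pull F c \<phi> y"
  by (rule ext) (simp add: pull_def vecof_restrict[OF assms] s)

lemma foliated_forms_restrict:
  assumes W: "openin X W"
  shows "foliated_forms (restrict_foliation F W) p q = Frm W p q"
proof -
  interpret R: complex_fol "restrict_foliation F W"
    by unfold_locales (rule complex_foliation_restrict[OF W])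
  have tW: "topspace (subtopology X W) = W" using openin_subset[OF W] by auto
  have sup: "R.supported W \<phi> \<longleftrightarrow> supported W \<phi>" for \<phi>
    unfolding R.supported_def supported_def by (simp only: leaf_tangent_restrict_iff[OF W])
  have "R.Frm W p q = Frm W p q"
  proof (rule equalityI; rule subsetI)
    fix \<phi> assume \<phi>: "\<phi> \<in> R.Frm W p q"
    show "\<phi> \<in> Frm W p q"
    proof (rule FrmI)
      show "supported W \<phi>" using R.FrmD(1)[OF \<phi>] sup by simp
      fix c y assume c: "c \<in> charts F" "y \<in> fst c" "snd c y \<in> W"
      have "y \<in> {y \<in> fst c. snd c y \<in> W}" using c by simp
      then obtain D where D: "(D, snd c) \<in> charts (restrict_foliation F W)" "y \<in> D" "D \<subseteq> {y \<in> fst c. snd c y \<in> W}"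
        by (rule restrict_chart_inside[OF c(1) open_preimage[OF c(1) W] _ order_refl]) (rule that)
      have "R.locally_form p q W \<phi> (D, snd c) y" using R.FrmD(2)[OF \<phi> D(1)] D(2) c(3) by simp
      then obtain S where S0: "model_open (cdim (restrict_foliation F W)) (codim (restrict_foliation F W)) S" "y \<in> S"
        "S \<subseteq> {y \<in> fst (D, snd c). snd (D, snd c) y \<in> W}"
        "local_form (cdim (restrict_foliation F W)) (codim (restrict_foliation F W)) p q S (pull (restrict_foliation F W) (D, snd c) \<phi>)"
        by (rule R.locally_formE) (rule that)
      note S = S0[unfolded restrict_sel fst_conv snd_conv]
      show "locally_form p q W \<phi> c y"
      proof (rule locally_formI[OF S(1,2)])
        show sub: "S \<subseteq> {y \<in> fst c. snd c y \<in> W}" using S(3) D(3) by blast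
        show "local_form m n p q S (pull F c \<phi>)"
        proof (rule local_form_cong[OF S(4)])
          fix z vs assume "z \<in> S"
          then have "snd c z \<in> W" using sub by blast
          then show "pull (restrict_foliation F W) (D, snd c) \<phi> z vs = pull F c \<phi> z vs"
            using pull_restrict[OF W, of "(D, snd c)" c z \<phi>] by simp
        qed
      qed
    qed
  next
    fix \<phi> assume \<phi>: "\<phi> \<in> Frm W p q"
    show "\<phi> \<in> R.Frm W p q"
    proof (rule R.FrmI)
      show "R.supported W \<phi>" using FrmD(1)[OF \<phi>] sup by simp
      fix d y assume d: "d \<in> charts (restrict_foliation F W)" "y \<in> fst d" "snd d y \<in> W"
      obtain c where c: "c \<in> charts F" "snd c = snd d" "fst d \<subseteq> fst c" "disc_ball m n (fst d)" "chart_image d \<subseteq> W"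
        by (rule restrict_chartD[OF d(1)]) (rule that)
      have "y \<in> fst c" "snd c y \<in> W" using d c by auto
      from FrmD(2)[OF \<phi> c(1) this]
      obtain S where S: "model_open m n S" "y \<in> S" "S \<subseteq> {y \<in> fst c. snd c y \<in> W}" "local_form m n p q S (pull F c \<phi>)"
        by (rule locally_formE) (rule that)
      have o: "model_open m n (S \<inter> fst d)" by (rule openin_Int[OF S(1) disc_ball_open[OF c(4)]])
      show "R.locally_form p q W \<phi> d y"
      proof (rule R.locally_formI)
        show "model_open (cdim (restrict_foliation F W)) (codim (restrict_foliation F W)) (S \<inter> fst d)" using o by simp
        show "y \<in> S \<inter> fst d" using S(2) d(2) by simp
        show sub: "S \<inter> fst d \<subseteq> {y \<in> fst d. snd d y \<in> W}" using S(3) c(2) by auto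
        show "local_form (cdim (restrict_foliation F W)) (codim (restrict_foliation F W)) p q (S \<inter> fst d) (pull (restrict_foliation F W) d \<phi>)"
          unfolding restrict_sel
        proof (rule local_form_cong[OF local_form_subset[OF S(4)]])
          fix z vs assume "z \<in> S \<inter> fst d"
          then have "snd c z \<in> W" using S(3) by blast
          then show "pull F c \<phi> z vs = pull (restrict_foliation F W) d \<phi> z vs"
            using pull_restrict[OF W c(2)[symmetric]] by simp
        qed simp
      qed
    qed
  qed
  then show ?thesis using R.foliated_forms_eq tW by simp
qed

text \<open>\<open>is_d_dbar_f\<close> for the restricted foliation gives the expression in its own
  charts. Around each point over \<open>W\<close>, such a chart shares its parametrization with a
  chart of \<open>F\<close>, so the two expressions coincide.\<close>

lemma is_d_restrict:
  assumes W: "openin X W" and f: "smooth_function F f"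
  shows "is_d W f p q (dbar_f (restrict_foliation F W) f p q)"
proof -
  interpret R: complex_fol "restrict_foliation F W"
    by unfold_locales (rule complex_foliation_restrict[OF W])
  have tW: "topspace (subtopology X W) = W" using openin_subset[OF W] by auto
  have "smooth_function (restrict_foliation F W) f"
    unfolding smooth_function_def restrict_sel
  proof
    fix d assume d: "d \<in> charts (restrict_foliation F W)"
    obtain c where c: "c \<in> charts F" "snd c = snd d" "fst d \<subseteq> fst c" by (rule restrict_chartD[OF d]) (rule that)
    have "smooth_on m n (fst c) (f \<circ> snd c)" using f c(1) by (simp add: smooth_function_def)
    then show "smooth_on m n (fst d) (f \<circ> snd d)" using smooth_on_subset[OF _ c(3)] c(2) by simp
  qed
  from R.is_d_dbar_f[OF this, of p q]
  have D: "R.is_d W f p q (dbar_f (restrict_foliation F W) f p q)" by (simp only: restrict_sel tW)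
  have Frm: "R.Frm W p q = Frm W p q"
    using foliated_forms_restrict[OF W] R.foliated_forms_eq tW by simp
  show ?thesis unfolding is_d_def
  proof (intro ballI conjI impI)
    fix \<phi> assume \<phi>: "\<phi> \<in> Frm W p q"
    have D': "R.supported W (dbar_f (restrict_foliation F W) f p q \<phi>)"
      "\<And>d y. d \<in> charts (restrict_foliation F W) \<Longrightarrow> y \<in> fst d \<Longrightarrow> snd d y \<in> W \<Longrightarrow>
        pull (restrict_foliation F W) d (dbar_f (restrict_foliation F W) f p q \<phi>) y =
        twisted_d m (of_nat (p + q)) (f \<circ> snd d) (pull (restrict_foliation F W) d \<phi>) y"
      using bspec[OF D[unfolded R.is_d_def] \<phi>[folded Frm]] unfolding restrict_sel by blast+
    show "supported W (dbar_f (restrict_foliation F W) f p q \<phi>)"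
      using D'(1) unfolding R.supported_def supported_def by (simp only: leaf_tangent_restrict_iff[OF W])
    fix c y assume c: "c \<in> charts F" "y \<in> fst c" "snd c y \<in> W"
    have "y \<in> {y \<in> fst c. snd c y \<in> W}" using c by simp
    then obtain D where D: "(D, snd c) \<in> charts (restrict_foliation F W)" "y \<in> D" "D \<subseteq> {y \<in> fst c. snd c y \<in> W}"
      by (rule restrict_chart_inside[OF c(1) open_preimage[OF c(1) W] _ order_refl]) (rule that)
    have oD: "model_open m n D" by (rule restrict_chartD[OF D(1)]) (simp add: disc_ball_open)
    have e: "pull (restrict_foliation F W) (D, snd c) \<psi> z = pull F c \<psi> z" if "z \<in> D" for z \<psi>
      by (rule pull_restrict[OF W]) (use that D(3) in auto)
    have "pull F c (dbar_f (restrict_foliation F W) f p q \<phi>) y =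
        twisted_d m (of_nat (p + q)) (f \<circ> snd c) (pull (restrict_foliation F W) (D, snd c) \<phi>) y"
      using D'(2)[OF D(1), of y] D(2) c(3) e[OF D(2)] by simp
    also have "\<dots> = twisted_d m (of_nat (p + q)) (f \<circ> snd c) (pull F c \<phi>) y"
      by (rule ext) (rule twisted_d_cong[OF oD D(2)], simp add: e)
    finally show "pull F c (dbar_f (restrict_foliation F W) f p q \<phi>) y =
        twisted_d m (of_nat (p + q)) (f \<circ> snd c) (pull F c \<phi>) y" .
  qed
qed

section \<open>Operations on forms over an open subset\<close>

lemma pull_plus: "pull F c (\<phi> + \<psi>) y vs = pull F c \<phi> y vs + pull F c \<psi> y vs"
  by (simp add: pull_def)

lemma pull_scale: "pull F c (scale_form k \<phi>) y vs = k * pull F c \<phi> y vs"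
  by (simp add: pull_def scale_form_def)

lemma Frm_zero: "0 \<in> Frm W p q" if "openin X W"
proof (rule FrmI)
  show "supported W 0" by (simp add: supported_def)
  fix c y assume c: "c \<in> charts F" "y \<in> fst c" "snd c y \<in> W"
  show "locally_form p q W 0 c y"
  proof (rule locally_formI[OF open_preimage[OF c(1) that] _ order_refl])
    have "pull F c 0 = (\<lambda>y vs. 0)" by (intro ext) (simp add: pull_def)
    then show "local_form m n p q {y \<in> fst c. snd c y \<in> W} (pull F c 0)" by (simp add: local_form_zero)
  qed (use c in simp)
qed

lemma Frm_add:
  assumes 1: "\<phi> \<in> Frm W p q" and 2: "\<psi> \<in> Frm W p q"
  shows "\<phi> + \<psi> \<in> Frm W p q"
proof (rule FrmI)
  show "supported W (\<phi> + \<psi>)" unfolding supported_def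
    using supportedD[OF FrmD(1)[OF 1]] supportedD[OF FrmD(1)[OF 2]] by simp
  fix c y assume c: "c \<in> charts F" "y \<in> fst c" "snd c y \<in> W"
  obtain S where S: "model_open m n S" "y \<in> S" "S \<subseteq> {y \<in> fst c. snd c y \<in> W}" "local_form m n p q S (pull F c \<phi>)"
    by (rule locally_formE[OF FrmD(2)[OF 1 c]]) (rule that)
  obtain S' where S': "model_open m n S'" "y \<in> S'" "S' \<subseteq> {y \<in> fst c. snd c y \<in> W}" "local_form m n p q S' (pull F c \<psi>)"
    by (rule locally_formE[OF FrmD(2)[OF 2 c]]) (rule that)
  have o: "model_open m n (S \<inter> S')" by (rule openin_Int[OF S(1) S'(1)])
  show "locally_form p q W (\<phi> + \<psi>) c y"
  proof (rule locally_formI[OF o])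
    have "local_form m n p q (S \<inter> S') (\<lambda>y vs. pull F c \<phi> y vs + pull F c \<psi> y vs)"
      by (rule local_form_add[OF o local_form_subset[OF S(4)] local_form_subset[OF S'(4)]]) auto
    then show "local_form m n p q (S \<inter> S') (pull F c (\<phi> + \<psi>))" by (simp add: pull_plus[abs_def])
  qed (use S S' in blast)+
qed

lemma Frm_mult:
  assumes \<phi>: "\<phi> \<in> Frm W p q" and g: "smooth_function F g"
  shows "(\<lambda>x Xs. g x * \<phi> x Xs) \<in> Frm W p q"
proof (rule FrmI)
  show "supported W (\<lambda>x Xs. g x * \<phi> x Xs)" unfolding supported_def
    using supportedD[OF FrmD(1)[OF \<phi>]] by simp
  fix c y assume c: "c \<in> charts F" "y \<in> fst c" "snd c y \<in> W"
  obtain S where S: "model_open m n S" "y \<in> S" "S \<subseteq> {y \<in> fst c. snd c y \<in> W}" "local_form m n p q S (pull F c \<phi>)"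
    by (rule locally_formE[OF FrmD(2)[OF \<phi> c]]) (rule that)
  show "locally_form p q W (\<lambda>x Xs. g x * \<phi> x Xs) c y"
  proof (rule locally_formI[OF S(1-3)])
    have "smooth_on m n S (g \<circ> snd c)"
      by (rule smooth_on_subset[of m n "fst c"]) (use g c(1) S(3) in \<open>auto simp: smooth_function_def\<close>)
    then have "local_form m n p q S (\<lambda>y vs. (g \<circ> snd c) y * pull F c \<phi> y vs)"
      by (rule local_form_mult[OF S(1) _ S(4)])
    then show "local_form m n p q S (pull F c (\<lambda>x Xs. g x * \<phi> x Xs))" by (simp add: pull_def[abs_def])
  qed
qed

lemma smooth_function_const: "smooth_function F (\<lambda>x. k)"
  by (simp add: smooth_function_def o_def smooth_on_const)

lemma Frm_scale:
  assumes "\<phi> \<in> Frm W p q"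
  shows "scale_form k \<phi> \<in> Frm W p q"
proof -
  have "scale_form k \<phi> = (\<lambda>x Xs. k * \<phi> x Xs)" by (intro ext) (simp add: scale_form_def)
  then show ?thesis using Frm_mult[OF assms smooth_function_const] by simp
qed

lemma Frm_uminus:
  assumes "\<phi> \<in> Frm W p q"
  shows "- \<phi> \<in> Frm W p q"
proof -
  have "- \<phi> = scale_form (-1) \<phi>" by (intro ext) (simp add: scale_form_def)
  then show ?thesis using Frm_scale[OF assms] by simp
qed

lemma is_dD:
  assumes "is_d W f p q d" "\<phi> \<in> Frm W p q"
  shows "supported W (d \<phi>)"
    "c \<in> charts F \<Longrightarrow> y \<in> fst c \<Longrightarrow> snd c y \<in> W \<Longrightarrow>
        pull F c (d \<phi>) y = twisted_d m (of_nat (p + q)) (f \<circ> snd c) (pull F c \<phi>) y"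
  using bspec[OF assms(1)[unfolded is_d_def] assms(2)] by blast+

lemma is_d_Frm:
  assumes f: "smooth_function F f" and d: "is_d W f p q d" and \<phi>: "\<phi> \<in> Frm W p q"
  shows "d \<phi> \<in> Frm W p (Suc q)"
proof (rule FrmI)
  show "supported W (d \<phi>)" by (rule is_dD(1)[OF d \<phi>])
  fix c y assume c: "c \<in> charts F" "y \<in> fst c" "snd c y \<in> W"
  obtain S where S: "model_open m n S" "y \<in> S" "S \<subseteq> {y \<in> fst c. snd c y \<in> W}" "local_form m n p q S (pull F c \<phi>)"
    by (rule locally_formE[OF FrmD(2)[OF \<phi> c]]) (rule that)
  have fs: "smooth_on m n S (f \<circ> snd c)"
    by (rule smooth_on_subset[of m n "fst c"]) (use f c(1) S(3) in \<open>auto simp: smooth_function_def\<close>)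
  show "locally_form p (Suc q) W (d \<phi>) c y"
  proof (rule locally_formI[OF S(1-3)])
    show "local_form m n p (Suc q) S (pull F c (d \<phi>))"
    proof (rule local_form_cong[OF local_form_twisted_d[OF S(1) fs S(4), of "of_nat (p + q)"]])
      fix z vs assume "z \<in> S"
      then have "z \<in> fst c" "snd c z \<in> W" using S(3) by blast+
      from is_dD(2)[OF d \<phi> c(1) this]
      show "twisted_d m (of_nat (p + q)) (f \<circ> snd c) (pull F c \<phi>) z vs = pull F c (d \<phi>) z vs" by simp
    qed
  qed
qed

lemma Frm_smooth_near:
  assumes \<phi>: "\<phi> \<in> Frm W p q" and c: "c \<in> charts F" "y \<in> fst c" "snd c y \<in> W"
  obtains S where "model_open m n S" "y \<in> S" "S \<subseteq> {y \<in> fst c. snd c y \<in> W}"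
    "\<And>vs. smooth_on m n S (\<lambda>y. pull F c \<phi> y vs)"
proof -
  obtain S where S: "model_open m n S" "y \<in> S" "S \<subseteq> {y \<in> fst c. snd c y \<in> W}" "local_form m n p q S (pull F c \<phi>)"
    by (rule locally_formE[OF FrmD(2)[OF \<phi> c]]) (rule that)
  show thesis by (rule that[OF S(1-3)]) (rule local_form_smooth[OF S(1,4)])
qed

lemma is_d_add:
  assumes f: "smooth_function F f" and W: "W \<subseteq> topspace X" and d: "is_d W f p q d"
    and \<phi>: "\<phi> \<in> Frm W p q" and \<psi>: "\<psi> \<in> Frm W p q"
  shows "d (\<phi> + \<psi>) = d \<phi> + d \<psi>"
proof (rule form_eqI[OF _ _ W])
  show "supported W (d (\<phi> + \<psi>))" by (rule is_dD(1)[OF d Frm_add[OF \<phi> \<psi>]])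
  show "supported W (d \<phi> + d \<psi>)"
    by (rule FrmD(1)[OF Frm_add[OF is_d_Frm[OF f d \<phi>] is_d_Frm[OF f d \<psi>]]])
  fix c y vs assume c: "c \<in> charts F" "y \<in> fst c" "snd c y \<in> W"
  obtain S where S: "model_open m n S" "y \<in> S" "\<And>vs. smooth_on m n S (\<lambda>y. pull F c \<phi> y vs)"
    by (rule Frm_smooth_near[OF \<phi> c]) (rule that)
  obtain S' where S': "model_open m n S'" "y \<in> S'" "\<And>vs. smooth_on m n S' (\<lambda>y. pull F c \<psi> y vs)"
    by (rule Frm_smooth_near[OF \<psi> c]) (rule that)
  have o: "model_open m n (S \<inter> S')" "y \<in> S \<inter> S'" using openin_Int[OF S(1) S'(1)] S(2) S'(2) by simp_all
  have "twisted_d m (of_nat (p + q)) (f \<circ> snd c) (\<lambda>y vs. pull F c \<phi> y vs + pull F c \<psi> y vs) y vs =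
    twisted_d m (of_nat (p + q)) (f \<circ> snd c) (pull F c \<phi>) y vs + twisted_d m (of_nat (p + q)) (f \<circ> snd c) (pull F c \<psi>) y vs"
    by (rule twisted_d_add[OF o smooth_on_subset[OF S(3)] smooth_on_subset[OF S'(3)]]) simp_all
  then show "pull F c (d (\<phi> + \<psi>)) y vs = pull F c (d \<phi> + d \<psi>) y vs"
    by (simp only: is_dD(2)[OF d Frm_add[OF \<phi> \<psi>] c] pull_plus is_dD(2)[OF d \<phi> c] is_dD(2)[OF d \<psi> c] pull_plus[abs_def])
qed

lemma is_d_scale:
  assumes f: "smooth_function F f" and W: "W \<subseteq> topspace X" and d: "is_d W f p q d" and \<phi>: "\<phi> \<in> Frm W p q"
  shows "d (scale_form k \<phi>) = scale_form k (d \<phi>)"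
proof (rule form_eqI[OF _ _ W])
  show "supported W (d (scale_form k \<phi>))" by (rule is_dD(1)[OF d Frm_scale[OF \<phi>]])
  show "supported W (scale_form k (d \<phi>))" by (rule FrmD(1)[OF Frm_scale[OF is_d_Frm[OF f d \<phi>]]])
  fix c y vs assume c: "c \<in> charts F" "y \<in> fst c" "snd c y \<in> W"
  obtain S where S: "model_open m n S" "y \<in> S" "\<And>vs. smooth_on m n S (\<lambda>y. pull F c \<phi> y vs)"
    by (rule Frm_smooth_near[OF \<phi> c]) (rule that)
  have "twisted_d m (of_nat (p + q)) (f \<circ> snd c) (\<lambda>y vs. k * pull F c \<phi> y vs) y vs =
    k * twisted_d m (of_nat (p + q)) (f \<circ> snd c) (pull F c \<phi>) y vs"
    by (rule twisted_d_cmult[OF S])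
  then show "pull F c (d (scale_form k \<phi>)) y vs = pull F c (scale_form k (d \<phi>)) y vs"
    by (simp only: is_dD(2)[OF d Frm_scale[OF \<phi>] c] pull_scale is_dD(2)[OF d \<phi> c] pull_scale[abs_def])
qed

lemma is_d_is_d:
  assumes f: "smooth_function F f" and W: "W \<subseteq> topspace X" "openin X W" and d: "is_d W f p q d" "is_d W f p (Suc q) d'"
    and \<phi>: "\<phi> \<in> Frm W p q"
  shows "d' (d \<phi>) = 0"
proof (rule form_eqI[OF _ _ W(1)])
  have d\<phi>: "d \<phi> \<in> Frm W p (Suc q)" by (rule is_d_Frm[OF f d(1) \<phi>])
  show "supported W (d' (d \<phi>))" by (rule is_dD(1)[OF d(2) d\<phi>])
  show "supported W 0" by (rule FrmD(1)[OF Frm_zero[OF W(2)]])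
  fix c y vs assume c: "c \<in> charts F" "y \<in> fst c" "snd c y \<in> W"
  obtain S where S: "model_open m n S" "y \<in> S" "S \<subseteq> {y \<in> fst c. snd c y \<in> W}" "\<And>vs. smooth_on m n S (\<lambda>y. pull F c \<phi> y vs)"
    by (rule Frm_smooth_near[OF \<phi> c]) (rule that)
  have fs: "smooth_on m n S (f \<circ> snd c)"
    by (rule smooth_on_subset[of m n "fst c"]) (use f c(1) S(3) in \<open>auto simp: smooth_function_def\<close>)
  have "pull F c (d' (d \<phi>)) y vs = twisted_d m (of_nat (p + Suc q)) (f \<circ> snd c) (pull F c (d \<phi>)) y vs"
    by (simp only: is_dD(2)[OF d(2) d\<phi> c])
  also have "\<dots> = twisted_d m (of_nat (p + Suc q)) (f \<circ> snd c) (twisted_d m (of_nat (p + q)) (f \<circ> snd c) (pull F c \<phi>)) y vs"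
  proof (rule twisted_d_cong[OF S(1,2)])
    fix z r assume "z \<in> S"
    then have "z \<in> fst c" "snd c z \<in> W" using S(3) by blast+
    then show "pull F c (d \<phi>) z r = twisted_d m (of_nat (p + q)) (f \<circ> snd c) (pull F c \<phi>) z r"
      by (simp only: is_dD(2)[OF d(1) \<phi> c(1)])
  qed
  \<comment> \<open>The weight of the second operator is one larger, as
    \<open>twisted_d_twisted_d\<close> demands.\<close>
  also have "\<dots> = twisted_d m (of_nat (p + q) + 1) (f \<circ> snd c) (twisted_d m (of_nat (p + q)) (f \<circ> snd c) (pull F c \<phi>)) y vs"
    by (simp add: add.commute)
  also have "\<dots> = 0" by (rule twisted_d_twisted_d[OF S(1,2) fs S(4)])
  finally show "pull F c (d' (d \<phi>)) y vs = pull F c 0 y vs" by (simp add: pull_def)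
qed

lemma pull_restrict_form: "snd c y \<in> W \<Longrightarrow> pull F c (restrict_form W \<phi>) y vs = pull F c \<phi> y vs"
  by (simp add: pull_def restrict_form_def)

lemma restrict_form_Frm:
  assumes \<phi>: "\<phi> \<in> Frm W p q" and W': "openin X W'" "W' \<subseteq> W"
  shows "restrict_form W' \<phi> \<in> Frm W' p q"
proof (rule FrmI)
  show "supported W' (restrict_form W' \<phi>)"
    unfolding supported_def restrict_form_def using supportedD[OF FrmD(1)[OF \<phi>]] W'(2) by auto
  fix c y assume c: "c \<in> charts F" "y \<in> fst c" "snd c y \<in> W'"
  have "snd c y \<in> W" using c(3) W'(2) by blast
  from FrmD(2)[OF \<phi> c(1,2) this]
  obtain S where S: "model_open m n S" "y \<in> S" "S \<subseteq> {y \<in> fst c. snd c y \<in> W}" "local_form m n p q S (pull F c \<phi>)"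
    by (rule locally_formE) (rule that)
  have o: "model_open m n (S \<inter> {y \<in> fst c. snd c y \<in> W'})"
    by (rule openin_Int[OF S(1) open_preimage[OF c(1) W'(1)]])
  show "locally_form p q W' (restrict_form W' \<phi>) c y"
  proof (rule locally_formI[OF o])
    show "y \<in> S \<inter> {y \<in> fst c. snd c y \<in> W'}" using S(2) c by simp
    show "local_form m n p q (S \<inter> {y \<in> fst c. snd c y \<in> W'}) (pull F c (restrict_form W' \<phi>))"
      by (rule local_form_cong[OF local_form_subset[OF S(4)]]) (simp_all add: pull_restrict_form)
  qed simp
qed

text \<open>\<open>twisted_d\<close> is local: near a point over \<open>W'\<close> a form and its
  restriction have the same chart expression.\<close>

lemma is_d_restrict_form:
  assumes f: "smooth_function F f" and W: "W \<subseteq> topspace X" and W': "openin X W'" "W' \<subseteq> W"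
    and d: "is_d W f p q d" "is_d W' f p q d'" and \<phi>: "\<phi> \<in> Frm W p q"
  shows "restrict_form W' (d \<phi>) = d' (restrict_form W' \<phi>)"
proof (rule form_eqI)
  note r = restrict_form_Frm[OF \<phi> W']
  show "supported W' (restrict_form W' (d \<phi>))" by (rule FrmD(1)[OF restrict_form_Frm[OF is_d_Frm[OF f d(1) \<phi>] W']])
  show "supported W' (d' (restrict_form W' \<phi>))" by (rule is_dD(1)[OF d(2) r])
  show "W' \<subseteq> topspace X" using W W' by blast
  fix c y vs assume c: "c \<in> charts F" "y \<in> fst c" "snd c y \<in> W'"
  then have cW: "snd c y \<in> W" using W'(2) by blast
  have y: "y \<in> {y \<in> fst c. snd c y \<in> W'}" using c by simp
  have "pull F c (restrict_form W' (d \<phi>)) y vs = twisted_d m (of_nat (p + q)) (f \<circ> snd c) (pull F c \<phi>) y vs"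
    by (simp only: pull_restrict_form[of c, OF c(3)] is_dD(2)[OF d(1) \<phi> c(1,2) cW])
  also have "\<dots> = twisted_d m (of_nat (p + q)) (f \<circ> snd c) (pull F c (restrict_form W' \<phi>)) y vs"
    by (rule twisted_d_cong[OF open_preimage[OF c(1) W'(1)] y]) (simp add: pull_restrict_form)
  also have "\<dots> = pull F c (d' (restrict_form W' \<phi>)) y vs"
    by (simp only: is_dD(2)[OF d(2) r c])
  finally show "pull F c (restrict_form W' (d \<phi>)) y vs = pull F c (d' (restrict_form W' \<phi>)) y vs" .
qed

text \<open>Forms are total functions that vanish outside their domain, so the extension by zero is
  \<open>\<phi>\<close> itself. Near the points of \<open>W - W'\<close> its local expression is the
  zero form.\<close>

lemma Frm_extend:
  assumes \<phi>: "\<phi> \<in> Frm W' p q" and W: "openin X W" "W' \<subseteq> W"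
    and z: "\<And>x. x \<in> W - W' \<Longrightarrow> \<exists>N. openin X N \<and> x \<in> N \<and> (\<forall>z\<in>N. \<forall>Xs. \<phi> z Xs = 0)"
  shows "\<phi> \<in> Frm W p q"
proof (rule FrmI)
  show "supported W \<phi>" unfolding supported_def using supportedD[OF FrmD(1)[OF \<phi>]] W(2) by blast
  fix c y assume c: "c \<in> charts F" "y \<in> fst c" "snd c y \<in> W"
  show "locally_form p q W \<phi> c y"
  proof (cases "snd c y \<in> W'")
    case True
    obtain S where S: "model_open m n S" "y \<in> S" "S \<subseteq> {y \<in> fst c. snd c y \<in> W'}" "local_form m n p q S (pull F c \<phi>)"
      by (rule locally_formE[OF FrmD(2)[OF \<phi> c(1,2) True]]) (rule that)
    show ?thesis by (rule locally_formI[OF S(1,2) _ S(4)]) (use S(3) W(2) in blast)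
  next
    case False
    then obtain N where N: "openin X N \<and> snd c y \<in> N \<and> (\<forall>z\<in>N. \<forall>Xs. \<phi> z Xs = 0)"
      using z[of "snd c y"] c(3) by blast
    have o: "openin X (N \<inter> W)" using N W(1) by blast
    show ?thesis
    proof (rule locally_formI[OF open_preimage[OF c(1) o]])
      show "y \<in> {y \<in> fst c. snd c y \<in> N \<inter> W}" using c N by simp
      show "local_form m n p q {y \<in> fst c. snd c y \<in> N \<inter> W} (pull F c \<phi>)"
        by (rule local_form_cong[OF local_form_zero]) (use N in \<open>simp add: pull_def\<close>)
    qed auto
  qed
qed

text \<open>Each point has a neighbourhood inside \<open>U\<close> or inside \<open>V\<close>, where
  the glued form inherits the local expression of \<open>\<sigma>\<close> or of
  \<open>\<tau>\<close>.\<close>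

lemma Frm_glue:
  assumes \<sigma>: "\<sigma> \<in> Frm U p q" and \<tau>: "\<tau> \<in> Frm V p q" and UV: "openin X U" "openin X V"
    and e: "restrict_form (U \<inter> V) \<sigma> = restrict_form (U \<inter> V) \<tau>"
  shows "\<exists>\<phi>\<in>Frm (U \<union> V) p q. restrict_form U \<phi> = \<sigma> \<and> restrict_form V \<phi> = \<tau>"
proof
  define \<phi> where "\<phi> = (\<lambda>x Xs. if x \<in> U then \<sigma> x Xs else \<tau> x Xs)"
  have eq: "\<sigma> x Xs = \<tau> x Xs" if "x \<in> U \<inter> V" for x Xs
    using fun_cong[OF fun_cong[OF e, of x], of Xs] that by (simp add: restrict_form_def)
  have \<sigma>0: "\<sigma> x Xs = 0" if "x \<notin> U" for x Xs using supportedD[OF FrmD(1)[OF \<sigma>]] that by blast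
  have \<tau>0: "\<tau> x Xs = 0" if "x \<notin> V" for x Xs using supportedD[OF FrmD(1)[OF \<tau>]] that by blast
  have r: "restrict_form U \<phi> = \<sigma>" "restrict_form V \<phi> = \<tau>"
    using eq \<sigma>0 \<tau>0 by (auto simp: restrict_form_def \<phi>_def fun_eq_iff)
  then show "restrict_form U \<phi> = \<sigma> \<and> restrict_form V \<phi> = \<tau>" by simp
  show "\<phi> \<in> Frm (U \<union> V) p q"
  proof (rule FrmI)
    show "supported (U \<union> V) \<phi>" unfolding supported_def \<phi>_def
      using supportedD[OF FrmD(1)[OF \<sigma>]] supportedD[OF FrmD(1)[OF \<tau>]] by auto
    have loc: "locally_form p q (U \<union> V) \<phi> c y"
      if W: "W \<subseteq> U \<union> V" "\<psi> \<in> Frm W p q" "restrict_form W \<phi> = \<psi>" and c: "c \<in> charts F" "y \<in> fst c" "snd c y \<in> W" for W \<psi> c y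
    proof -
      obtain S where S: "model_open m n S" "y \<in> S" "S \<subseteq> {y \<in> fst c. snd c y \<in> W}" "local_form m n p q S (pull F c \<psi>)"
        by (rule locally_formE[OF FrmD(2)[OF W(2) c]]) (rule that)
      show ?thesis
      proof (rule locally_formI[OF S(1,2)])
        show "S \<subseteq> {y \<in> fst c. snd c y \<in> U \<union> V}" using S(3) W(1) by blast
        show "local_form m n p q S (pull F c \<phi>)"
        proof (rule local_form_cong[OF S(4)])
          fix z vs assume "z \<in> S"
          then have "snd c z \<in> W" using S(3) by blast
          then show "pull F c \<psi> z vs = pull F c \<phi> z vs" using pull_restrict_form[of c z W \<phi> vs] W(3) by simp
        qed
      qed
    qed
    fix c y assume c: "c \<in> charts F" "y \<in> fst c" "snd c y \<in> U \<union> V"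
    from c(3) show "locally_form p q (U \<union> V) \<phi> c y"
      using loc[OF Un_upper1 \<sigma> r(1) c(1,2)] loc[OF Un_upper2 \<tau> r(2) c(1,2)] by blast
  qed
qed

end

section \<open>Partitions of unity\<close>

text \<open>The box is a product of compact intervals and rectangles and, beyond the dimensions, of
  singletons; the infinite product is compact by Tychonoff's theorem.\<close>

lemma compact_box:
  fixes y0 :: model
  shows "compact {y \<in> model_space m n. \<forall>k\<in>coords m n. \<bar>co k y - co k y0\<bar> \<le> e}"
proof -
  define Z where "Z = (\<lambda>a. if a < m then cbox (fst y0 a - Complex e e) (fst y0 a + Complex e e) else {0})"
  define T where "T = (\<lambda>b. if b < n then cbox (snd y0 b - e) (snd y0 b + e) else {0})"
  have "compactin (product_topology (\<lambda>_. euclidean) UNIV) (PiE UNIV Z)"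
    unfolding compactin_PiE by (simp add: Z_def)
  then have Zc: "compact (PiE UNIV Z)" by (simp only: euclidean_product_topology compactin_euclidean_iff)
  have "compactin (product_topology (\<lambda>_. euclidean) UNIV) (PiE UNIV T)"
    unfolding compactin_PiE by (simp add: T_def)
  then have Tc: "compact (PiE UNIV T)" by (simp only: euclidean_product_topology compactin_euclidean_iff)
  have if_all: "(\<forall>a. if a < k then P a else Q a) \<longleftrightarrow> (\<forall>a\<ge>k. Q a) \<and> (\<forall>a<k. P a)" for P Q and k :: nat
    by (metis not_le)
  have z: "z \<in> Z a \<longleftrightarrow> (if a < m then \<bar>Re z - Re (fst y0 a)\<bar> \<le> e \<and> \<bar>Im z - Im (fst y0 a)\<bar> \<le> e else z = 0)" for z a
    unfolding Z_def abs_le_iff by (cases "a < m") (auto simp: in_cbox_complex_iff)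
  have t: "z \<in> T b \<longleftrightarrow> (if b < n then \<bar>z - snd y0 b\<bar> \<le> e else z = 0)" for z b
    unfolding T_def abs_le_iff by (cases "b < n") auto
  have zi: "fst y \<in> PiE UNIV Z \<longleftrightarrow> (\<forall>a\<ge>m. fst y a = 0) \<and> (\<forall>a<m. \<bar>co (ReZ a) y - co (ReZ a) y0\<bar> \<le> e \<and> \<bar>co (ImZ a) y - co (ImZ a) y0\<bar> \<le> e)" for y
    unfolding PiE_iff extensional_UNIV z co.simps if_all[symmetric] by simp
  have ti: "snd y \<in> PiE UNIV T \<longleftrightarrow> (\<forall>b\<ge>n. snd y b = 0) \<and> (\<forall>b<n. \<bar>co (RealX b) y - co (RealX b) y0\<bar> \<le> e)" for y
    unfolding PiE_iff extensional_UNIV t co.simps if_all[symmetric] by simp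
  have "{y \<in> model_space m n. \<forall>k\<in>coords m n. \<bar>co k y - co k y0\<bar> \<le> e} = PiE UNIV Z \<times> PiE UNIV T"
  proof (rule Set.set_eqI)
    fix y
    have "(\<forall>k\<in>coords m n. \<bar>co k y - co k y0\<bar> \<le> e) \<longleftrightarrow>
       (\<forall>a<m. \<bar>co (ReZ a) y - co (ReZ a) y0\<bar> \<le> e \<and> \<bar>co (ImZ a) y - co (ImZ a) y0\<bar> \<le> e) \<and> (\<forall>b<n. \<bar>co (RealX b) y - co (RealX b) y0\<bar> \<le> e)"
      by (auto simp: coords_def simp del: co.simps)
    then show "y \<in> {y \<in> model_space m n. \<forall>k\<in>coords m n. \<bar>co k y - co k y0\<bar> \<le> e} \<longleftrightarrow> y \<in> PiE UNIV Z \<times> PiE UNIV T"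
      unfolding mem_Times_iff zi ti by (auto simp: model_space_def mem_Times_iff simp del: co.simps)
  qed
  then show ?thesis using compact_Times[OF Zc Tc] by simp
qed

context complex_fol
begin

text \<open>The bump is built in one chart. It vanishes outside the image of a compact box, which is
  closed because the manifold is Hausdorff, so the extension by 0 is smooth.\<close>

lemma bump_function:
  assumes O: "openin X O'" and x: "x \<in> O'"
  shows "\<exists>b N K. smooth_function F b \<and> openin X N \<and> x \<in> N \<and> (\<forall>z\<in>N. b z = 1) \<and>
    closedin X K \<and> K \<subseteq> O' \<and> (\<forall>z. z \<notin> K \<longrightarrow> b z = 0)"
proof -
  have "x \<in> topspace X" using openin_subset[OF O] x by blast
  then obtain c y0 where c: "c \<in> charts F" and y0: "y0 \<in> fst c" "snd c y0 = x" by (rule obtain_chart) (rule that)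
  have "y0 \<in> {y \<in> fst c. snd c y \<in> O'}" using y0 x by simp
  from model_open_box[OF open_preimage[OF c O] this]
  obtain e where e: "e > 0" and box: "\<forall>y'\<in>model_space m n. (\<forall>k\<in>coords m n. \<bar>co k y' - co k y0\<bar> < e) \<longrightarrow> y' \<in> {y \<in> fst c. snd c y \<in> O'}"
    by (elim exE conjE) (rule that)
  define B where "B = {y \<in> model_space m n. \<forall>k\<in>coords m n. \<bar>co k y - co k y0\<bar> \<le> e/2}"
  have B: "B \<subseteq> {y \<in> fst c. snd c y \<in> O'}"
  proof
    fix y assume "y \<in> B"
    then have y: "y \<in> model_space m n" and ye: "\<forall>k\<in>coords m n. \<bar>co k y - co k y0\<bar> \<le> e/2" by (simp_all add: B_def)
    have "\<forall>k\<in>coords m n. \<bar>co k y - co k y0\<bar> < e"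
    proof
      fix k assume "k \<in> coords m n"
      from bspec[OF ye this] show "\<bar>co k y - co k y0\<bar> < e" using e by linarith
    qed
    then show "y \<in> {y \<in> fst c. snd c y \<in> O'}" by (rule mp[OF bspec[OF box y]])
  qed
  define K where "K = snd c ` B"
  have "compact B" unfolding B_def by (rule compact_box)
  then have "compactin (top_of_set (fst c)) B" using B by (auto simp: compactin_subtopology)
  moreover have "continuous_map (top_of_set (fst c)) X (snd c)"
    using homeomorphic_imp_continuous_map[OF chart_facts(3)[OF c]] by (rule continuous_map_into_fulltopology)
  ultimately have "compactin X K" unfolding K_def by (rule image_compactin)
  then have K: "closedin X K" by (rule compactin_imp_closedin[OF Hausdorff])
  define \<rho> where "\<rho> = (\<lambda>y. \<Sum>k\<in>coords m n. (co k y - co k y0)\<^sup>2)"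
  \<comment> \<open>Outside the box of half-width \<open>e/2\<close> some coordinate contributes at
    least \<open>(e/2)\<^sup>2\<close> to \<open>\<rho>\<close>, so \<open>\<beta>\<close> vanishes
    there, while it is 1 where \<open>\<rho> < r/2\<close>.\<close>
  define r where "r = (e/2)\<^sup>2"
  have r: "r > 0" using e by (simp add: r_def)
  \<comment> \<open>The denominator is positive because \<open>r - \<rho> y\<close> and
    \<open>\<rho> y - r/2\<close> add up to \<open>r/2\<close>, so one of them is positive.\<close>
  define \<beta> where "\<beta> = (\<lambda>y. flat 0 (r - \<rho> y) / (flat 0 (r - \<rho> y) + flat 0 (\<rho> y - r/2)))"
  have pos: "flat 0 (r - \<rho> y) + flat 0 (\<rho> y - r/2) > 0" for y
    using r by (auto simp: flat_def add_pos_nonneg add_nonneg_pos)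
  have S: "model_open m n (fst c)" by (rule chart_open[OF c])
  have s\<rho>: "smooth_on m n (fst c) (\<lambda>y. of_real (\<rho> y))"
  proof -
    have "smooth_on m n (fst c) (\<lambda>y. \<Sum>k\<in>coords m n. (of_real (co k y) - of_real (co k y0)) * (of_real (co k y) - of_real (co k y0)))"
      by (intro smooth_on_sum smooth_on_mult smooth_on_diff smooth_on_co smooth_on_const S)
    then show ?thesis by (simp add: \<rho>_def power2_eq_square)
  qed
  have s1: "smooth_on m n (fst c) (\<lambda>y. of_real (r - \<rho> y))"
    using smooth_on_diff[OF S smooth_on_const[of m n _ "of_real r"] s\<rho>] by simp
  have s2: "smooth_on m n (fst c) (\<lambda>y. of_real (\<rho> y - r/2))"
    using smooth_on_diff[OF S s\<rho> smooth_on_const[of m n _ "of_real (r/2)"]] by simp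
  have s\<beta>: "smooth_on m n (fst c) (\<lambda>y. of_real (\<beta> y))"
  proof -
    have "smooth_on m n (fst c) (\<lambda>y. of_real (flat 0 (r - \<rho> y)) * inverse (of_real (flat 0 (r - \<rho> y)) + of_real (flat 0 (\<rho> y - r/2))))"
    proof (intro smooth_on_mult smooth_on_inverse smooth_on_add S smooth_on_flat[OF S s1] smooth_on_flat[OF S s2])
      fix y :: model
      have "flat 0 (r - \<rho> y) + flat 0 (\<rho> y - r/2) \<noteq> 0" using pos[of y] by linarith
      then show "of_real (flat 0 (r - \<rho> y)) + of_real (flat 0 (\<rho> y - r/2)) \<noteq> (0::complex)"
        unfolding of_real_add[symmetric] of_real_eq_0_iff .
    qed
    then show ?thesis by (simp only: \<beta>_def divide_inverse of_real_mult of_real_inverse of_real_add)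
  qed
  have \<beta>0: "\<beta> y = 0" if "y \<in> model_space m n" "y \<notin> B" for y
  proof -
    have "\<exists>k\<in>coords m n. \<not> \<bar>co k y - co k y0\<bar> \<le> e/2" using that unfolding B_def mem_Collect_eq by blast
    then obtain k where k: "k \<in> coords m n" "\<not> \<bar>co k y - co k y0\<bar> \<le> e/2" by (rule bexE)
    have "(e/2)\<^sup>2 \<le> \<bar>co k y - co k y0\<bar>\<^sup>2" by (rule power_mono) (use k(2) e in simp_all)
    then have "r \<le> (co k y - co k y0)\<^sup>2" unfolding r_def by simp
    also have "\<dots> \<le> \<rho> y" unfolding \<rho>_def by (rule member_le_sum[OF k(1)]) auto
    finally show ?thesis by (simp add: \<beta>_def flat_def)
  qed
  define b where "b = (\<lambda>z. if z \<in> chart_image c then of_real (\<beta> (adapted c z)) else (0::complex))"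
  have b0: "b z = 0" if "z \<notin> K" for z
  proof (cases "z \<in> chart_image c")
    case True
    have "adapted c z \<notin> B" using that snd_adapted[OF True] unfolding K_def by (metis imageI)
    moreover have "adapted c z \<in> model_space m n" using adapted_in[OF True] model_open_imp_subset[OF S] by blast
    ultimately show ?thesis using \<beta>0 by (simp add: b_def)
  qed (simp add: b_def)
  define P where "P = fst c \<inter> {y. \<rho> y < r/2}"
  have "open {y. \<rho> y < r/2}" unfolding \<rho>_def by (intro open_Collect_less continuous_intros)
  then have P: "model_open m n P" unfolding P_def using S by (auto simp: openin_open)
  have N: "openin X (snd c ` P)" by (rule open_image[OF c P]) (simp add: P_def)
  have "\<rho> y0 = 0" by (simp add: \<rho>_def)
  then have xN: "x \<in> snd c ` P" using y0 r by (auto simp: P_def)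
  have b1: "b z = 1" if "z \<in> snd c ` P" for z
  proof -
    obtain y where y: "y \<in> P" "z = snd c y" using \<open>z \<in> snd c ` P\<close> by (rule imageE)
    have yc: "y \<in> fst c" and ry: "\<rho> y < r/2" using y(1) by (simp_all add: P_def)
    have "b z = of_real (\<beta> y)" using adapted_snd[OF c yc] chart_imageI[OF yc] y(2) by (simp add: b_def)
    moreover have "flat 0 (\<rho> y - r/2) = 0" using ry by (simp add: flat_def)
    then have "\<beta> y = 1" using pos[of y] by (simp add: \<beta>_def)
    ultimately show ?thesis by simp
  qed
  have sb: "smooth_function F b"
    unfolding smooth_function_def
  proof
    fix c' assume c': "c' \<in> charts F"
    show "smooth_on m n (fst c') (b \<circ> snd c')"
    proof (rule smooth_on_local[OF _ model_open_imp_subset[OF chart_open[OF c']]])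
      fix y assume y: "y \<in> fst c'"
      show "\<exists>S'. model_open m n S' \<and> y \<in> S' \<and> smooth_on m n S' (b \<circ> snd c')"
      proof (cases "snd c' y \<in> chart_image c")
        case True
        have "smooth_on m n (overlap c' c) (b \<circ> snd c')"
          by (rule smooth_on_cong[OF overlap_open[OF c' c] _ transition_smooth_compose[OF c' c s\<beta>]])
             (simp add: b_def overlap_def transition_def)
        then show ?thesis using overlap_open[OF c' c] True y by (intro exI[of _ "overlap c' c"]) (simp add: overlap_def)
      next
        case False
        have "K \<subseteq> chart_image c" using B by (auto simp: K_def chart_image_def)
        then have yK: "snd c' y \<in> topspace X - K" using False chart_in_space[OF c' y] by blast
        have "openin X (topspace X - K)" using K by (rule openin_diff[OF openin_topspace])
        note o = open_preimage[OF c' this]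
        have "smooth_on m n {y \<in> fst c'. snd c' y \<in> topspace X - K} (b \<circ> snd c')"
          by (rule smooth_on_cong[OF o _ smooth_on_const[of m n _ 0]]) (simp add: b0)
        then show ?thesis using o yK y by (intro exI[of _ "{y \<in> fst c'. snd c' y \<in> topspace X - K}"]) simp
      qed
    qed
  qed
  have KO: "K \<subseteq> O'" using B by (auto simp: K_def)
  show ?thesis
  proof (rule exI[of _ b], rule exI[of _ "snd c ` P"], rule exI[of _ K], intro conjI ballI allI impI)
    show "b z = 1" if "z \<in> snd c ` P" for z by (rule b1[OF that])
    show "b z = 0" if "z \<notin> K" for z by (rule b0[OF that])
  qed (rule sb N xN K KO)+
qed

lemma prod_telescope:
  fixes b :: "nat \<Rightarrow> 'c::comm_ring_1"
  shows "(\<Sum>i<k. b i * (\<Prod>j<i. 1 - b j)) = 1 - (\<Prod>j<k. 1 - b j)"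
  by (induction k) (simp_all add: algebra_simps)

text \<open>The functions \<open>w\<^sub>i = b\<^sub>i \<Prod>\<^sub>j\<^sub><\<^sub>i (1 - b\<^sub>j)\<close> form a partition of unity which is automatically locally
  finite: \<open>w\<^sub>i\<close> vanishes where some \<open>b\<^sub>j\<close> with \<open>j < i\<close> equals 1.\<close>

lemma smooth_separation:
  assumes U: "openin X U" and V: "openin X V" and UV: "U \<union> V = topspace X"
  shows "\<exists>\<mu>. smooth_function F \<mu> \<and>
    (\<forall>x\<in>U - V. \<exists>N. openin X N \<and> x \<in> N \<and> (\<forall>z\<in>N. \<mu> z = 0)) \<and>
    (\<forall>x\<in>V - U. \<exists>N. openin X N \<and> x \<in> N \<and> (\<forall>z\<in>N. \<mu> z = 1))"
proof (cases "topspace X = {}")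
  case True
  then show ?thesis using smooth_function_const UV by (intro exI[of _ "\<lambda>x. 0"]) auto
next
  case False
  define Q where "Q = (\<lambda>x b N K. smooth_function F b \<and> openin X N \<and> x \<in> N \<and> (\<forall>z\<in>N. b z = 1) \<and>
    closedin X K \<and> (K \<subseteq> U \<or> K \<subseteq> V) \<and> (\<forall>z. z \<notin> K \<longrightarrow> b z = 0))"
  have "\<forall>x\<in>topspace X. \<exists>b N K. Q x b N K"
  proof
    fix x assume "x \<in> topspace X"
    then have "\<exists>O'. openin X O' \<and> x \<in> O' \<and> (O' \<subseteq> U \<or> O' \<subseteq> V)" using U V UV by blast
    then obtain O' where O: "openin X O'" "x \<in> O'" "O' \<subseteq> U \<or> O' \<subseteq> V" by (elim exE conjE) (rule that)
    from bump_function[OF O(1,2)] show "\<exists>b N K. Q x b N K"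
    proof (elim exE conjE)
      fix b N K
      assume *: "smooth_function F b" "openin X N" "x \<in> N" "\<forall>z\<in>N. b z = 1" "closedin X K" "K \<subseteq> O'" "\<forall>z. z \<notin> K \<longrightarrow> b z = 0"
      have "K \<subseteq> U \<or> K \<subseteq> V" using O(3) *(6) by blast
      then have "Q x b N K" unfolding Q_def using * by (intro conjI)
      then show ?thesis by (intro exI)
    qed
  qed
  from bchoice[OF this] obtain bb where "\<forall>x\<in>topspace X. \<exists>N K. Q x (bb x) N K" by (rule exE)
  from bchoice[OF this] obtain NN where "\<forall>x\<in>topspace X. \<exists>K. Q x (bb x) (NN x) K" by (rule exE)
  from bchoice[OF this] obtain KK where "\<forall>x\<in>topspace X. Q x (bb x) (NN x) (KK x)" by (rule exE)
  note bnk = bspec[OF this, unfolded Q_def]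
  have oNN: "openin X (NN x)" if "x \<in> topspace X" for x by (rule conjunct1[OF conjunct2[OF bnk[OF that]]])
  have xNN: "x \<in> NN x" if "x \<in> topspace X" for x by (rule conjunct1[OF conjunct2[OF conjunct2[OF bnk[OF that]]]])
  have "\<exists>\<V>. countable \<V> \<and> \<V> \<subseteq> NN ` topspace X \<and> \<Union>\<V> = topspace X"
  proof (rule Lindelof_spaceD[OF second_countable_imp_Lindelof_space[OF second_countable]])
    show "openin X N" if "N \<in> NN ` topspace X" for N using that oNN by (elim imageE) simp
    show "\<Union> (NN ` topspace X) = topspace X"
    proof (intro equalityI subsetI)
      fix x assume "x \<in> topspace X"
      then show "x \<in> \<Union> (NN ` topspace X)" using xNN by (intro UN_I)
    next
      fix x assume "x \<in> \<Union> (NN ` topspace X)"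
      then show "x \<in> topspace X" by (elim UN_E) (rule subsetD[OF openin_subset[OF oNN]])
    qed
  qed
  then obtain \<V> where \<V>: "countable \<V>" "\<V> \<subseteq> NN ` topspace X" "\<Union>\<V> = topspace X" by (elim exE conjE) (rule that)
  obtain C where C: "countable C" "C \<subseteq> topspace X" "\<V> = NN ` C"
    using countable_subset_image[of \<V> NN "topspace X"] \<V>(1,2) by blast
  have "C \<noteq> {}"
  proof
    assume "C = {}"
    then have "topspace X = {}" unfolding \<V>(3)[symmetric] C(3) by simp
    then show False by (rule notE[OF False])
  qed
  \<comment> \<open>An enumeration by all natural numbers, possibly with repetitions, treats finite
    and infinite \<open>C\<close> alike; the products over \<open>j < i\<close> refer to its
    order.\<close>
  define pt where "pt = from_nat_into C"
  have rpt: "range pt = C" unfolding pt_def by (rule range_from_nat_into[OF \<open>C \<noteq> {}\<close> C(1)])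
  have pt: "pt i \<in> topspace X" for i using rpt C(2) by blast
  define b N K where "b = (\<lambda>i. bb (pt i))" and "N = (\<lambda>i. NN (pt i))" and "K = (\<lambda>i. KK (pt i))"
  have sb: "smooth_function F (b i)" for i
    unfolding b_def by (rule bnk[OF pt, THEN conjunct1])
  have oN: "openin X (N i)" for i
    unfolding N_def by (rule bnk[OF pt, THEN conjunct2, THEN conjunct1])
  have bN: "b i z = 1" if "z \<in> N i" for i z
    using that unfolding b_def N_def by (rule bnk[OF pt, THEN conjunct2, THEN conjunct2, THEN conjunct2, THEN conjunct1, THEN bspec])
  have cK: "closedin X (K i)" for i
    unfolding K_def by (rule bnk[OF pt, THEN conjunct2, THEN conjunct2, THEN conjunct2, THEN conjunct2, THEN conjunct1])
  have KUV: "K i \<subseteq> U \<or> K i \<subseteq> V" for i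
    unfolding K_def by (rule bnk[OF pt, THEN conjunct2, THEN conjunct2, THEN conjunct2, THEN conjunct2, THEN conjunct2, THEN conjunct1])
  have bK: "b i z = 0" if "z \<notin> K i" for i z
    using that unfolding b_def K_def
    by (rule bnk[OF pt, THEN conjunct2, THEN conjunct2, THEN conjunct2, THEN conjunct2, THEN conjunct2, THEN conjunct2, THEN spec, THEN mp])
  have covN: "\<exists>i. x \<in> N i" if "x \<in> topspace X" for x
  proof -
    obtain p where p: "p \<in> C" "x \<in> NN p" using \<open>x \<in> topspace X\<close> \<V>(3) C(3) by blast
    then obtain i where "p = pt i" using rpt by blast
    then show ?thesis using p by (auto simp: N_def)
  qed
  define w where "w = (\<lambda>i z. b i z * (\<Prod>j<i. 1 - b j z))"
  have w0: "w i z = 0" if "z \<in> N k" "k < i" for i k z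
  proof -
    have "(\<Prod>j<i. 1 - b j z) = 0" by (rule prod_zero[OF finite_lessThan]) (use that bN in auto)
    then show ?thesis by (simp add: w_def)
  qed
  \<comment> \<open>Indices outside \<open>I\<close> have \<open>K i \<subseteq> U\<close>. So a
    point of \<open>U - V\<close> lies in no \<open>K i\<close> with \<open>i \<in> I\<close>, and a
    point of \<open>V - U\<close> lies in no \<open>K i\<close> with
    \<open>i \<notin> I\<close>.\<close>
  define I where "I = {i. K i \<subseteq> V}"
  \<comment> \<open>The sum stops at the first \<open>N i\<close> that contains \<open>z\<close>,
    since all later \<open>w i\<close> vanish at \<open>z\<close>. Any \<open>k\<close> with
    \<open>z \<in> N k\<close> gives the same value, so on the open set \<open>N k\<close> the range
    of summation can be fixed.\<close>
  define \<mu> where "\<mu> = (\<lambda>z. \<Sum>i<Suc (LEAST i. z \<in> N i). if i \<in> I then w i z else 0)"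
  have \<mu>: "\<mu> z = (\<Sum>i<Suc k. if i \<in> I then w i z else 0)" if z: "z \<in> N k" for z k
  proof -
    define l where "l = (LEAST i. z \<in> N i)"
    have l: "z \<in> N l" "l \<le> k" using z by (auto simp: l_def intro: LeastI Least_le)
    show ?thesis unfolding \<mu>_def l_def[symmetric]
      by (rule sum.mono_neutral_left) (use l w0[OF l(1)] in auto)
  qed
  have tot: "(\<Sum>i<Suc k. w i z) = 1" if z: "z \<in> N k" for z k
  proof -
    have "(\<Prod>j<Suc k. 1 - b j z) = 0" by (rule prod_zero[OF finite_lessThan]) (use z bN in auto)
    then show ?thesis unfolding w_def prod_telescope by simp
  qed
  have sw: "smooth_on m n (fst c) (w i \<circ> snd c)" if c: "c \<in> charts F" for i c
  proof -
    have "smooth_on m n (fst c) (\<lambda>y. b i (snd c y) * (\<Prod>j<i. 1 - b j (snd c y)))"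
      using sb c by (intro smooth_on_mult smooth_on_prod smooth_on_diff smooth_on_const chart_open)
        (simp_all add: smooth_function_def o_def)
    then show ?thesis by (simp add: w_def o_def)
  qed
  have s\<mu>: "smooth_function F \<mu>"
    unfolding smooth_function_def
  proof
    fix c assume c: "c \<in> charts F"
    show "smooth_on m n (fst c) (\<mu> \<circ> snd c)"
    proof (rule smooth_on_local[OF _ model_open_imp_subset[OF chart_open[OF c]]])
      fix y assume y: "y \<in> fst c"
      obtain k where k: "snd c y \<in> N k" using covN[OF chart_in_space[OF c y]] by blast
      define S where "S = {y \<in> fst c. snd c y \<in> N k}"
      have S: "model_open m n S" unfolding S_def by (rule open_preimage[OF c oN])
      have "smooth_on m n S (\<lambda>y. \<Sum>i<Suc k. if i \<in> I then (w i \<circ> snd c) y else 0)"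
      proof (rule smooth_on_sum[OF S])
        fix i show "smooth_on m n S (\<lambda>y. if i \<in> I then (w i \<circ> snd c) y else 0)"
          using smooth_on_subset[OF sw[OF c, of i], of S] smooth_on_const[of m n S 0]
          by (cases "i \<in> I") (auto simp: S_def o_def)
      qed
      then have "smooth_on m n S (\<mu> \<circ> snd c)"
        by (rule smooth_on_cong[OF S, rotated]) (simp add: S_def \<mu>[where k = k] del: sum.lessThan_Suc cong: if_cong)
      then show "\<exists>S'. model_open m n S' \<and> y \<in> S' \<and> smooth_on m n S' (\<mu> \<circ> snd c)"
        using S k y by (intro exI[of _ S]) (simp add: S_def)
    qed
  qed
  \<comment> \<open>On \<open>N k\<close> only the indices up to \<open>k\<close> count, so finitely
    many closed sets \<open>K i\<close> have to be removed and the rest is still open.\<close>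
  have near: "\<exists>M k. openin X M \<and> x \<in> M \<and> M \<subseteq> N k \<and> (\<forall>z\<in>M. \<forall>i\<in>J. i < Suc k \<longrightarrow> w i z = 0)"
    if x: "x \<in> topspace X" and J: "\<And>i. i \<in> J \<Longrightarrow> x \<notin> K i" for x J
  proof -
    obtain k where k: "x \<in> N k" using covN[OF x] by blast
    define M where "M = N k - \<Union> (K ` (J \<inter> {..<Suc k}))"
    have "closedin X (\<Union> (K ` (J \<inter> {..<Suc k})))"
      by (rule closedin_Union) (use cK in auto)
    then have "openin X M" unfolding M_def by (rule openin_diff[OF oN])
    moreover have "x \<in> M" using k J by (auto simp: M_def)
    moreover have "w i z = 0" if "z \<in> M" "i \<in> J" "i < Suc k" for i z
      using that bK[of z i] by (auto simp: M_def w_def)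
    ultimately show ?thesis by (intro exI[of _ M] exI[of _ k]) (auto simp: M_def)
  qed
  have "\<exists>M. openin X M \<and> x \<in> M \<and> (\<forall>z\<in>M. \<mu> z = 0)" if x: "x \<in> U - V" for x
  proof -
    have "x \<in> topspace X" using x UV by blast
    from near[OF this, of I] x obtain M k where M: "openin X M" "x \<in> M" "M \<subseteq> N k" "\<forall>z\<in>M. \<forall>i\<in>I. i < Suc k \<longrightarrow> w i z = 0"
      unfolding I_def by blast
    have "\<mu> z = 0" if "z \<in> M" for z
    proof -
      have "z \<in> N k" using M(3) that by blast
      then show ?thesis unfolding \<mu>[OF \<open>z \<in> N k\<close>] by (intro sum.neutral ballI) (use M(4) that in auto)
    qed
    then show ?thesis using M by blast
  qed
  moreover have "\<exists>M. openin X M \<and> x \<in> M \<and> (\<forall>z\<in>M. \<mu> z = 1)" if x: "x \<in> V - U" for x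
  proof -
    have xX: "x \<in> topspace X" using x UV by blast
    have "x \<notin> K i" if "i \<in> - I" for i using that x KUV[of i] by (auto simp: I_def)
    from near[OF xX, of "- I"] this obtain M k where M: "openin X M" "x \<in> M" "M \<subseteq> N k" "\<forall>z\<in>M. \<forall>i\<in>-I. i < Suc k \<longrightarrow> w i z = 0"
      by blast
    have "\<mu> z = 1" if "z \<in> M" for z
    proof -
      have z: "z \<in> N k" using M(3) that by blast
      have "\<mu> z = (\<Sum>i<Suc k. w i z)"
        unfolding \<mu>[OF z] by (intro sum.cong refl) (use M(4) that in auto)
      then show ?thesis using tot[OF z] by simp
    qed
    then show ?thesis using M by blast
  qed
  ultimately show ?thesis using s\<mu> by (intro exI[of _ \<mu>] conjI ballI)
qed

lemma Frm_split:
  assumes U: "openin X U" and V: "openin X V" and UV: "U \<union> V = topspace X" and \<sigma>: "\<sigma> \<in> Frm (U \<inter> V) p q"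
  shows "\<exists>\<alpha>\<in>Frm U p q. \<exists>\<beta>\<in>Frm V p q. \<sigma> = restrict_form (U \<inter> V) \<alpha> - restrict_form (U \<inter> V) \<beta>"
proof -
  obtain \<mu> where \<mu>: "smooth_function F \<mu>"
    "\<forall>x\<in>U - V. \<exists>N. openin X N \<and> x \<in> N \<and> (\<forall>z\<in>N. \<mu> z = 0)"
    "\<forall>x\<in>V - U. \<exists>N. openin X N \<and> x \<in> N \<and> (\<forall>z\<in>N. \<mu> z = 1)"
    using smooth_separation[OF U V UV] by blast
  have \<nu>: "smooth_function F (\<lambda>x. \<mu> x - 1)"
    unfolding smooth_function_def
  proof
    fix c assume c: "c \<in> charts F"
    have "smooth_on m n (fst c) (\<lambda>y. (\<mu> \<circ> snd c) y - 1)"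
      using \<mu>(1) c by (intro smooth_on_diff smooth_on_const chart_open) (simp_all add: smooth_function_def o_def)
    then show "smooth_on m n (fst c) ((\<lambda>x. \<mu> x - 1) \<circ> snd c)" by (simp add: o_def)
  qed
  define \<alpha> where "\<alpha> = (\<lambda>x Xs. \<mu> x * \<sigma> x Xs)"
  define \<beta> where "\<beta> = (\<lambda>x Xs. (\<mu> x - 1) * \<sigma> x Xs)"
  have "\<alpha> \<in> Frm U p q"
  proof (rule Frm_extend[OF _ U Int_lower1[of U V]])
    show "\<alpha> \<in> Frm (U \<inter> V) p q" unfolding \<alpha>_def by (rule Frm_mult[OF \<sigma> \<mu>(1)])
    fix x assume "x \<in> U - U \<inter> V"
    then have "x \<in> U - V" by blast
    from bspec[OF \<mu>(2) this] obtain N where N: "openin X N" "x \<in> N" "\<forall>z\<in>N. \<mu> z = 0" by blast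
    then show "\<exists>N. openin X N \<and> x \<in> N \<and> (\<forall>z\<in>N. \<forall>Xs. \<alpha> z Xs = 0)"
      by (intro exI[of _ N]) (simp add: \<alpha>_def)
  qed
  moreover have "\<beta> \<in> Frm V p q"
  proof (rule Frm_extend[OF _ V Int_lower2[of U V]])
    show "\<beta> \<in> Frm (U \<inter> V) p q" unfolding \<beta>_def by (rule Frm_mult[OF \<sigma> \<nu>])
    fix x assume "x \<in> V - U \<inter> V"
    then have "x \<in> V - U" by blast
    from bspec[OF \<mu>(3) this] obtain N where N: "openin X N" "x \<in> N" "\<forall>z\<in>N. \<mu> z = 1" by blast
    then show "\<exists>N. openin X N \<and> x \<in> N \<and> (\<forall>z\<in>N. \<forall>Xs. \<beta> z Xs = 0)"
      by (intro exI[of _ N]) (simp add: \<beta>_def)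
  qed
  moreover have "\<sigma> = restrict_form (U \<inter> V) \<alpha> - restrict_form (U \<inter> V) \<beta>"
  proof (intro ext)
    fix x Xs
    have "\<sigma> x Xs = 0" if "x \<notin> U \<inter> V" using supportedD[OF FrmD(1)[OF \<sigma>]] that by blast
    then show "\<sigma> x Xs = (restrict_form (U \<inter> V) \<alpha> - restrict_form (U \<inter> V) \<beta>) x Xs"
      by (auto simp: restrict_form_def \<alpha>_def \<beta>_def algebra_simps)
  qed
  ultimately show ?thesis by blast
qed

end

section \<open>The long exact sequence\<close>

lemma zero_form_eq: "zero_form = 0"
  by (intro ext) (simp add: zero_form_def)

lemma add_form_eq: "add_form = (+)"
  by (intro ext) (simp add: add_form_def)

lemma diff_form_eq: "diff_form = (-)"
  by (intro ext) (simp add: diff_form_def)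

text \<open>The passage from the groups of the statement to the abstract ones: the operations on
  forms are the pointwise operations of the function type.\<close>

lemma cohomology_eq:
  assumes "cochain_complex (foliated_forms G p) (dbar_f G f p)"
  shows "cocycles G f p = cochain_complex.Z (foliated_forms G p) (dbar_f G f p)"
    and "cohomology G f p = cochain_complex.H (foliated_forms G p) (dbar_f G f p)"
    and "coh_class G f p = cochain_complex.cls (foliated_forms G p) (dbar_f G f p)"
proof -
  interpret C: cochain_complex "foliated_forms G p" "dbar_f G f p" by (rule assms)
  show Z: "cocycles G f p = C.Z"
    by (rule ext) (simp add: cocycles_def C.Z_def zero_form_eq)
  have B: "coboundaries G f p q = C.B q" for q
    by (cases q) (simp_all add: C.B_def zero_form_eq)
  have G: "cocycle_group G f p q = C.G q" for q
    by (simp add: cocycle_group_def C.G_def Z add_form_eq zero_form_eq)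
  show "cohomology G f p = C.H"
    by (rule ext) (simp add: cohomology_def C.H_def G B)
  show "coh_class G f p = C.cls"
    by (intro ext) (simp add: coh_class_def C.cls_def G B)
qed

lemma restrict_form_add: "restrict_form W (\<phi> + \<psi>) = restrict_form W \<phi> + restrict_form W \<psi>"
  by (intro ext) (simp add: restrict_form_def)

lemma restrict_form_scale: "restrict_form W (scale_form k \<phi>) = scale_form k (restrict_form W \<phi>)"
  by (intro ext) (simp add: restrict_form_def scale_form_def)

lemma restrict_form_restrict_form: "W' \<subseteq> W \<Longrightarrow> restrict_form W' (restrict_form W \<phi>) = restrict_form W' \<phi>"
  by (intro ext) (auto simp: restrict_form_def)

lemma scale_form_add: "scale_form k (\<phi> + \<psi>) = scale_form k \<phi> + scale_form k \<psi>"
  by (intro ext) (simp add: scale_form_def algebra_simps)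

context complex_fol
begin

lemma cochain_complex_Frm:
  assumes f: "smooth_function F f" and W: "openin X W" and d: "\<And>q. is_d W f p q (d q)"
  shows "cochain_complex (Frm W p) d"
proof
  fix q x y assume x: "x \<in> Frm W p q"
  show "- x \<in> Frm W p q" by (rule Frm_uminus[OF x])
  show "d q x \<in> Frm W p (Suc q)" by (rule is_d_Frm[OF f d x])
  show "d (Suc q) (d q x) = 0" by (rule is_d_is_d[OF f openin_subset[OF W] W d d x])
  assume y: "y \<in> Frm W p q"
  show "x + y \<in> Frm W p q" by (rule Frm_add[OF x y])
  show "d q (x + y) = d q x + d q y" by (rule is_d_add[OF f openin_subset[OF W] d x y])
qed (rule Frm_zero[OF W])

lemma Frm_eq_0I:
  assumes \<phi>: "\<phi> \<in> Frm (U \<union> V) p q" and 0: "restrict_form U \<phi> = 0" "restrict_form V \<phi> = 0"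
  shows "\<phi> = 0"
proof (intro ext)
  fix x Xs
  consider "x \<in> U" | "x \<in> V" | "x \<notin> U \<union> V" by blast
  then show "\<phi> x Xs = 0 x Xs"
  proof cases
    case 1
    then show ?thesis using fun_cong[OF fun_cong[OF 0(1), of x], of Xs] by (simp add: restrict_form_def)
  next
    case 2
    then show ?thesis using fun_cong[OF fun_cong[OF 0(2), of x], of Xs] by (simp add: restrict_form_def)
  next
    case 3
    then have "\<phi> x Xs = 0" by (intro supportedD[OF FrmD(1)[OF \<phi>]]) simp
    then show ?thesis by simp
  qed
qed

lemma mayer_vietoris_Frm:
  assumes f: "smooth_function F f" and U: "openin X U" and V: "openin X V" and UV: "U \<union> V = topspace X"
    and dM: "\<And>q. is_d (topspace X) f p q (dM q)" and dU: "\<And>q. is_d U f p q (dU q)"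
    and dV: "\<And>q. is_d V f p q (dV q)" and dI: "\<And>q. is_d (U \<inter> V) f p q (dI q)"
  shows "mayer_vietoris (Frm (topspace X) p) (Frm U p) (Frm V p) (Frm (U \<inter> V) p) dM dU dV dI
    (restrict_form U) (restrict_form V) (restrict_form (U \<inter> V)) scale_form"
proof -
  note I = openin_Int[OF U V]
  note sub = openin_subset[OF U] openin_subset[OF V] openin_subset[OF I]
  interpret M: cochain_complex "Frm (topspace X) p" dM by (rule cochain_complex_Frm[OF f openin_topspace dM])
  interpret U: cochain_complex "Frm U p" dU by (rule cochain_complex_Frm[OF f U dU])
  interpret V: cochain_complex "Frm V p" dV by (rule cochain_complex_Frm[OF f V dV])
  interpret I: cochain_complex "Frm (U \<inter> V) p" dI by (rule cochain_complex_Frm[OF f I dI])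
  show ?thesis
  proof unfold_locales
    fix q x assume x: "x \<in> Frm (topspace X) p q"
    show "restrict_form U x \<in> Frm U p q" by (rule restrict_form_Frm[OF x U sub(1)])
    show "restrict_form V x \<in> Frm V p q" by (rule restrict_form_Frm[OF x V sub(2)])
    show "restrict_form U (dM q x) = dU q (restrict_form U x)"
      by (rule is_d_restrict_form[OF f subset_refl U sub(1) dM dU x])
    show "restrict_form V (dM q x) = dV q (restrict_form V x)"
      by (rule is_d_restrict_form[OF f subset_refl V sub(2) dM dV x])
    show "restrict_form (U \<inter> V) (restrict_form U x) = restrict_form (U \<inter> V) (restrict_form V x)"
      by (simp add: restrict_form_restrict_form)
    show "x = 0" if "restrict_form U x = 0" "restrict_form V x = 0"
      by (rule Frm_eq_0I[OF x[folded UV] that])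
    fix k
    show "scale_form k x \<in> Frm (topspace X) p q" by (rule Frm_scale[OF x])
    show "dM q (scale_form k x) = scale_form k (dM q x)" by (rule is_d_scale[OF f subset_refl dM x])
  next
    fix q x assume x: "x \<in> Frm U p q"
    show "restrict_form (U \<inter> V) x \<in> Frm (U \<inter> V) p q" by (rule restrict_form_Frm[OF x I Int_lower1])
    show "restrict_form (U \<inter> V) (dU q x) = dI q (restrict_form (U \<inter> V) x)"
      by (rule is_d_restrict_form[OF f sub(1) I Int_lower1 dU dI x])
    fix k
    show "scale_form k x \<in> Frm U p q" by (rule Frm_scale[OF x])
    show "dU q (scale_form k x) = scale_form k (dU q x)" by (rule is_d_scale[OF f sub(1) dU x])
    fix y assume y: "y \<in> Frm V p q" "restrict_form (U \<inter> V) x = restrict_form (U \<inter> V) y"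
    show "\<exists>z\<in>Frm (topspace X) p q. restrict_form U z = x \<and> restrict_form V z = y"
      by (rule Frm_glue[OF x y(1) U V y(2), unfolded UV])
  next
    fix q x assume x: "x \<in> Frm V p q"
    show "restrict_form (U \<inter> V) x \<in> Frm (U \<inter> V) p q" by (rule restrict_form_Frm[OF x I Int_lower2])
    show "restrict_form (U \<inter> V) (dV q x) = dI q (restrict_form (U \<inter> V) x)"
      by (rule is_d_restrict_form[OF f sub(2) I Int_lower2 dV dI x])
    fix k
    show "scale_form k x \<in> Frm V p q" by (rule Frm_scale[OF x])
    show "dV q (scale_form k x) = scale_form k (dV q x)" by (rule is_d_scale[OF f sub(2) dV x])
  next
    fix q x assume x: "x \<in> Frm (U \<inter> V) p q"
    show "\<exists>a\<in>Frm U p q. \<exists>b\<in>Frm V p q. x = restrict_form (U \<inter> V) a - restrict_form (U \<inter> V) b"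
      by (rule Frm_split[OF U V UV x])
    fix k
    show "scale_form k x \<in> Frm (U \<inter> V) p q" by (rule Frm_scale[OF x])
    show "dI q (scale_form k x) = scale_form k (dI q x)" by (rule is_d_scale[OF f sub(3) dI x])
  qed (simp_all add: restrict_form_add restrict_form_scale scale_form_add)
qed

end

theorem theorem2p1:
  fixes F :: "'a foliated" and f :: "'a \<Rightarrow> complex" and U V :: "'a set" and p :: nat
  assumes "complex_foliation F"
    and "smooth_function F f"
    and "openin (mtop F) U" and "openin (mtop F) V" and "U \<union> V = topspace (mtop F)"
  defines "H \<equiv> cohomology F f p"
    and "HU \<equiv> cohomology (restrict_foliation F U) f p"
    and "HV \<equiv> cohomology (restrict_foliation F V) f p"
    and "HUV \<equiv> cohomology (restrict_foliation F (U \<inter> V)) f p"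
  shows "\<exists>A B \<delta>.
    (\<forall>q. group_hom (H q) (HU q \<times>\<times> HV q) (A q) \<and>
         group_hom (HU q \<times>\<times> HV q) (HUV q) (B q) \<and>
         group_hom (HUV q) (H (Suc q)) (\<delta> q)) \<and>
    (\<forall>q. \<forall>\<phi>\<in>cocycles F f p q.
       A q (coh_class F f p q \<phi>) =
         (coh_class (restrict_foliation F U) f p q (restrict_form U \<phi>),
          coh_class (restrict_foliation F V) f p q (restrict_form V \<phi>))) \<and>
    (\<forall>q. \<forall>\<sigma>\<in>cocycles (restrict_foliation F U) f p q. \<forall>\<tau>\<in>cocycles (restrict_foliation F V) f p q.
       B q (coh_class (restrict_foliation F U) f p q \<sigma>, coh_class (restrict_foliation F V) f p q \<tau>) =
         coh_class (restrict_foliation F (U \<inter> V)) f p q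
           (diff_form (restrict_form (U \<inter> V) \<sigma>) (restrict_form (U \<inter> V) \<tau>))) \<and>
    (\<forall>q k. \<forall>\<sigma>\<in>cocycles (restrict_foliation F (U \<inter> V)) f p q. \<forall>\<psi>\<in>cocycles F f p (Suc q).
       \<delta> q (coh_class (restrict_foliation F (U \<inter> V)) f p q \<sigma>) = coh_class F f p (Suc q) \<psi> \<longrightarrow>
       \<delta> q (coh_class (restrict_foliation F (U \<inter> V)) f p q (scale_form k \<sigma>)) =
         coh_class F f p (Suc q) (scale_form k \<psi>)) \<and>
    kernel (H 0) (HU 0 \<times>\<times> HV 0) (A 0) = {\<one>\<^bsub>H 0\<^esub>} \<and>
    (\<forall>q. A q ` carrier (H q) = kernel (HU q \<times>\<times> HV q) (HUV q) (B q) \<and>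
         B q ` carrier (HU q \<times>\<times> HV q) = kernel (HUV q) (H (Suc q)) (\<delta> q) \<and>
         \<delta> q ` carrier (HUV q) = kernel (H (Suc q)) (HU (Suc q) \<times>\<times> HV (Suc q)) (A (Suc q)))"
proof -
  interpret complex_fol F by unfold_locales (rule assms(1))
  note f = assms(2) and U = assms(3) and V = assms(4) and UV = assms(5)
  note I = openin_Int[OF U V]
  have eq: "foliated_forms F p = Frm (topspace X) p" "foliated_forms (restrict_foliation F U) p = Frm U p"
    "foliated_forms (restrict_foliation F V) p = Frm V p"
    "foliated_forms (restrict_foliation F (U \<inter> V)) p = Frm (U \<inter> V) p"
    using foliated_forms_eq foliated_forms_restrict[OF U] foliated_forms_restrict[OF V] foliated_forms_restrict[OF I]
    by (intro ext; simp)+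
  \<comment> \<open>The complexes are named by \<open>foliated_forms\<close>, so that the abstract
    groups become those of the statement; the axioms are verified after rewriting to
    \<open>Frm\<close>.\<close>
  interpret mayer_vietoris "foliated_forms F p" "foliated_forms (restrict_foliation F U) p"
    "foliated_forms (restrict_foliation F V) p" "foliated_forms (restrict_foliation F (U \<inter> V)) p"
    "dbar_f F f p" "dbar_f (restrict_foliation F U) f p" "dbar_f (restrict_foliation F V) f p"
    "dbar_f (restrict_foliation F (U \<inter> V)) f p"
    "restrict_form U" "restrict_form V" "restrict_form (U \<inter> V)" scale_form
    unfolding eq
    by (rule mayer_vietoris_Frm[OF f U V UV is_d_dbar_f[OF f] is_d_restrict[OF U f] is_d_restrict[OF V f] is_d_restrict[OF I f]])
  note cohomology = cohomology_eq[OF M.cochain_complex_axioms] cohomology_eq[OF U.cochain_complex_axioms]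
    cohomology_eq[OF V.cochain_complex_axioms] cohomology_eq[OF I.cochain_complex_axioms]
  show ?thesis
    unfolding H_def HU_def HV_def HUV_def cohomology diff_form_eq by (rule exact_sequence)
qed

end
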